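(* Suppose that all the forms $f_{i,j}$ are monomials (so that $I_1,\ldots,I_p\subset R$ are monomial ideals). Then, for all $\mathbf{d}=(d_1,\ldots,d_p)\in\mathbb{N}^p$ with $|\mathbf{d}|=r$, we have $$\deg(\mathcal{G})\cdot\deg_{\mathbb{P}}^{\mathbf{d}}(Y)=\mathrm{MV}_r\Big(\big(\pi(\Gamma(I_1)),\ldots,\pi(\Gamma(I_p))\big)_{\mathbf{d}}\Big).$$
   Context: Let $k$ be an arbitrary field, $R=k[x_0,\ldots,x_r]$ a standard graded polynomial ring, and $p\ge 1$. For each $1\le i\le p$ let $\{f_{i,0},\ldots,f_{i,m_i}\}\subset R$ be a set of forms of the same degree $\delta_i\ge 1$, let $I_i=(f_{i,0},\ldots,f_{i,m_i})\subset R$, and let $\mathcal{G}_i:\mathbb{P}_k^r\dashrightarrow\mathbb{P}_k^{m_i}$ be the rational map $\mathbf{x}\mapsto(f_{i,0}(\mathbf{x}),\ldots,f_{i,m_i}(\mathbf{x}))$. Let $\mathcal{G}=(\mathcal{G}_1,\ldots,\mathcal{G}_p):\mathbb{P}_k^r\dashrightarrow\mathbb{P}:=\mathbb{P}_k^{m_1}\times_k\cdots\times_k\mathbb{P}_k^{m_p}$ and let $Y\subset\mathbb{P}$ be the closure of the image of $\mathcal{G}$. For $\mathbf{d}\in\mathbb{N}^p$, $|\mathbf{d}|=d_1+\cdots+d_p$. Multidegrees: let $P_Y(\mathbf{t})\in\mathbb{Q}[t_1,\ldots,t_p]$ be the multigraded Hilbert polynomial of $Y\subset\mathbb{P}$,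 i.e. of its $\mathbb{N}^p$-graded coordinate ring; it has degree $\dim Y\le r$. Writing $P_Y(\mathbf{t})=\sum_{\mathbf{d}}e(\mathbf{d})\binom{t_1+d_1}{d_1}\cdots\binom{t_p+d_p}{d_p}$, the multidegree of $Y$ of type $\mathbf{d}$, $|\mathbf{d}|=r$, is $\deg_{\mathbb{P}}^{\mathbf{d}}(Y):=e(\mathbf{d})$ (zero if $\dim Y<r$). Degree: with $K(\cdot)$ the field of rational functions, $\deg(\mathcal{G}):=[K(\mathbb{P}_k^r):K(Y)]$ if this is finite, and $\deg(\mathcal{G}):=0$ otherwise. Polytopes: for a monomial ideal $J\subset R$ with monomial generating set $G(J)$ (for $J=I_i$, take $G(I_i)=\{f_{i,0},\ldots,f_{i,m_i}\}$), $\Gamma(J)\subset\mathbb{R}^{r+1}$ is the convex hull of $\{(n_0,\ldots,n_r)\in\mathbb{N}^{r+1}\mid x_0^{n_0}\cdots x_r^{n_r}\in G(J)\}$. The map $\pi:\mathbb{R}^{r+1}\to\mathbb{R}^r$ is the projection $(x_0,x_1,\ldots,x_r)\mapsto(x_1,\ldots,x_r)$. Mixed volumes: for a sequence $\mathbf{K}=(K_1,\ldots,K_p)$ of convex bodies in $\mathbb{R}^r$ and $\mathbf{d}\in\mathbb{N}^p$, $\mathbf{K}_{\mathbf{d}}$ denotes the multiset consisting of $d_i$ copies of $K_i$ for each $i$. For $\lambda\in\mathbb{N}^p$, $\mathrm{Vol}_r(\lambda_1K_1+\cdots+\lambda_pK_p)$ (Minkowski sum) is a homogeneous polynomial of degree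 $r$ in $\lambda$, and the mixed volumes $\mathrm{MV}_r(\mathbf{K}_{\mathbf{d}})$ are defined by $$\mathrm{Vol}_r(\lambda_1K_1+\cdots+\lambda_pK_p)=\sum_{\mathbf{d}\in\mathbb{N}^p,\,|\mathbf{d}|=r}\frac{1}{d_1!\cdots d_p!}\,\mathrm{MV}_r(\mathbf{K}_{\mathbf{d}})\,\lambda_1^{d_1}\cdots\lambda_p^{d_p}.$$ *)

theory Defs
  imports
    "HOL-Analysis.Analysis"
    "HOL-Library.Poly_Mapping"
    "HOL-Computational_Algebra.Fraction_Field"
    "HOL-Algebra.QuotRing"
    "HOL-Algebra.Embedded_Algebras"
    "HOL-Algebra.Algebraic_Closure_Type"
begin

section \<open>Multivariate polynomials\<close>

text \<open>
  A polynomial over \<open>'c\<close> in variables of type \<open>'x\<close> is a finitely supported map from exponents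
  \<open>'x \<Rightarrow>\<^sub>0 nat\<close> to coefficients, with the convolution product of
  \<^theory>\<open>HOL-Library.Poly_Mapping\<close>. The ring \<open>R = k[x_0, ..., x_r]\<close> is \<open>('v, 'k) mpoly\<close> for a
  finite type \<open>'v\<close> with \<open>r + 1\<close> elements. The linear order required of \<open>'v\<close> below only serves to
  obtain the library instance \<open>idom\<close>, hence the fraction field of \<open>R\<close>.
\<close>

type_synonym ('x, 'c) mpoly = "('x \<Rightarrow>\<^sub>0 nat) \<Rightarrow>\<^sub>0 'c"

definition mpoly_const :: "'c::zero \<Rightarrow> ('x, 'c) mpoly"
  where "mpoly_const c = Poly_Mapping.single 0 c"

definition mpoly_eval :: "('c::zero \<Rightarrow> 'a::comm_semiring_1) \<Rightarrow> ('x \<Rightarrow> 'a) \<Rightarrow> ('x, 'c) mpoly \<Rightarrow> 'a"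
  where "mpoly_eval \<phi> x P =
    (\<Sum>e\<in>Poly_Mapping.keys P. \<phi> (Poly_Mapping.lookup P e) * (\<Prod>v\<in>Poly_Mapping.keys e. x v ^ Poly_Mapping.lookup e v))"

definition is_monomial :: "('x, 'c::zero_neq_one) mpoly \<Rightarrow> bool"
  where "is_monomial P \<longleftrightarrow> (\<exists>e. P = Poly_Mapping.single e 1)"

definition homogeneous :: "nat \<Rightarrow> ('v::finite, 'c::zero) mpoly \<Rightarrow> bool"
  where "homogeneous n P \<longleftrightarrow> (\<forall>e\<in>Poly_Mapping.keys P. (\<Sum>v\<in>UNIV. Poly_Mapping.lookup e v) = n)"

text \<open>
  The multigraded ring \<open>B = k[y_{i,j}]\<close> of \<open>\<P> = \<Prod>i. \<P>^{m i}\<close>, where \<open>j \<le> m i\<close> and \<open>y_{i,j}\<close> has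
  degree the \<open>i\<close>-th unit vector. The factors of \<open>\<P>\<close> are indexed by a finite type \<open>'p\<close>.
\<close>

definition multi_carrier :: "('p \<Rightarrow> nat) \<Rightarrow> ('p \<times> nat, 'c::zero) mpoly set"
  where "multi_carrier m = {F. \<forall>e\<in>Poly_Mapping.keys F. Poly_Mapping.keys e \<subseteq> {(i, j). j \<le> m i}}"

definition multi_ring :: "('p \<Rightarrow> nat) \<Rightarrow> ('p \<times> nat, 'k::field) mpoly ring"
  where "multi_ring m = ring_of_type_algebra\<lparr>carrier := multi_carrier m\<rparr>"

definition multi_piece :: "('p \<Rightarrow> nat) \<Rightarrow> ('p \<Rightarrow> nat) \<Rightarrow> ('p \<times> nat, 'c::zero) mpoly set"
  where "multi_piece m t =
    {F \<in> multi_carrier m. \<forall>e\<in>Poly_Mapping.keys F. \<forall>i. (\<Sum>j\<le>m i. Poly_Mapping.lookup e (i, j)) = t i}"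


section \<open>Projective spaces, rational maps and closures of images\<close>

text \<open>
  Subsets of a projective variety over \<open>k\<close> are given by points over the algebraic closure of \<open>k\<close>,
  while closed sets are cut out by equations over \<open>k\<close>: the ground field may be finite, so its
  own rational points would not suffice.
  A point of projective space is the set of all its homogeneous coordinate vectors.
\<close>

definition proj_point :: "('i \<Rightarrow> 'a::field) \<Rightarrow> ('i \<Rightarrow> 'a) set"
  where "proj_point v = {(\<lambda>j. c * v j) | c. c \<noteq> 0}"

definition proj_space :: "'i set \<Rightarrow> ('i \<Rightarrow> 'a::field) set set"
  where "proj_space J = {proj_point v | v. v \<noteq> (\<lambda>_. 0) \<and> (\<forall>j. j \<notin> J \<longrightarrow> v j = 0)}"

definition multi_proj_space :: "('p \<Rightarrow> nat) \<Rightarrow> ('p \<Rightarrow> (nat \<Rightarrow> 'a::field) set) set"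
  where "multi_proj_space m = {y. \<forall>i. y i \<in> proj_space {..m i}}"

definition vanishes_at ::
    "('p \<times> nat, 'k::field) mpoly \<Rightarrow> ('p \<Rightarrow> (nat \<Rightarrow> 'k alg_closure) set) \<Rightarrow> bool"
  where "vanishes_at F y \<longleftrightarrow>
    (\<forall>z. (\<forall>i. z i \<in> y i) \<longrightarrow> mpoly_eval to_ac (\<lambda>(i, j). z i j) F = 0)"

definition zariski_closed ::
    "'k::field itself \<Rightarrow> ('p \<Rightarrow> nat) \<Rightarrow> ('p \<Rightarrow> (nat \<Rightarrow> 'k alg_closure) set) set \<Rightarrow> bool"
  where "zariski_closed k m Z \<longleftrightarrow>
    (\<exists>S :: ('p \<times> nat, 'k) mpoly set. S \<subseteq> (\<Union>t. multi_piece m t) \<and>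
      Z = {y \<in> multi_proj_space m. \<forall>F\<in>S. vanishes_at F y})"

definition map_domain ::
    "('p \<Rightarrow> nat) \<Rightarrow> ('p \<Rightarrow> nat \<Rightarrow> ('v::finite, 'k::field) mpoly) \<Rightarrow> ('v \<Rightarrow> 'k alg_closure) set set"
  where "map_domain m f =
    {q \<in> proj_space UNIV. \<forall>i. \<exists>j\<le>m i. \<exists>x\<in>q. mpoly_eval to_ac x (f i j) \<noteq> 0}"

text \<open>
  All coordinate vectors \<open>x\<close> of the point \<open>q\<close> contribute the same point to the union, because the
  \<open>f i j\<close> with \<open>j \<le> m i\<close> are forms of the same degree.
\<close>

definition rational_map ::
    "('p \<Rightarrow> nat) \<Rightarrow> ('p \<Rightarrow> nat \<Rightarrow> ('v::finite, 'k::field) mpoly) \<Rightarrow>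
      ('v \<Rightarrow> 'k alg_closure) set \<Rightarrow> 'p \<Rightarrow> (nat \<Rightarrow> 'k alg_closure) set"
  where "rational_map m f q = (\<lambda>i. \<Union>x\<in>q.
    proj_point (\<lambda>j. if j \<le> m i then mpoly_eval to_ac x (f i j) else 0))"

definition image_closure ::
    "('p \<Rightarrow> nat) \<Rightarrow> ('p \<Rightarrow> nat \<Rightarrow> ('v::finite, 'k::field) mpoly) \<Rightarrow>
      ('p \<Rightarrow> (nat \<Rightarrow> 'k alg_closure) set) set"
  where "image_closure m f =
    zariski_closed TYPE('k) m hull (rational_map m f ` map_domain m f)"

definition vanishing_ideal ::
    "('p \<Rightarrow> nat) \<Rightarrow> ('p \<Rightarrow> (nat \<Rightarrow> 'k::field alg_closure) set) set \<Rightarrow> ('p \<times> nat, 'k) mpoly set"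
  where "vanishing_ideal m Y =
    Idl\<^bsub>multi_ring m\<^esub> {F \<in> (\<Union>t. multi_piece m t). \<forall>y\<in>Y. vanishes_at F y}"


section \<open>Multigraded Hilbert polynomials and multidegrees\<close>

text \<open>
  The dimension over \<open>k\<close> of the piece of degree \<open>t\<close> of the coordinate ring \<open>B/I(Y)\<close>; the subfield
  of constants and the graded piece are sets of cosets.
\<close>

definition hilbert_function ::
    "('p \<Rightarrow> nat) \<Rightarrow> ('p \<Rightarrow> (nat \<Rightarrow> 'k::field alg_closure) set) set \<Rightarrow> ('p \<Rightarrow> nat) \<Rightarrow> nat"
  where "hilbert_function m Y t =
    (let B = multi_ring m; I = vanishing_ideal m Y
     in ring.dim (B Quot I) (range (\<lambda>c. I +>\<^bsub>B\<^esub> mpoly_const c))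
          ((\<lambda>F. I +>\<^bsub>B\<^esub> F) ` multi_piece m t))"

definition hilbert_polynomial ::
    "('p::finite \<Rightarrow> nat) \<Rightarrow> ('p \<Rightarrow> (nat \<Rightarrow> 'k::field alg_closure) set) set \<Rightarrow> ('p, rat) mpoly"
  where "hilbert_polynomial m Y =
    (THE P. \<exists>N. \<forall>t. (\<forall>i. N \<le> t i) \<longrightarrow>
       mpoly_eval id (\<lambda>i. of_nat (t i)) P = of_nat (hilbert_function m Y t))"

definition binomial_coeffs :: "('p::finite, rat) mpoly \<Rightarrow> ('p \<Rightarrow> nat) \<Rightarrow> rat"
  where "binomial_coeffs P =
    (THE e. finite {d. e d \<noteq> 0} \<and>
       (\<forall>t. mpoly_eval id t P =
          (\<Sum>d | e d \<noteq> 0. e d * (\<Prod>i\<in>UNIV. (t i + of_nat (d i)) gchoose d i))))"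

text \<open>
  Only meaningful for \<open>|d|\<close> at least the dimension of \<open>Y\<close>.
\<close>

definition multidegree ::
    "('p::finite \<Rightarrow> nat) \<Rightarrow> ('p \<Rightarrow> (nat \<Rightarrow> 'k::field alg_closure) set) set \<Rightarrow> ('p \<Rightarrow> nat) \<Rightarrow> rat"
  where "multidegree m Y d = binomial_coeffs (hilbert_polynomial m Y) d"


section \<open>Degree of a rational map\<close>

definition proj_function_field :: "('v::{finite,linorder}, 'k::field) mpoly fract set"
  where "proj_function_field =
    {Fract a b | a b n. homogeneous n a \<and> homogeneous n b \<and> b \<noteq> 0}"

text \<open>
  The function field of the image closure \<open>Y\<close> consists of the fractions \<open>F/G\<close> of multihomogeneous
  elements of the same degree in the coordinate ring \<open>B/I(Y)\<close>, with \<open>G\<close> not in \<open>I(Y)\<close>.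
  It is represented by its image in \<open>K(\<P>^r)\<close> under the pullback embedding
  that substitutes \<open>f i j\<close> for \<open>y_{i,j}\<close>.
\<close>

definition pullback_function_field ::
    "('p \<Rightarrow> nat) \<Rightarrow> ('p \<Rightarrow> nat \<Rightarrow> ('v::{finite,linorder}, 'k::field) mpoly) \<Rightarrow>
      ('v, 'k) mpoly fract set"
  where "pullback_function_field m f =
    {Fract (mpoly_eval mpoly_const (\<lambda>(i, j). f i j) F) (mpoly_eval mpoly_const (\<lambda>(i, j). f i j) G)
      | F G t. F \<in> multi_piece m t \<and> G \<in> multi_piece m t \<and>
               G \<notin> vanishing_ideal m (image_closure m f)}"

definition map_degree ::
    "('p \<Rightarrow> nat) \<Rightarrow> ('p \<Rightarrow> nat \<Rightarrow> ('v::{finite,linorder}, 'k::field) mpoly) \<Rightarrow> nat"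
  where "map_degree m f =
    (let Q = (ring_of_type_algebra :: ('v, 'k) mpoly fract ring);
         L = pullback_function_field m f; K = proj_function_field
     in if ring.finite_dimension Q L K then ring.dim Q L K else 0)"


section \<open>Polytopes and mixed volumes\<close>

definition newton_polytope :: "('v::finite, 'k::zero_neq_one) mpoly set \<Rightarrow> (real ^ 'v) set"
  where "newton_polytope G =
    convex hull {(\<chi> v. real (Poly_Mapping.lookup e v)) | e. Poly_Mapping.single e 1 \<in> G}"

text \<open>
  \<open>\<real>\<^sup>r\<close> is the space \<open>C \<rightarrow>\<^sub>E UNIV\<close> of extensional functions on a coordinate set \<open>C\<close> with \<open>r\<close>
  elements, carrying the product of Lebesgue measures, so that \<open>r = 0\<close> is included.
  The projection \<open>\<pi>\<close> forgets the coordinate \<open>v0\<close>.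
\<close>

definition drop_coord :: "'v::finite \<Rightarrow> real ^ 'v \<Rightarrow> 'v \<Rightarrow> real"
  where "drop_coord v0 x = (\<lambda>v\<in>-{v0}. x $ v)"

definition volume :: "'v set \<Rightarrow> ('v \<Rightarrow> real) set \<Rightarrow> real"
  where "volume C S = measure (\<Pi>\<^sub>M v\<in>C. lborel) S"

definition minkowski_comb ::
    "'v set \<Rightarrow> ('p::finite \<Rightarrow> ('v \<Rightarrow> real) set) \<Rightarrow> ('p \<Rightarrow> nat) \<Rightarrow> ('v \<Rightarrow> real) set"
  where "minkowski_comb C K l =
    {(\<lambda>v\<in>C. \<Sum>i\<in>UNIV. real (l i) * x i v) | x. \<forall>i. x i \<in> K i}"

definition mixed_volume ::
    "'v set \<Rightarrow> ('p::finite \<Rightarrow> ('v \<Rightarrow> real) set) \<Rightarrow> ('p \<Rightarrow> nat) \<Rightarrow> real"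
  where "mixed_volume C K =
    (THE M. (\<forall>d. sum d UNIV \<noteq> card C \<longrightarrow> M d = 0) \<and>
       (\<forall>l. volume C (minkowski_comb C K l) =
          (\<Sum>d | sum d UNIV = card C.
             1 / (\<Prod>i\<in>UNIV. fact (d i)) * M d * (\<Prod>i\<in>UNIV. real (l i) ^ d i))))"

end

theory Submission
  imports Defs
begin

text \<open>
  Let \<open>a i j\<close> be the exponent of the monomial \<open>f i j\<close>. Both sides of the theorem are read off from the
  sumsets \<open>S t = {\<Sum>i j. e i j * a i j | e. \<forall>i. (\<Sum>j. e i j) = t i}\<close> and from the lattice \<open>\<Lambda>\<close> generated by the
  differences \<open>a i j - a i j'\<close>, a sublattice of the integer vectors of total degree zero.

  The Hilbert function. A multihomogeneous polynomial vanishes on the closure of the image if and only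
  if it becomes zero after substituting the \<open>f i j\<close> (\<open>vanishes_on_closure_iff\<close>); the points of the torus over an
  algebraically closed, hence infinite, field suffice to see this. So the graded piece of degree \<open>t\<close> of
  the coordinate ring has a basis indexed by \<open>S t\<close>, and the Hilbert function is \<open>card (S t)\<close>
  (\<open>hilbert_function_eq\<close>). That it is a polynomial for large \<open>t\<close> is Khovanskii's theorem
  (\<open>card_sumset_eventually_poly\<close>), proved by counting the least representations in a term order.

  The degree of the map. The function field of projective space is generated over the ground field by the
  Laurent monomials of degree zero, that of the image by those with exponents in \<open>\<Lambda>\<close>. Monomials in
  distinct cosets of \<open>\<Lambda>\<close> are linearly independent over the smaller field (\<open>laurent_independent\<close>), and
  representatives of all cosets span the larger field if there are finitely many of them
  (\<open>KP_dimension\<close>). So the degree is the index \<open>D\<close> of \<open>\<Lambda>\<close>, or \<open>0\<close> if this index is infinite.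

  The volume. Let \<open>V t\<close> be the volume of the Minkowski combination \<open>Z t\<close> of the projected polytopes with
  weights \<open>t\<close>. Rounding down the coefficients in a real combination of the generators shows that \<open>S t\<close> is, up to bounded
  shifts, the set of all points of a coset of \<open>\<Lambda>\<close> in \<open>Z t\<close>. Comparing with unions of unit cubes
  yields, for finite index, \<open>D * card (S t) \<le> V (t + c)\<close> and \<open>V t \<le> D * card (S (t + c))\<close> with a constant vector \<open>c\<close>
  (\<open>card_sumset_le_volume\<close>, \<open>volume_le_card_sumset\<close>). As \<open>V\<close> is homogeneous of degree \<open>r\<close> and continuous, \<open>V\<close> is the form of
  degree \<open>r\<close> in \<open>D\<close> times the Hilbert polynomial (\<open>leading_form\<close>), and comparing coefficients gives the
  claim. If the index is infinite, a linear functional that vanishes on \<open>\<Lambda>\<close> confines each \<open>Z t\<close> to a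
  hyperplane, so that all volumes vanish together with the degree of the map.
\<close>

section \<open>Evaluating polynomials\<close>

abbreviation lookup where "lookup \<equiv> Poly_Mapping.lookup"
abbreviation keys where "keys \<equiv> Poly_Mapping.keys"
abbreviation single where "single \<equiv> Poly_Mapping.single"

definition monom_val :: "('x \<Rightarrow> 'a::comm_semiring_1) \<Rightarrow> ('x \<Rightarrow>\<^sub>0 nat) \<Rightarrow> 'a"
  where "monom_val x e = (\<Prod>v\<in>keys e. x v ^ lookup e v)"

lemma mpoly_eval_monom_val:
  "mpoly_eval \<phi> x P = (\<Sum>e\<in>keys P. \<phi> (lookup P e) * monom_val x e)"
  by (simp add: mpoly_eval_def monom_val_def)

lemma monom_val_superset:
  "finite A \<Longrightarrow> keys e \<subseteq> A \<Longrightarrow> monom_val x e = (\<Prod>v\<in>A. x v ^ lookup e v)"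
  unfolding monom_val_def
  by (rule prod.mono_neutral_left) (auto simp: in_keys_iff)

lemma monom_val_UNIV: "monom_val x e = (\<Prod>v\<in>UNIV. x (v::'v::finite) ^ lookup e v)"
  by (rule monom_val_superset) auto

lemma monom_val_zero [simp]: "monom_val x 0 = 1"
  by (simp add: monom_val_def)

lemma monom_val_add: "monom_val x (e + e') = monom_val x e * monom_val x e'"
proof -
  let ?A = "keys e \<union> keys e'"
  have "monom_val x (e + e') = (\<Prod>v\<in>?A. x v ^ lookup (e + e') v)"
    by (rule monom_val_superset) (auto simp: keys_add)
  also have "\<dots> = (\<Prod>v\<in>?A. x v ^ lookup e v) * (\<Prod>v\<in>?A. x v ^ lookup e' v)"
    by (simp add: lookup_add power_add prod.distrib)
  also have "\<dots> = monom_val x e * monom_val x e'"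
    by (simp add: monom_val_superset[of ?A])
  finally show ?thesis .
qed

lemma mpoly_eval_superset:
  assumes "finite A" "keys P \<subseteq> A" "\<phi> 0 = 0"
  shows "mpoly_eval \<phi> x P = (\<Sum>e\<in>A. \<phi> (lookup P e) * monom_val x e)"
  unfolding mpoly_eval_monom_val
  by (rule sum.mono_neutral_left) (use assms in \<open>auto simp: in_keys_iff\<close>)

lemma mpoly_eval_single: "\<phi> 0 = 0 \<Longrightarrow> mpoly_eval \<phi> x (single e c) = \<phi> c * monom_val x e"
  by (cases "c = 0") (simp_all add: mpoly_eval_monom_val)

lemma mpoly_eval_zero: "mpoly_eval \<phi> x 0 = 0"
  by (simp add: mpoly_eval_def)

lemma mpoly_eval_add:
  assumes "\<phi> 0 = 0" "\<And>a b. \<phi> (a + b) = \<phi> a + \<phi> b"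
  shows "mpoly_eval \<phi> x (P + Q) = mpoly_eval \<phi> x P + mpoly_eval \<phi> x Q"
proof -
  let ?A = "keys P \<union> keys Q"
  have "mpoly_eval \<phi> x (P + Q) = (\<Sum>e\<in>?A. \<phi> (lookup (P + Q) e) * monom_val x e)"
    by (rule mpoly_eval_superset) (use assms keys_add[of P Q] in auto)
  also have "\<dots> = (\<Sum>e\<in>?A. \<phi> (lookup P e) * monom_val x e) + (\<Sum>e\<in>?A. \<phi> (lookup Q e) * monom_val x e)"
    by (simp add: lookup_add assms distrib_right sum.distrib)
  also have "\<dots> = mpoly_eval \<phi> x P + mpoly_eval \<phi> x Q"
    using assms by (simp add: mpoly_eval_superset[of ?A])
  finally show ?thesis .
qed

lemma mpoly_eval_sum:
  assumes "\<phi> 0 = 0" "\<And>a b. \<phi> (a + b) = \<phi> a + \<phi> b"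
  shows "mpoly_eval \<phi> x (\<Sum>i\<in>I. P i) = (\<Sum>i\<in>I. mpoly_eval \<phi> x (P i))"
  by (induction I rule: infinite_finite_induct)
     (simp_all add: mpoly_eval_zero mpoly_eval_add[OF assms])

lemma poly_mapping_sum_single: "P = (\<Sum>e\<in>keys P. single e (lookup P e))"
  by (rule poly_mapping_eqI)
     (auto simp: lookup_sum lookup_single when_def sum.delta in_keys_iff)

lemma mpoly_eval_mult:
  fixes P Q :: "('x, 'c::comm_semiring_1) mpoly"
  assumes "\<phi> 0 = 0" "\<And>a b. \<phi> (a + b) = \<phi> a + \<phi> b" "\<And>a b. \<phi> (a * b) = \<phi> a * \<phi> b"
  shows "mpoly_eval \<phi> x (P * Q) = mpoly_eval \<phi> x P * mpoly_eval \<phi> x Q"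
proof -
  have "P * Q = (\<Sum>e\<in>keys P. single e (lookup P e)) * (\<Sum>e\<in>keys Q. single e (lookup Q e))"
    by (rule arg_cong2[where f="(*)"]; rule poly_mapping_sum_single)
  also have "\<dots> = (\<Sum>e\<in>keys P. \<Sum>e'\<in>keys Q. single (e + e') (lookup P e * lookup Q e'))"
    by (simp add: sum_product mult_single)
  finally have "mpoly_eval \<phi> x (P * Q) = (\<Sum>e\<in>keys P. \<Sum>e'\<in>keys Q.
      (\<phi> (lookup P e) * monom_val x e) * (\<phi> (lookup Q e') * monom_val x e'))"
    by (simp add: mpoly_eval_sum[OF assms(1,2)] mpoly_eval_single[of \<phi>, OF assms(1)] assms(3) monom_val_add mult_ac)
  thus ?thesis by (simp add: mpoly_eval_monom_val sum_product)
qed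

lemma mpoly_eval_const: "\<phi> 0 = 0 \<Longrightarrow> mpoly_eval \<phi> x (mpoly_const c) = \<phi> c"
  by (simp add: mpoly_const_def mpoly_eval_single)

lemma mpoly_eval_one: "\<phi> 0 = 0 \<Longrightarrow> \<phi> 1 = 1 \<Longrightarrow> mpoly_eval \<phi> x 1 = 1"
  using mpoly_eval_const[of \<phi> x 1] by (simp add: mpoly_const_def)

lemma mpoly_eval_prod:
  fixes P :: "'i \<Rightarrow> ('x, 'c::comm_semiring_1) mpoly"
  assumes "\<phi> 0 = 0" "\<phi> 1 = 1" "\<And>a b. \<phi> (a + b) = \<phi> a + \<phi> b" "\<And>a b. \<phi> (a * b) = \<phi> a * \<phi> b"
  shows "mpoly_eval \<phi> x (\<Prod>i\<in>I. P i) = (\<Prod>i\<in>I. mpoly_eval \<phi> x (P i))"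
  by (induction I rule: infinite_finite_induct)
     (simp_all add: mpoly_eval_one[of \<phi>, OF assms(1,2)] mpoly_eval_mult[of \<phi>, OF assms(1,3,4)])

lemma mpoly_eval_power:
  fixes P :: "('x, 'c::comm_semiring_1) mpoly"
  assumes "\<phi> 0 = 0" "\<phi> 1 = 1" "\<And>a b. \<phi> (a + b) = \<phi> a + \<phi> b" "\<And>a b. \<phi> (a * b) = \<phi> a * \<phi> b"
  shows "mpoly_eval \<phi> x (P ^ n) = mpoly_eval \<phi> x P ^ n"
  by (induction n)
     (simp_all add: mpoly_eval_one[of \<phi>, OF assms(1,2)] mpoly_eval_mult[of \<phi>, OF assms(1,3,4)])

lemma mpoly_const_add: "mpoly_const (a + b) = mpoly_const a + mpoly_const b"
  and mpoly_const_mult: "mpoly_const (a * b) = (mpoly_const a * mpoly_const b :: ('x, 'c::comm_semiring_1) mpoly)"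
  and mpoly_const_zero: "mpoly_const 0 = 0"
  and mpoly_const_one: "mpoly_const 1 = 1"
  by (simp_all add: mpoly_const_def single_add mult_single)

text \<open>
  Evaluating at \<open>x\<close> after substituting \<open>g\<close> is evaluating at the values of \<open>g\<close>. This links equations for
  the image of a rational map, evaluated at points, with polynomial identities between its components.
\<close>

lemma mpoly_eval_compose:
  fixes F :: "('y, 'c::comm_semiring_1) mpoly"
  assumes "\<phi> 0 = 0" "\<phi> 1 = 1" "\<And>a b. \<phi> (a + b) = \<phi> a + \<phi> b" "\<And>a b. \<phi> (a * b) = \<phi> a * \<phi> b"
  shows "mpoly_eval \<phi> x (mpoly_eval mpoly_const g F) = mpoly_eval \<phi> (\<lambda>p. mpoly_eval \<phi> x (g p)) F"
  unfolding mpoly_eval_monom_val[of mpoly_const] mpoly_eval_monom_val[of _ _ F]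
  by (simp add: mpoly_eval_sum[OF assms(1,3)] mpoly_eval_mult[of \<phi>, OF assms(1,3,4)]
      mpoly_eval_const[of \<phi>, OF assms(1)] monom_val_def mpoly_eval_prod[of \<phi>, OF assms]
      mpoly_eval_power[of \<phi>, OF assms])

text \<open>On a finite set of variables exponents are plain functions, which is how sumsets and lattices treat them.\<close>

definition exponent :: "('v::finite \<Rightarrow> nat) \<Rightarrow> 'v \<Rightarrow>\<^sub>0 nat"
  where "exponent = Poly_Mapping.Abs_poly_mapping"

lemma lookup_exponent [simp]: "lookup (exponent g) = g"
  unfolding exponent_def by (rule lookup_Abs_poly_mapping) simp

lemma exponent_lookup [simp]: "exponent (lookup e) = e"
  by (rule poly_mapping_eqI) simp

lemma exponent_inject: "exponent g = exponent h \<longleftrightarrow> g = h"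
  by (metis lookup_exponent)

lemma single_power: "single (exponent g) 1 ^ n = (single (exponent (\<lambda>v. n * g v)) 1 :: ('v::finite, 'c::comm_semiring_1) mpoly)"
proof (induction n)
  case 0
  have "exponent (\<lambda>v. 0 * g v) = 0" by (rule poly_mapping_eqI) simp
  thus ?case by simp
next
  case (Suc n)
  have "exponent g + exponent (\<lambda>v. n * g v) = exponent (\<lambda>v. Suc n * g v)"
    by (rule poly_mapping_eqI) (simp add: lookup_add)
  thus ?case using Suc by (simp add: mult_single)
qed

lemma single_prod: "(\<Prod>p\<in>A. single (exponent (g p)) 1) =
    (single (exponent (\<lambda>v. \<Sum>p\<in>A. g p v)) 1 :: ('v::finite, 'c::comm_semiring_1) mpoly)"
proof (induction A rule: infinite_finite_induct)
  case (insert p A)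
  have "exponent (g p) + exponent (\<lambda>v. \<Sum>p\<in>A. g p v) = exponent (\<lambda>v. \<Sum>p\<in>insert p A. g p v)"
    by (rule poly_mapping_eqI) (use insert in \<open>simp add: lookup_add\<close>)
  thus ?case using insert by (simp add: mult_single)
next
  case empty
  have "exponent (\<lambda>v. \<Sum>p\<in>{}. g p v) = 0" by (rule poly_mapping_eqI) simp
  thus ?case by simp
next
  case (infinite A)
  have "exponent (\<lambda>v. \<Sum>p\<in>A. g p v) = 0" by (rule poly_mapping_eqI) (use infinite in simp)
  thus ?case using infinite by simp
qed

lemma monom_val_monomials:
  "monom_val (\<lambda>p. single (exponent (g p)) 1) e =
    (single (exponent (\<lambda>v. \<Sum>p\<in>keys e. lookup e p * g p v)) 1 :: ('v::finite, 'c::comm_semiring_1) mpoly)"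
  by (simp add: monom_val_def single_power single_prod)

section \<open>Polynomials vanishing at many points\<close>

text \<open>
  Positional notation: in a base \<open>B\<close> exceeding all entries at \<open>u\<close>, the weight \<open>1\<close> for \<open>u\<close> and \<open>B\<close> times
  the old weights elsewhere allow to read off the entry at \<open>u\<close> modulo \<open>B\<close>.
\<close>

lemma separating_weights_on:
  fixes E :: "('a \<Rightarrow> nat) set"
  assumes "finite V" "finite E"
  shows "\<exists>w. (\<forall>v. w v \<ge> 1) \<and> (\<forall>e\<in>E. \<forall>e'\<in>E.
     (\<Sum>v\<in>V. w v * e v) = (\<Sum>v\<in>V. w v * e' v) \<longrightarrow> (\<forall>v\<in>V. e v = e' v))"
  using assms(1)
proof (induction V)
  case empty
  show ?case by (rule exI[of _ "\<lambda>_. 1"]) auto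
next
  case (insert u V)
  then obtain w where w: "\<forall>v. w v \<ge> 1" "\<forall>e\<in>E. \<forall>e'\<in>E.
     (\<Sum>v\<in>V. w v * e v) = (\<Sum>v\<in>V. w v * e' v) \<longrightarrow> (\<forall>v\<in>V. e v = e' v)" by blast
  define B where "B = Suc (\<Sum>e\<in>E. e u)"
  have B: "e u < B" if "e \<in> E" for e
    unfolding B_def using member_le_sum[of e E "\<lambda>e. e u"] that assms(2) by (simp add: le_imp_less_Suc)
  define w' where "w' = (\<lambda>v. if v = u then 1 else B * w v)"
  have s: "(\<Sum>v\<in>insert u V. w' v * e v) = e u + B * (\<Sum>v\<in>V. w v * e v)" for e
  proof -
    have "(\<Sum>v\<in>V. w' v * e v) = (\<Sum>v\<in>V. B * (w v * e v))"
      by (rule sum.cong) (use insert in \<open>auto simp: w'_def\<close>)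
    thus ?thesis using insert by (simp add: w'_def sum_distrib_left)
  qed
  have "\<forall>v. w' v \<ge> 1" using w(1)
    unfolding w'_def by (auto simp: B_def intro: trans_le_add1)
  moreover have "\<forall>v\<in>insert u V. e v = e' v" if e: "e \<in> E" "e' \<in> E"
    and eq: "(\<Sum>v\<in>insert u V. w' v * e v) = (\<Sum>v\<in>insert u V. w' v * e' v)" for e e'
  proof -
    have eq: "e u + B * (\<Sum>v\<in>V. w v * e v) = e' u + B * (\<Sum>v\<in>V. w v * e' v)"
      using eq unfolding s .
    from arg_cong[OF eq, of "\<lambda>n. n mod B"] have u: "e u = e' u" using B e by simp
    hence "B * (\<Sum>v\<in>V. w v * e v) = B * (\<Sum>v\<in>V. w v * e' v)" using eq by simp
    hence "(\<Sum>v\<in>V. w v * e v) = (\<Sum>v\<in>V. w v * e' v)" using B[OF e(1)] by simp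
    with w(2) e u show ?thesis by blast
  qed
  ultimately show ?case by blast
qed

text \<open>
  Kronecker's substitution \<open>x_v = s ^ w v\<close> turns a polynomial in several variables into one in the
  single variable \<open>s\<close> without merging monomials, so infinitely many zeros \<open>s\<close> force all
  coefficients to vanish.
\<close>

lemma coefficients_zero_if_vanishing:
  fixes c :: "('a::finite \<Rightarrow> nat) \<Rightarrow> 'f::idom"
  assumes E: "finite E" and T: "infinite T"
    and zero: "\<And>s w. s \<in> T \<Longrightarrow> (\<And>v. w v \<ge> (1::nat)) \<Longrightarrow> (\<Sum>e\<in>E. c e * (\<Prod>v\<in>UNIV. (s ^ w v) ^ e v)) = 0"
    and e0: "e0 \<in> E"
  shows "c e0 = 0"
proof -
  obtain w where w: "\<forall>v. w v \<ge> 1" "\<forall>e\<in>E. \<forall>e'\<in>E.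
     (\<Sum>v\<in>UNIV. w v * e v) = (\<Sum>v\<in>UNIV. w v * e' v) \<longrightarrow> (\<forall>v\<in>UNIV. e v = e' v)"
    using separating_weights_on[of UNIV E] E by auto
  define p where "p = (\<Sum>e\<in>E. Polynomial.monom (c e) (\<Sum>v\<in>UNIV. w v * e v))"
  have "poly p s = 0" if "s \<in> T" for s
    using zero[OF that, of w] w(1)
    by (simp add: p_def poly_sum poly_monom power_sum power_mult)
  hence "T \<subseteq> {s. poly p s = 0}" by blast
  with T have "p = 0" using poly_roots_finite finite_subset by blast
  hence "0 = Polynomial.coeff p (\<Sum>v\<in>UNIV. w v * e0 v)" by simp
  also have "\<dots> = (\<Sum>e\<in>E. if e = e0 then c e else 0)"
    unfolding p_def coeff_sum
    by (rule sum.cong) (use w(2) e0 in \<open>auto simp: fun_eq_iff\<close>)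
  also have "\<dots> = c e0" using E e0 by simp
  finally show ?thesis by simp
qed

lemma mpoly_zero_if_vanishing:
  fixes P :: "('a::finite, 'c::zero) mpoly" and \<phi> :: "'c \<Rightarrow> 'f::idom"
  assumes T: "infinite T" and \<phi>: "\<And>c. \<phi> c = 0 \<longleftrightarrow> c = 0"
    and zero: "\<And>s w. s \<in> T \<Longrightarrow> (\<And>v. w v \<ge> (1::nat)) \<Longrightarrow> mpoly_eval \<phi> (\<lambda>v. s ^ w v) P = 0"
  shows "P = 0"
proof (rule poly_mapping_eqI)
  fix e :: "'a \<Rightarrow>\<^sub>0 nat"
  have inj: "inj_on lookup (keys P)" by (rule inj_onI) (simp only: poly_mapping_eq_iff)
  define c where "c g = \<phi> (lookup P (exponent g))" for g
  have "c g = 0" if "g \<in> lookup ` keys P" for g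
  proof (rule coefficients_zero_if_vanishing[OF _ T _ that])
    fix s and w :: "'a \<Rightarrow> nat" assume s: "s \<in> T" "\<And>v. w v \<ge> 1"
    have "(\<Sum>g\<in>lookup ` keys P. c g * (\<Prod>v\<in>UNIV. (s ^ w v) ^ g v)) = mpoly_eval \<phi> (\<lambda>v. s ^ w v) P"
      by (subst sum.reindex[OF inj]) (simp add: mpoly_eval_monom_val monom_val_UNIV c_def)
    thus "(\<Sum>g\<in>lookup ` keys P. c g * (\<Prod>v\<in>UNIV. (s ^ w v) ^ g v)) = 0" using zero[OF s] by simp
  qed simp
  hence "c (lookup e) = 0" if "e \<in> keys P" using that by blast
  hence "e \<notin> keys P" using \<phi> by (auto simp: c_def in_keys_iff)
  thus "lookup P e = lookup 0 e" by (simp add: in_keys_iff)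
qed

text \<open>
  If the field were finite, \<open>1 + \<Prod>a. (x - a)\<close> would be a polynomial of positive degree with value \<open>1\<close>
  everywhere.
\<close>

lemma infinite_alg_closed: "infinite (UNIV :: 'a::alg_closed_field set)"
proof
  assume fin: "finite (UNIV :: 'a set)"
  define p :: "'a poly" where "p = 1 + (\<Prod>a\<in>UNIV. [:-a, 1:])"
  have "Polynomial.degree (\<Prod>a\<in>(UNIV::'a set). [:-a, 1:]) = card (UNIV :: 'a set)"
    by (subst degree_prod_eq_sum_degree) auto
  moreover have "card (UNIV :: 'a set) > 0" using fin by (simp add: card_gt_0_iff)
  ultimately have "Polynomial.degree p > 0" unfolding p_def
    by (metis degree_1 degree_add_eq_right)
  then obtain x where "poly p x = 0" using alg_closed_imp_poly_has_root by blast
  moreover have "poly p x = 1"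
  proof -
    have "(\<Prod>a\<in>UNIV. poly [:-a, 1:] x) = 0" using fin by (intro prod_zero) auto
    thus ?thesis by (simp add: p_def poly_prod)
  qed
  ultimately show False by simp
qed

section \<open>Dimension of the span of a finite family\<close>

lemma (in ring) combine_map_finsum:
  assumes "distinct ss" "c \<in> set ss \<rightarrow> carrier R" "u \<in> set ss \<rightarrow> carrier R"
  shows "combine (map c ss) (map u ss) = (\<Oplus>s\<in>set ss. c s \<otimes> u s)"
  using assms
proof (induction ss)
  case (Cons s ss)
  hence "(\<Oplus>s\<in>set (s # ss). c s \<otimes> u s) = c s \<otimes> u s \<oplus> (\<Oplus>s\<in>set ss. c s \<otimes> u s)"
    by (simp only: list.set, subst finsum_insert) (auto intro!: m_closed)
  with Cons show ?case by auto
qed simp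

text \<open>
  All bases below are indexed by sets of exponents, so linear combinations are given by coefficient
  functions on a finite set instead of lists of coefficients.
\<close>

lemma (in ring) dimension_family:
  assumes K: "subfield K R" and S: "finite S" and u: "u \<in> S \<rightarrow> carrier R"
    and indep: "\<And>c s. c \<in> S \<rightarrow> K \<Longrightarrow> (\<Oplus>s\<in>S. c s \<otimes> u s) = \<zero> \<Longrightarrow> s \<in> S \<Longrightarrow> c s = \<zero>"
  shows "dimension (card S) K {\<Oplus>s\<in>S. c s \<otimes> u s | c. c \<in> S \<rightarrow> K}"
    and "\<exists>us. independent K us \<and> length us = card S \<and> set us = u ` S \<and>
      Span K us = {\<Oplus>s\<in>S. c s \<otimes> u s | c. c \<in> S \<rightarrow> K}"
proof -
  obtain ss where ss: "distinct ss" "set ss = S" using S finite_distinct_list by blast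
  have KR: "K \<subseteq> carrier R" using subfieldE(3)[OF K] .
  have zK: "\<zero> \<in> K" using subringE(2)[OF subfieldE(1)[OF K]] .
  define n where "n = length ss"
  have n: "n = card S" using ss distinct_card n_def by metis
  have as_fun: "\<exists>c. Ks = map c ss" if "length Ks = n" for Ks :: "'a list"
  proof -
    have "Ks = map (\<lambda>s. the (map_of (zip ss Ks) s)) ss"
      by (rule nth_equalityI) (use that ss n_def in \<open>auto simp: map_of_zip_nth\<close>)
    thus ?thesis by blast
  qed
  have us: "set (map u ss) \<subseteq> carrier R" using u ss by auto
  have comb: "combine (map c ss) (map u ss) = (\<Oplus>s\<in>S. c s \<otimes> u s)" if "c \<in> S \<rightarrow> K" for c
    using combine_map_finsum[of ss c u] ss that u KR by auto
  have ind: "independent K (map u ss)"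
  proof (rule trivial_combine_imp_independent[OF K us])
    fix Ks assume Ks: "set Ks \<subseteq> K" "combine Ks (map u ss) = \<zero>"
    define Ks' where "Ks' = take n Ks @ replicate (n - length Ks) \<zero>"
    have len: "length Ks' = n" by (simp add: Ks'_def)
    then obtain c where c: "Ks' = map c ss" using as_fun by blast
    have "set Ks' \<subseteq> K" using Ks(1) zK set_take_subset[of n Ks] unfolding Ks'_def by auto
    hence cK: "c \<in> S \<rightarrow> K" using c ss by auto
    have "combine Ks' (map u ss) = \<zero>"
      using combine_append_replicate[OF us, of "take n Ks" "n - length Ks"] combine_take[of "map u ss" Ks] Ks(2)
      by (simp add: Ks'_def n_def)
    hence "c s = \<zero>" if "s \<in> S" for s using indep[OF cK _ that] comb[OF cK] c by simp
    hence "set Ks' \<subseteq> {\<zero>}" using c ss by auto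
    thus "set (take (length (map u ss)) Ks) \<subseteq> {\<zero>}" by (auto simp: Ks'_def n_def)
  qed
  have span: "Span K (map u ss) = {\<Oplus>s\<in>S. c s \<otimes> u s | c. c \<in> S \<rightarrow> K}"
  proof (intro equalityI subsetI)
    fix x assume "x \<in> Span K (map u ss)"
    then obtain Ks where Ks: "x = combine Ks (map u ss)" "length Ks = n" "set Ks \<subseteq> K"
      using Span_eq_combine_set_length_version[OF K us] by (auto simp: n_def)
    then obtain c where c: "Ks = map c ss" using as_fun by blast
    with Ks ss have "c \<in> S \<rightarrow> K" by auto
    thus "x \<in> {\<Oplus>s\<in>S. c s \<otimes> u s | c. c \<in> S \<rightarrow> K}" using comb Ks(1) c by blast
  next
    fix x assume "x \<in> {\<Oplus>s\<in>S. c s \<otimes> u s | c. c \<in> S \<rightarrow> K}"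
    then obtain c where c: "c \<in> S \<rightarrow> K" "x = (\<Oplus>s\<in>S. c s \<otimes> u s)" by blast
    hence "x = combine (map c ss) (map u ss)" using comb by simp
    moreover have "set (map c ss) \<subseteq> K" using c ss by auto
    ultimately show "x \<in> Span K (map u ss)" unfolding Span_eq_combine_set[OF K us] by blast
  qed
  from dimensionI[OF K ind span] n show "dimension (card S) K {\<Oplus>s\<in>S. c s \<otimes> u s | c. c \<in> S \<rightarrow> K}"
    by (simp add: n_def)
  show "\<exists>us. independent K us \<and> length us = card S \<and> set us = u ` S \<and>
      Span K us = {\<Oplus>s\<in>S. c s \<otimes> u s | c. c \<in> S \<rightarrow> K}"
    by (rule exI[of _ "map u ss"], intro conjI ind span) (use n ss in \<open>simp_all add: n_def\<close>)
qed

lemma ring_of_type_algebra_simps [simp]: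
  "carrier ring_of_type_algebra = UNIV"
  "monoid.mult ring_of_type_algebra = (\<lambda>x y. x * y)"
  "monoid.one ring_of_type_algebra = 1"
  "ring.zero ring_of_type_algebra = 0"
  "ring.add ring_of_type_algebra = (\<lambda>x y. x + y)"
  by (simp_all add: ring_of_type_algebra_def)

lemma finsum_type_algebra:
  assumes "cring (ring_of_type_algebra\<lparr>carrier := H\<rparr>)" "g \<in> S \<rightarrow> H" "finite S"
  shows "finsum (ring_of_type_algebra\<lparr>carrier := H\<rparr>) g S = sum g S"
proof -
  interpret cring "ring_of_type_algebra\<lparr>carrier := H\<rparr>" by fact
  show ?thesis using assms(3,2)
    by (induction S) (simp_all add: Pi_def)
qed

section \<open>Sums of exponents\<close>

locale monomial_map =
  fixes m :: "'p::finite \<Rightarrow> nat" and a :: "'p \<Rightarrow> nat \<Rightarrow> 'v::finite \<Rightarrow> nat"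
begin

text \<open>
  A family \<open>z\<close> of coefficients stands for the formal combination of the generators \<open>a i j\<close>, \<open>j \<le> m i\<close>:
  \<open>comb z\<close> is its value and \<open>csum z\<close> its multidegree. The coefficients are natural numbers for
  monomials, integers for lattice vectors and reals for points of polytopes.
\<close>

definition comb :: "('p \<Rightarrow> nat \<Rightarrow> 'r::comm_semiring_1) \<Rightarrow> 'v \<Rightarrow> 'r"
  where "comb z v = (\<Sum>i\<in>UNIV. \<Sum>j\<le>m i. z i j * of_nat (a i j v))"

definition csum :: "('p \<Rightarrow> nat \<Rightarrow> 'r::comm_semiring_1) \<Rightarrow> 'p \<Rightarrow> 'r"
  where "csum z i = (\<Sum>j\<le>m i. z i j)"

lemma comb_cong: "(\<And>i j. j \<le> m i \<Longrightarrow> z i j = z' i j) \<Longrightarrow> comb z = comb z'"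
  unfolding comb_def by (intro ext sum.cong) auto

lemma csum_cong: "(\<And>i j. j \<le> m i \<Longrightarrow> z i j = z' i j) \<Longrightarrow> csum z = csum z'"
  unfolding csum_def by (intro ext sum.cong) auto

text \<open>
  The exponents of the monomials of multidegree \<open>t\<close> in the \<open>f i j\<close>.
\<close>

definition sumset :: "('p \<Rightarrow> nat) \<Rightarrow> ('v \<Rightarrow> nat) set"
  where "sumset t = {comb e | e. csum e = t}"

lemma sum_index: "(\<Sum>p\<in>{(i, j). j \<le> m i}. g p) = (\<Sum>i\<in>UNIV. \<Sum>j\<le>m i. g (i, j))"
proof -
  have "{(i, j). j \<le> m i} = Sigma UNIV (\<lambda>i. {..m i})" by auto
  thus ?thesis by (simp add: sum.Sigma)
qed

lemma finite_index: "finite {(i, j). j \<le> m i}"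
proof -
  have "{(i, j). j \<le> m i} = Sigma UNIV (\<lambda>i. {..m i})" by auto
  thus ?thesis by simp
qed

lemma finite_sumset: "finite (sumset t)"
proof -
  let ?E = "{e. \<forall>i j. if j \<le> m i then e i j \<le> t i else e i j = 0}"
  have "finite (PiE {(i, j). j \<le> m i} (\<lambda>(i, j). {..t i}))"
    by (rule finite_PiE) (use finite_index in auto)
  hence "finite ((\<lambda>g i j. if j \<le> m i then g (i, j) else 0) ` PiE {(i, j). j \<le> m i} (\<lambda>(i, j). {..t i}))"
    by (rule finite_imageI)
  moreover have "sumset t \<subseteq> comb ` (\<lambda>g i j. if j \<le> m i then g (i, j) else 0) ` PiE {(i, j). j \<le> m i} (\<lambda>(i, j). {..t i})"
  proof
    fix s assume "s \<in> sumset t"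
    then obtain e where e: "s = comb e" "csum e = t" by (auto simp: sumset_def)
    let ?g = "restrict (\<lambda>(i, j). e i j) {(i, j). j \<le> m i}"
    have "e i j \<le> t i" if "j \<le> m i" for i j
      using member_le_sum[of j "{..m i}" "e i"] that e(2) by (auto simp: csum_def)
    hence "?g \<in> PiE {(i, j). j \<le> m i} (\<lambda>(i, j). {..t i})" by auto
    moreover have "s = comb (\<lambda>i j. if j \<le> m i then ?g (i, j) else 0)"
      unfolding e(1) by (rule comb_cong) simp
    ultimately show "s \<in> comb ` (\<lambda>g i j. if j \<le> m i then g (i, j) else 0) ` PiE {(i, j). j \<le> m i} (\<lambda>(i, j). {..t i})"
      by blast
  qed
  ultimately show ?thesis by (meson finite_imageI finite_subset)
qed

lemma entry_le_sum:
  fixes g :: "'p \<Rightarrow> nat \<Rightarrow> 'r::linordered_idom"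
  assumes "j \<le> m i" "\<And>i j. 0 \<le> g i j"
  shows "g i j \<le> (\<Sum>i\<in>UNIV. \<Sum>j\<le>m i. g i j)"
proof -
  have "g i j \<le> (\<Sum>j\<le>m i. g i j)" using assms by (intro member_le_sum[of j "{..m i}" "g i"]) auto
  also have "\<dots> \<le> (\<Sum>i\<in>UNIV. \<Sum>j\<le>m i. g i j)"
    using assms(2) by (intro member_le_sum[of i UNIV "\<lambda>i. \<Sum>j\<le>m i. g i j"]) (auto intro: sum_nonneg)
  finally show ?thesis .
qed

end

locale toric = monomial_map m a
  for m :: "'p::finite \<Rightarrow> nat" and a :: "'p \<Rightarrow> nat \<Rightarrow> 'v::{finite,linorder} \<Rightarrow> nat" +
  fixes f :: "'p \<Rightarrow> nat \<Rightarrow> ('v, 'k::field) mpoly" and \<delta> :: "'p \<Rightarrow> nat"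
  assumes f_eq: "\<And>i j. j \<le> m i \<Longrightarrow> f i j = single (exponent (a i j)) 1"
    and deg: "\<And>i j. j \<le> m i \<Longrightarrow> (\<Sum>v\<in>UNIV. a i j v) = \<delta> i"
begin

text \<open>
  Substitution of \<open>f i j\<close> for \<open>y\<^sub>i\<^sub>j\<close>, the homomorphism whose kernel is the ideal of the image closure,
  as far as multihomogeneous elements are concerned.
\<close>

definition ev :: "('p \<times> nat, 'k) mpoly \<Rightarrow> ('v, 'k) mpoly"
  where "ev F = mpoly_eval mpoly_const (\<lambda>(i, j). f i j) F"

lemma ev_add: "ev (F + G) = ev F + ev G"
  unfolding ev_def by (rule mpoly_eval_add) (simp_all add: mpoly_const_zero mpoly_const_add)
lemma ev_mult: "ev (F * G) = ev F * ev G"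
  unfolding ev_def by (rule mpoly_eval_mult) (simp_all add: mpoly_const_zero mpoly_const_add mpoly_const_mult)
lemma ev_zero: "ev 0 = 0" by (simp add: ev_def mpoly_eval_zero)
lemma ev_one: "ev 1 = 1" unfolding ev_def by (rule mpoly_eval_one) (simp_all add: mpoly_const_zero mpoly_const_one)
lemma ev_minus: "ev (- F) = - ev F"
  using ev_add[of F "-F"] by (simp add: ev_zero eq_neg_iff_add_eq_0 add.commute)
lemma ev_const: "ev (mpoly_const c) = mpoly_const c"
  unfolding ev_def by (rule mpoly_eval_const) (simp add: mpoly_const_zero)
lemma ev_sum: "ev (\<Sum>s\<in>S. F s) = (\<Sum>s\<in>S. ev (F s))"
  unfolding ev_def by (rule mpoly_eval_sum) (simp_all add: mpoly_const_zero mpoly_const_add)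
lemma ev_prod: "ev (\<Prod>s\<in>S. F s) = (\<Prod>s\<in>S. ev (F s))"
  by (induction S rule: infinite_finite_induct) (simp_all add: ev_one ev_mult)

definition multiplicities :: "('p \<times> nat \<Rightarrow>\<^sub>0 nat) \<Rightarrow> 'p \<Rightarrow> nat \<Rightarrow> nat"
  where "multiplicities e = (\<lambda>i j. lookup e (i, j))"

lemma monom_val_f:
  assumes "keys e \<subseteq> {(i, j). j \<le> m i}"
  shows "monom_val (\<lambda>(i, j). f i j) e = single (exponent (comb (multiplicities e))) 1"
proof -
  have "monom_val (\<lambda>(i, j). f i j) e = monom_val (\<lambda>p. single (exponent (case p of (i, j) \<Rightarrow> a i j)) 1) e"
    unfolding monom_val_def by (rule prod.cong) (use assms f_eq in auto)
  also have "\<dots> = single (exponent (\<lambda>v. \<Sum>p\<in>keys e. lookup e p * (case p of (i, j) \<Rightarrow> a i j) v)) 1"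
    by (rule monom_val_monomials)
  also have "(\<lambda>v. \<Sum>p\<in>keys e. lookup e p * (case p of (i, j) \<Rightarrow> a i j) v) = comb (multiplicities e)"
  proof
    fix v
    have "(\<Sum>p\<in>keys e. lookup e p * (case p of (i, j) \<Rightarrow> a i j) v) =
        (\<Sum>p\<in>{(i, j). j \<le> m i}. lookup e p * (case p of (i, j) \<Rightarrow> a i j) v)"
      by (rule sum.mono_neutral_left) (use assms finite_index in \<open>auto simp: in_keys_iff\<close>)
    thus "(\<Sum>p\<in>keys e. lookup e p * (case p of (i, j) \<Rightarrow> a i j) v) = comb (multiplicities e) v"
      by (simp add: sum_index comb_def multiplicities_def)
  qed
  finally show ?thesis .
qed

lemma ev_expand:
  assumes "F \<in> multi_carrier m"
  shows "ev F = (\<Sum>e\<in>keys F. single (exponent (comb (multiplicities e))) (lookup F e))"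
  unfolding ev_def mpoly_eval_monom_val
  by (rule sum.cong) (use assms monom_val_f in \<open>auto simp: multi_carrier_def mpoly_const_def mult_single\<close>)

lemma lookup_ev:
  assumes "F \<in> multi_carrier m"
  shows "lookup (ev F) (exponent s) = (\<Sum>e\<in>keys F. if comb (multiplicities e) = s then lookup F e else 0)"
  unfolding ev_expand[OF assms] lookup_sum
  by (rule sum.cong) (auto simp: lookup_single when_def exponent_inject)

lemma piece_csum:
  assumes "F \<in> multi_piece m t" "e \<in> keys F"
  shows "csum (multiplicities e) = t" "comb (multiplicities e) \<in> sumset t" "keys e \<subseteq> {(i, j). j \<le> m i}"
proof -
  show *: "csum (multiplicities e) = t" using assms by (auto simp: multi_piece_def csum_def multiplicities_def)
  thus "comb (multiplicities e) \<in> sumset t" unfolding sumset_def by blast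
  show "keys e \<subseteq> {(i, j). j \<le> m i}" using assms by (auto simp: multi_piece_def multi_carrier_def)
qed

lemma piece_carrier: "multi_piece m t \<subseteq> multi_carrier m"
  by (auto simp: multi_piece_def)

lemma keys_ev:
  assumes "F \<in> multi_piece m t" "s \<in> keys (ev F)"
  shows "lookup s \<in> sumset t"
proof (rule ccontr)
  assume n: "lookup s \<notin> sumset t"
  have "lookup (ev F) (exponent (lookup s)) = 0"
    unfolding lookup_ev[OF subsetD[OF piece_carrier assms(1)]]
    by (rule sum.neutral) (use piece_csum(2)[OF assms(1)] n in fastforce)
  thus False using assms(2) by (simp add: in_keys_iff)
qed

text \<open>Multiplicities with \<open>j > m i\<close> are dropped, so that the result lies in the multigraded ring.\<close>

definition yexp :: "('p \<Rightarrow> nat \<Rightarrow> nat) \<Rightarrow> ('p \<times> nat \<Rightarrow>\<^sub>0 nat)"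
  where "yexp e = Poly_Mapping.Abs_poly_mapping (\<lambda>(i, j). if j \<le> m i then e i j else 0)"

lemma lookup_yexp: "lookup (yexp e) (i, j) = (if j \<le> m i then e i j else 0)"
proof -
  have "finite {p. (case p of (i, j) \<Rightarrow> if j \<le> m i then e i j else 0) \<noteq> 0}"
    by (rule finite_subset[OF _ finite_index]) (auto split: if_splits)
  thus ?thesis by (simp add: yexp_def lookup_Abs_poly_mapping)
qed

lemma keys_yexp: "keys (yexp e) \<subseteq> {(i, j). j \<le> m i}"
  by (auto simp: in_keys_iff lookup_yexp split: if_splits)

lemma single_yexp_piece: "single (yexp e) c \<in> multi_piece m (csum e)"
  using keys_yexp[of e] by (auto simp: multi_piece_def multi_carrier_def lookup_yexp csum_def)

lemma ev_single_yexp: "ev (single (yexp e) c) = single (exponent (comb e)) c"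
proof -
  have "comb (multiplicities (yexp e)) = comb e" by (rule comb_cong) (simp add: multiplicities_def lookup_yexp)
  moreover have "single (yexp e) c \<in> multi_carrier m" using single_yexp_piece piece_carrier by blast
  ultimately show ?thesis by (cases "c = 0") (simp_all add: ev_expand ev_zero)
qed

lemma multi_carrier_closed:
  fixes F G :: "('p \<times> nat, 'k) mpoly"
  assumes "F \<in> multi_carrier m" "G \<in> multi_carrier m"
  shows "F + G \<in> multi_carrier m" "F * G \<in> multi_carrier m" "- F \<in> multi_carrier m"
proof -
  show "F + G \<in> multi_carrier m" using assms keys_add[of F G] unfolding multi_carrier_def by blast
  show "F * G \<in> multi_carrier m" unfolding multi_carrier_def
  proof safe
    fix e i j assume "e \<in> keys (F * G)" and ij: "(i, j) \<in> keys e"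
    then obtain e1 e2 where "e = e1 + e2" "e1 \<in> keys F" "e2 \<in> keys G" using keys_mult[of F G] by blast
    with ij keys_add[of e1 e2] assms show "j \<le> m i" unfolding multi_carrier_def by blast
  qed
  have "keys (- F) = keys F" by (simp add: in_keys_iff set_eq_iff)
  thus "- F \<in> multi_carrier m" using assms by (auto simp: multi_carrier_def)
qed

lemma mpoly_const_carrier: "mpoly_const c \<in> multi_carrier m"
  by (simp add: multi_carrier_def mpoly_const_def)

lemma multi_piece_closed:
  fixes F G :: "('p \<times> nat, 'k) mpoly"
  shows "F \<in> multi_piece m t \<Longrightarrow> G \<in> multi_piece m t \<Longrightarrow> F + G \<in> multi_piece m t"
    and "F \<in> multi_piece m t \<Longrightarrow> - F \<in> multi_piece m t"
    and "F \<in> multi_piece m t \<Longrightarrow> G \<in> multi_piece m t' \<Longrightarrow> F * G \<in> multi_piece m (\<lambda>i. t i + t' i)"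
proof -
  show "F + G \<in> multi_piece m t" if "F \<in> multi_piece m t" "G \<in> multi_piece m t"
    using that keys_add[of F G] multi_carrier_closed(1)[of F G] unfolding multi_piece_def by blast
  have "keys (- F) = keys F" by (simp add: in_keys_iff set_eq_iff)
  thus "- F \<in> multi_piece m t" if "F \<in> multi_piece m t"
    using that multi_carrier_closed(3)[of F F] by (auto simp: multi_piece_def)
  show "F * G \<in> multi_piece m (\<lambda>i. t i + t' i)" if F: "F \<in> multi_piece m t" and G: "G \<in> multi_piece m t'"
  proof -
    have "(\<Sum>j\<le>m i. lookup e (i, j)) = t i + t' i" if "e \<in> keys (F * G)" for e i
    proof -
      from that obtain e1 e2 where "e = e1 + e2" "e1 \<in> keys F" "e2 \<in> keys G" using keys_mult[of F G] by blast
      thus ?thesis using F G by (auto simp: multi_piece_def lookup_add sum.distrib)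
    qed
    thus ?thesis using F G multi_carrier_closed(2)[of F G] by (auto simp: multi_piece_def)
  qed
qed

lemma zero_piece: "0 \<in> multi_piece m t"
  by (simp add: multi_piece_def multi_carrier_def)

lemma const_piece: "mpoly_const c \<in> multi_piece m (\<lambda>_. 0)"
  by (simp add: multi_piece_def multi_carrier_def mpoly_const_def)

lemma one_piece: "(1 :: ('p \<times> nat, 'k) mpoly) \<in> multi_piece m (\<lambda>_. 0)"
  using const_piece[of "1 :: 'k"] by (simp add: mpoly_const_one)

lemma multi_piece_sum: "(\<And>s. s \<in> S \<Longrightarrow> F s \<in> multi_piece m t) \<Longrightarrow> (\<Sum>s\<in>S. F s) \<in> multi_piece m t"
  for F :: "'s \<Rightarrow> ('p \<times> nat, 'k) mpoly"
  by (induction S rule: infinite_finite_induct) (auto intro: multi_piece_closed zero_piece)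

lemma multi_piece_prod: "(\<And>s. s \<in> S \<Longrightarrow> F s \<in> multi_piece m (t s)) \<Longrightarrow> (\<Prod>s\<in>S. F s) \<in> multi_piece m (\<lambda>i. \<Sum>s\<in>S. t s i)"
  for F :: "'s \<Rightarrow> ('p \<times> nat, 'k) mpoly"
proof (induction S rule: infinite_finite_induct)
  case (insert x S)
  thus ?case using multi_piece_closed(3)[of "F x" "t x" "\<Prod>s\<in>S. F s"] by auto
qed (simp_all add: one_piece)

end

section \<open>The ideal of the image\<close>

context toric
begin

text \<open>Extended by zero for \<open>j > m i\<close>, as are the coordinate vectors of points of \<open>multi_proj_space m\<close>.\<close>

definition fval :: "('v \<Rightarrow> 'k alg_closure) \<Rightarrow> 'p \<Rightarrow> nat \<Rightarrow> 'k alg_closure"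
  where "fval x i = (\<lambda>j. if j \<le> m i then mpoly_eval to_ac x (f i j) else 0)"

lemma eval_f:
  assumes "j \<le> m i"
  shows "mpoly_eval to_ac x (f i j) = (\<Prod>v\<in>UNIV. x v ^ a i j v)"
  using assms by (simp add: f_eq mpoly_eval_single monom_val_UNIV)

lemma fval_scale: "fval (\<lambda>v. c * x v) i = (\<lambda>j. c ^ \<delta> i * fval x i j)"
  by (rule ext) (auto simp: fval_def eval_f power_mult_distrib prod.distrib power_sum[symmetric] deg)

lemma proj_point_scale:
  fixes c :: "'c::field"
  shows "c \<noteq> 0 \<Longrightarrow> proj_point (\<lambda>j. c * v j) = proj_point v"
  unfolding proj_point_def
proof (intro equalityI subsetI; clarsimp)
  fix d :: 'c assume "c \<noteq> 0" "d \<noteq> 0"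
  thus "\<exists>e. (\<lambda>j. d * (c * v j)) = (\<lambda>j. e * v j) \<and> e \<noteq> 0"
    by (intro exI[of _ "d * c"]) auto
  show "\<exists>e. (\<lambda>j. d * v j) = (\<lambda>j. e * (c * v j)) \<and> e \<noteq> 0"
    using \<open>c \<noteq> 0\<close> \<open>d \<noteq> 0\<close> by (intro exI[of _ "d / c"]) auto
qed

lemma proj_point_self: "x \<in> proj_point x"
  unfolding proj_point_def by (rule CollectI, rule exI[of _ 1]) simp

text \<open>
  Rescaling \<open>x\<close> by \<open>c\<close> rescales all \<open>f i j\<close> with the same \<open>i\<close> by \<open>c ^ \<delta> i\<close>, so the union over all
  coordinate vectors of a point is a single point.
\<close>

lemma rational_map_eq: "rational_map m f (proj_point x) = (\<lambda>i. proj_point (fval x i))"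
proof
  fix i
  have "proj_point (fval y i) = proj_point (fval x i)" if y: "y \<in> proj_point x" for y
  proof -
    obtain c where "c \<noteq> 0" "y = (\<lambda>v. c * x v)" using y by (auto simp: proj_point_def)
    thus ?thesis using proj_point_scale[of "c ^ \<delta> i" "fval x i"] by (simp add: fval_scale)
  qed
  moreover have "x \<in> proj_point x" by (rule proj_point_self)
  ultimately show "rational_map m f (proj_point x) i = proj_point (fval x i)"
    unfolding rational_map_def fval_def by blast
qed

lemma eval_fval:
  assumes "F \<in> multi_carrier m"
  shows "mpoly_eval to_ac (\<lambda>(i, j). fval x i j) F = mpoly_eval to_ac x (ev F)"
proof -
  have J: "j \<le> m i" if "e \<in> keys F" "(i, j) \<in> keys e" for e i j
    using assms that by (auto simp: multi_carrier_def)
  have "mpoly_eval to_ac x (ev F) = mpoly_eval to_ac (\<lambda>p. mpoly_eval to_ac x ((\<lambda>(i, j). f i j) p)) F"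
    unfolding ev_def by (rule mpoly_eval_compose) simp_all
  also have "\<dots> = mpoly_eval to_ac (\<lambda>(i, j). fval x i j) F"
    unfolding mpoly_eval_def[of _ _ F]
    by (intro sum.cong prod.cong arg_cong2[where f = "(*)"] refl)
       (use J in \<open>auto simp: fval_def\<close>)
  finally show ?thesis by simp
qed

lemma eval_scale:
  assumes F: "F \<in> multi_piece m t"
  shows "mpoly_eval to_ac (\<lambda>(i, j). c i * y i j) F = (\<Prod>i\<in>UNIV. c i ^ t i) * mpoly_eval to_ac (\<lambda>(i, j). y i j) F"
proof -
  have *: "monom_val (\<lambda>(i, j). c i * y i j) e = (\<Prod>i\<in>UNIV. c i ^ t i) * monom_val (\<lambda>(i, j). y i j) e"
    if e: "e \<in> keys F" for e
  proof -
    have J: "{(i, j). j \<le> m i} = Sigma UNIV (\<lambda>i. {..m i})" by auto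
    have ek: "keys e \<subseteq> {(i, j). j \<le> m i}" using piece_csum(3)[OF F e] .
    have t: "t i = (\<Sum>j\<le>m i. lookup e (i, j))" for i
      using piece_csum(1)[OF F e] by (auto simp: csum_def multiplicities_def fun_eq_iff)
    have "monom_val (\<lambda>(i, j). c i * y i j) e =
        (\<Prod>i\<in>UNIV. \<Prod>j\<le>m i. (c i * y i j) ^ lookup e (i, j))"
      unfolding monom_val_superset[OF finite_index ek] unfolding J
      by (subst prod.Sigma) (auto intro!: prod.cong)
    also have "\<dots> = (\<Prod>i\<in>UNIV. c i ^ t i) * (\<Prod>i\<in>UNIV. \<Prod>j\<le>m i. y i j ^ lookup e (i, j))"
      by (simp add: power_mult_distrib prod.distrib t power_sum)
    also have "(\<Prod>i\<in>UNIV. \<Prod>j\<le>m i. y i j ^ lookup e (i, j)) = monom_val (\<lambda>(i, j). y i j) e"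
      unfolding monom_val_superset[OF finite_index ek] unfolding J
      by (subst prod.Sigma) (auto intro!: prod.cong)
    finally show ?thesis .
  qed
  show ?thesis unfolding mpoly_eval_monom_val
    by (simp add: * sum_distrib_left mult_ac cong: sum.cong)
qed

lemma vanishes_at_image_point:
  assumes F: "F \<in> multi_piece m t" and "ev F = 0"
  shows "vanishes_at F (rational_map m f (proj_point x))"
  unfolding vanishes_at_def rational_map_eq
proof (intro allI impI)
  fix z :: "'p \<Rightarrow> nat \<Rightarrow> 'k alg_closure" assume "\<forall>i. z i \<in> proj_point (fval x i)"
  hence "\<forall>i. \<exists>c. z i = (\<lambda>j. c * fval x i j)" by (auto simp: proj_point_def)
  then obtain c where c: "\<And>i. z i = (\<lambda>j. c i * fval x i j)" by metis
  have "mpoly_eval to_ac (\<lambda>(i, j). z i j) F = (\<Prod>i\<in>UNIV. c i ^ t i) * mpoly_eval to_ac x (ev F)"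
    unfolding c eval_scale[OF F] using eval_fval[of F x] F piece_carrier by auto
  thus "mpoly_eval to_ac (\<lambda>(i, j). z i j) F = 0" using assms(2) by (simp add: mpoly_eval_zero)
qed

lemma torus_point:
  assumes "\<And>v. x v \<noteq> 0"
  shows "proj_point x \<in> map_domain m f"
proof -
  have "x \<in> proj_point x" by (rule proj_point_self)
  moreover have "mpoly_eval to_ac x (f i 0) \<noteq> 0" for i using assms by (simp add: eval_f)
  moreover have "x \<noteq> (\<lambda>_. 0)" using assms by (metis)
  ultimately show ?thesis unfolding map_domain_def proj_space_def by blast
qed

text \<open>
  The definition of a closed set only admits subsets of the multiprojective space, so a closed set
  contains the image only if the image consists of honest points.
\<close>

lemma image_in_space:
  assumes "q \<in> map_domain m f"
  shows "rational_map m f q \<in> multi_proj_space m"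
proof -
  obtain x where x: "q = proj_point x" using assms unfolding map_domain_def proj_space_def by blast
  have "fval x i \<noteq> (\<lambda>_. 0)" for i
  proof -
    obtain j y where j: "j \<le> m i" "y \<in> q" "mpoly_eval to_ac y (f i j) \<noteq> 0"
      using assms unfolding map_domain_def by blast
    obtain c where "c \<noteq> 0" "y = (\<lambda>v. c * x v)" using j(2) by (auto simp: x proj_point_def)
    with j have "fval (\<lambda>v. c * x v) i j \<noteq> 0" by (simp add: fval_def)
    thus ?thesis by (auto simp: fval_scale fun_eq_iff)
  qed
  moreover have "\<forall>j. j \<notin> {..m i} \<longrightarrow> fval x i j = 0" for i by (simp add: fval_def)
  ultimately show ?thesis unfolding multi_proj_space_def x rational_map_eq proj_space_def by blast
qed

text \<open>
  The torus points alone detect the kernel: a polynomial vanishing at all points with nonzero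
  coordinates over the infinite field \<open>alg_closure\<close> is zero.
\<close>

lemma vanishes_on_closure_iff:
  assumes F: "F \<in> multi_piece m t"
  shows "(\<forall>y\<in>image_closure m f. vanishes_at F y) \<longleftrightarrow> ev F = 0"
proof
  assume van: "\<forall>y\<in>image_closure m f. vanishes_at F y"
  show "ev F = 0"
  proof (rule mpoly_zero_if_vanishing[of "UNIV - {0}" to_ac])
    show "infinite (UNIV - {0 :: 'k alg_closure})" using infinite_alg_closed by auto
    fix s :: "'k alg_closure" and w :: "'v \<Rightarrow> nat"
    assume s: "s \<in> UNIV - {0}"
    let ?x = "\<lambda>v. s ^ w v"
    have "rational_map m f (proj_point ?x) \<in> image_closure m f"
      unfolding image_closure_def by (rule hull_inc) (use torus_point[of ?x] s in auto)
    hence "vanishes_at F (rational_map m f (proj_point ?x))" using van by blast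
    moreover have "fval ?x i \<in> rational_map m f (proj_point ?x) i" for i
      unfolding rational_map_eq by (rule proj_point_self)
    ultimately have "mpoly_eval to_ac (\<lambda>(i, j). fval ?x i j) F = 0"
      unfolding vanishes_at_def by blast
    thus "mpoly_eval to_ac ?x (ev F) = 0"
      using eval_fval[OF subsetD[OF piece_carrier F], of ?x] by simp
  qed auto
next
  assume 0: "ev F = 0"
  let ?Z = "{y \<in> multi_proj_space m. \<forall>F\<in>{F}. vanishes_at F y}"
  have "rational_map m f ` map_domain m f \<subseteq> ?Z"
  proof (rule image_subsetI)
    fix q :: "('v \<Rightarrow> 'k alg_closure) set" assume q: "q \<in> map_domain m f"
    then obtain x where "q = proj_point x" unfolding map_domain_def proj_space_def by blast
    thus "rational_map m f q \<in> ?Z" using image_in_space[OF q] vanishes_at_image_point[OF F 0] by simp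
  qed
  moreover have "zariski_closed TYPE('k) m ?Z"
    unfolding zariski_closed_def by (rule exI[of _ "{F}"]) (use F in auto)
  ultimately have "image_closure m f \<subseteq> ?Z" unfolding image_closure_def by (rule hull_minimal)
  thus "\<forall>y\<in>image_closure m f. vanishes_at F y" by auto
qed

lemma multi_ring_simps [simp]:
  "carrier (multi_ring m) = multi_carrier m"
  "monoid.mult (multi_ring m) = (\<lambda>x y. x * y)"
  "monoid.one (multi_ring m) = (1 :: ('p \<times> nat, 'k) mpoly)"
  "ring.zero (multi_ring m) = (0 :: ('p \<times> nat, 'k) mpoly)"
  "ring.add (multi_ring m) = (\<lambda>x y. x + y)"
  by (simp_all add: multi_ring_def)

abbreviation B :: "('p \<times> nat, 'k) mpoly ring" where "B \<equiv> multi_ring m"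
abbreviation I :: "('p \<times> nat, 'k) mpoly set" where "I \<equiv> vanishing_ideal m (image_closure m f)"

lemma cring_multi_ring: "cring B"
proof -
  interpret P: cring "ring_of_type_algebra :: ('p \<times> nat, 'k) mpoly ring" by (rule cring_from_type_algebra)
  have inv: "\<ominus>\<^bsub>ring_of_type_algebra\<^esub> F = - F" for F :: "('p \<times> nat, 'k) mpoly"
    by (rule P.minus_equality) auto
  have "subring (multi_carrier m) (ring_of_type_algebra :: ('p \<times> nat, 'k) mpoly ring)"
    by (rule P.subringI) (use multi_carrier_closed subsetD[OF piece_carrier one_piece] in \<open>auto simp: inv\<close>)
  hence "subcring (multi_carrier m) (ring_of_type_algebra :: ('p \<times> nat, 'k) mpoly ring)"
    by (rule P.subcringI')
  thus ?thesis unfolding multi_ring_def using P.subcring_iff by simp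
qed

lemma ideal_I: "ideal I B"
proof -
  interpret cring B by (rule cring_multi_ring)
  show ?thesis unfolding vanishing_ideal_def
    by (rule genideal_ideal) (use piece_carrier in auto)
qed

text \<open>
  The kernel of \<open>ev\<close> is an ideal containing all generators. It is larger than the ideal in general,
  as it need not be multihomogeneous, but in each multidegree the two agree.
\<close>

lemma I_subset_kernel: "F \<in> I \<Longrightarrow> F \<in> multi_carrier m \<and> ev F = 0"
proof -
  interpret cring B by (rule cring_multi_ring)
  let ?R = "ring_of_type_algebra :: ('v, 'k) mpoly ring"
  have "ring_hom_ring B ?R ev"
    by (rule ring_hom_ringI) (auto simp: ev_add ev_mult ev_one ring_axioms)
  hence "ideal (a_kernel B ?R ev) B" by (rule ring_hom_ring.kernel_is_ideal)
  moreover have "{F \<in> (\<Union>t. multi_piece m t). \<forall>y\<in>image_closure m f. vanishes_at F y} \<subseteq> a_kernel B ?R ev"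
    using vanishes_on_closure_iff piece_carrier by (fastforce simp: a_kernel_def')
  ultimately have "I \<subseteq> a_kernel B ?R ev"
    unfolding vanishing_ideal_def by (rule genideal_minimal)
  thus "F \<in> I \<Longrightarrow> F \<in> multi_carrier m \<and> ev F = 0" by (auto simp: a_kernel_def')
qed

lemma piece_in_I_iff:
  assumes "F \<in> multi_piece m t"
  shows "F \<in> I \<longleftrightarrow> ev F = 0"
proof
  assume "ev F = 0"
  interpret cring B by (rule cring_multi_ring)
  have "{F \<in> (\<Union>t. multi_piece m t). \<forall>y\<in>image_closure m f. vanishes_at F y} \<subseteq> I"
    unfolding vanishing_ideal_def by (rule genideal_self) (use piece_carrier in auto)
  thus "F \<in> I" using \<open>ev F = 0\<close> assms vanishes_on_closure_iff[OF assms] by blast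
qed (use I_subset_kernel in blast)

section \<open>The Hilbert function counts the monomials in the image\<close>

text \<open>
  Modulo the ideal, two monomials of the same multidegree coincide as soon as they have the same
  image under \<open>ev\<close>. One monomial for each element of the sumset therefore gives a basis of the
  graded piece.
\<close>

theorem hilbert_function_eq: "hilbert_function m (image_closure m f) t = card (sumset t)"
proof -
  interpret B: cring B by (rule cring_multi_ring)
  interpret I: ideal I B by (rule ideal_I)
  let ?Q = "B Quot I"
  let ?k = "ring_of_type_algebra :: 'k ring"
  interpret Q: ring ?Q by (rule I.quotient_is_ring)
  interpret k: field ?k by (rule field_from_type_algebra)
  interpret h: ring_hom_cring B ?Q "(+>\<^bsub>B\<^esub>) I"
    by (rule I.rcos_ring_hom_cring) (rule cring_multi_ring)
  have coset_eq: "I +>\<^bsub>B\<^esub> F = I +>\<^bsub>B\<^esub> G" if "F \<in> multi_carrier m" "G \<in> multi_carrier m" "F - G \<in> I" for F G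
  proof -
    have "F \<oplus>\<^bsub>B\<^esub> \<ominus>\<^bsub>B\<^esub> G = F - G"
    proof -
      have "\<ominus>\<^bsub>B\<^esub> G = - G" by (rule B.minus_equality) (use that multi_carrier_closed(3)[of G G] in auto)
      thus ?thesis by simp
    qed
    hence "F \<in> I +>\<^bsub>B\<^esub> G" using I.a_rcos_module_rev[of G F] that by simp
    from I.a_repr_independence'[OF this] show ?thesis using that by simp
  qed
  have coset_zero: "F \<in> I" if "F \<in> multi_carrier m" "I +>\<^bsub>B\<^esub> F = \<zero>\<^bsub>?Q\<^esub>" for F
    using I.a_rcos_self[of F] that by (simp add: FactRing_def)
  define \<kappa> where "\<kappa> c = I +>\<^bsub>B\<^esub> mpoly_const c" for c :: 'k
  have cc: "mpoly_const c \<in> multi_carrier m" for c :: 'k by (rule mpoly_const_carrier)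
  have one_ne: "\<one>\<^bsub>?Q\<^esub> \<noteq> \<zero>\<^bsub>?Q\<^esub>"
  proof
    assume "\<one>\<^bsub>?Q\<^esub> = \<zero>\<^bsub>?Q\<^esub>"
    hence "I +>\<^bsub>B\<^esub> 1 = \<zero>\<^bsub>?Q\<^esub>" using h.hom_one by simp
    hence "1 \<in> I" using coset_zero one_piece piece_carrier by blast
    thus False using I_subset_kernel[of 1] by (simp add: ev_one)
  qed
  have "ring_hom_ring ?k ?Q \<kappa>"
  proof (rule ring_hom_ringI)
    fix x y :: 'k
    show "\<kappa> x \<in> carrier ?Q" using h.hom_closed[of "mpoly_const x"] cc by (simp add: \<kappa>_def)
    show "\<kappa> (x \<otimes>\<^bsub>?k\<^esub> y) = \<kappa> x \<otimes>\<^bsub>?Q\<^esub> \<kappa> y"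
      using h.hom_mult[of "mpoly_const x" "mpoly_const y"] cc by (simp add: \<kappa>_def mpoly_const_mult)
    show "\<kappa> (x \<oplus>\<^bsub>?k\<^esub> y) = \<kappa> x \<oplus>\<^bsub>?Q\<^esub> \<kappa> y"
      using h.hom_add[of "mpoly_const x" "mpoly_const y"] cc by (simp add: \<kappa>_def mpoly_const_add)
    show "\<kappa> \<one>\<^bsub>?k\<^esub> = \<one>\<^bsub>?Q\<^esub>" using h.hom_one by (simp add: \<kappa>_def mpoly_const_one)
  qed (auto simp: k.ring_axioms Q.ring_axioms)
  then interpret \<kappa>: ring_hom_ring ?k ?Q \<kappa> .
  have K: "subfield (range \<kappa>) ?Q"
    using \<kappa>.img_is_subfield(2)[OF k.carrier_is_subfield one_ne] by simp
  \<comment> \<open>one representing monomial for each element of the sumset\<close>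
  have "\<forall>s\<in>sumset t. \<exists>e. s = comb e \<and> csum e = t" by (auto simp: sumset_def)
  then obtain E where E: "\<And>s. s \<in> sumset t \<Longrightarrow> s = comb (E s)" "\<And>s. s \<in> sumset t \<Longrightarrow> csum (E s) = t"
    by metis
  define Y where "Y s c = single (yexp (E s)) (c :: 'k)" for s c
  have Yp: "Y s c \<in> multi_piece m t" if "s \<in> sumset t" for s c
    using single_yexp_piece[of "E s" c] E(2)[OF that] by (simp add: Y_def)
  have Yc: "Y s c \<in> multi_carrier m" if "s \<in> sumset t" for s c
    using Yp[OF that] piece_carrier by blast
  have evY: "ev (Y s c) = single (exponent s) c" if "s \<in> sumset t" for s c
    using E(1)[OF that] by (simp add: Y_def ev_single_yexp)
  define u where "u s = I +>\<^bsub>B\<^esub> Y s 1" for s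
  have uC: "u \<in> sumset t \<rightarrow> carrier ?Q" using h.hom_closed Yc by (auto simp: u_def)
  have lin: "(\<Oplus>\<^bsub>?Q\<^esub>s\<in>sumset t. \<kappa> (c s) \<otimes>\<^bsub>?Q\<^esub> u s) = I +>\<^bsub>B\<^esub> (\<Sum>s\<in>sumset t. Y s (c s))" for c
  proof -
    have "(\<Oplus>\<^bsub>?Q\<^esub>s\<in>sumset t. \<kappa> (c s) \<otimes>\<^bsub>?Q\<^esub> u s) = (\<Oplus>\<^bsub>?Q\<^esub>s\<in>sumset t. I +>\<^bsub>B\<^esub> Y s (c s))"
    proof (rule Q.finsum_cong')
      fix s assume s: "s \<in> sumset t"
      have "mpoly_const (c s) * Y s 1 = Y s (c s)" by (simp add: mpoly_const_def Y_def mult_single)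
      thus "\<kappa> (c s) \<otimes>\<^bsub>?Q\<^esub> u s = I +>\<^bsub>B\<^esub> Y s (c s)"
        using h.hom_mult[of "mpoly_const (c s)" "Y s 1"] cc Yc[OF s] by (simp add: \<kappa>_def u_def)
    qed (use h.hom_closed Yc in auto)
    also have "\<dots> = I +>\<^bsub>B\<^esub> (finsum B (\<lambda>s. Y s (c s)) (sumset t))"
      by (subst h.hom_finsum) (use Yc in \<open>auto simp: comp_def\<close>)
    also have "finsum B (\<lambda>s. Y s (c s)) (sumset t) = (\<Sum>s\<in>sumset t. Y s (c s))"
      unfolding multi_ring_def
      by (rule finsum_type_algebra) (use cring_multi_ring Yc finite_sumset in \<open>auto simp: multi_ring_def\<close>)
    finally show ?thesis .
  qed
  have sumY: "(\<Sum>s\<in>sumset t. Y s (c s)) \<in> multi_piece m t" for c by (rule multi_piece_sum) (rule Yp)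
  have coeff: "lookup (ev (\<Sum>s\<in>sumset t. Y s (c s))) (exponent s) = (if s \<in> sumset t then c s else 0)" for c s
  proof -
    have "lookup (ev (\<Sum>s\<in>sumset t. Y s (c s))) (exponent s) = (\<Sum>s'\<in>sumset t. if s' = s then c s' else 0)"
      unfolding ev_sum lookup_sum
      by (rule sum.cong) (auto simp: evY lookup_single when_def exponent_inject)
    thus ?thesis using finite_sumset by simp
  qed
  have "Q.dimension (card (sumset t)) (range \<kappa>)
      {\<Oplus>\<^bsub>?Q\<^esub>s\<in>sumset t. c s \<otimes>\<^bsub>?Q\<^esub> u s | c. c \<in> sumset t \<rightarrow> range \<kappa>}"
  proof (rule Q.dimension_family(1)[OF K finite_sumset uC])
    fix c s assume c: "c \<in> sumset t \<rightarrow> range \<kappa>" and s: "s \<in> sumset t"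
      and zero: "(\<Oplus>\<^bsub>?Q\<^esub>s\<in>sumset t. c s \<otimes>\<^bsub>?Q\<^esub> u s) = \<zero>\<^bsub>?Q\<^esub>"
    from c have "\<forall>s\<in>sumset t. \<exists>b. c s = \<kappa> b" by auto
    then obtain b where b: "\<And>s. s \<in> sumset t \<Longrightarrow> c s = \<kappa> (b s)" by metis
    have "(\<Oplus>\<^bsub>?Q\<^esub>s\<in>sumset t. c s \<otimes>\<^bsub>?Q\<^esub> u s) = (\<Oplus>\<^bsub>?Q\<^esub>s\<in>sumset t. \<kappa> (b s) \<otimes>\<^bsub>?Q\<^esub> u s)"
      by (rule Q.finsum_cong') (use uC b \<kappa>.hom_closed in auto)
    with zero have "I +>\<^bsub>B\<^esub> (\<Sum>s\<in>sumset t. Y s (b s)) = \<zero>\<^bsub>?Q\<^esub>" unfolding lin by simp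
    hence "(\<Sum>s\<in>sumset t. Y s (b s)) \<in> I"
      by (intro coset_zero subsetD[OF piece_carrier sumY])
    hence "b s = 0" using I_subset_kernel coeff[of b s] s by auto
    thus "c s = \<zero>\<^bsub>?Q\<^esub>" using b[OF s] \<kappa>.hom_zero by simp
  qed
  also have "{\<Oplus>\<^bsub>?Q\<^esub>s\<in>sumset t. c s \<otimes>\<^bsub>?Q\<^esub> u s | c. c \<in> sumset t \<rightarrow> range \<kappa>} = (\<lambda>F. I +>\<^bsub>B\<^esub> F) ` multi_piece m t"
  proof (intro equalityI subsetI)
    fix x assume "x \<in> {\<Oplus>\<^bsub>?Q\<^esub>s\<in>sumset t. c s \<otimes>\<^bsub>?Q\<^esub> u s | c. c \<in> sumset t \<rightarrow> range \<kappa>}"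
    then obtain c where c: "c \<in> sumset t \<rightarrow> range \<kappa>" "x = (\<Oplus>\<^bsub>?Q\<^esub>s\<in>sumset t. c s \<otimes>\<^bsub>?Q\<^esub> u s)" by blast
    from c have "\<forall>s\<in>sumset t. \<exists>b. c s = \<kappa> b" by auto
    then obtain b where b: "\<And>s. s \<in> sumset t \<Longrightarrow> c s = \<kappa> (b s)" by metis
    have "x = (\<Oplus>\<^bsub>?Q\<^esub>s\<in>sumset t. \<kappa> (b s) \<otimes>\<^bsub>?Q\<^esub> u s)"
      unfolding c(2) by (rule Q.finsum_cong') (use uC b \<kappa>.hom_closed in auto)
    thus "x \<in> (\<lambda>F. I +>\<^bsub>B\<^esub> F) ` multi_piece m t" unfolding lin using sumY by blast
  next
    fix x assume "x \<in> (\<lambda>F. I +>\<^bsub>B\<^esub> F) ` multi_piece m t"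
    then obtain F where F: "F \<in> multi_piece m t" "x = I +>\<^bsub>B\<^esub> F" by blast
    define b where "b s = lookup (ev F) (exponent s)" for s
    let ?G = "\<Sum>s\<in>sumset t. Y s (b s)"
    have "ev ?G = ev F"
    proof (rule poly_mapping_eqI)
      fix e
      have "lookup (ev F) e = 0" if "lookup e \<notin> sumset t"
        using keys_ev[OF F(1), of e] that by (auto simp: in_keys_iff)
      thus "lookup (ev ?G) e = lookup (ev F) e" using coeff[of b "lookup e"] by (auto simp: b_def)
    qed
    hence "ev (F + - ?G) = 0" by (simp only: ev_add ev_minus) simp
    moreover have "F + - ?G \<in> multi_piece m t" using F sumY by (intro multi_piece_closed)
    ultimately have "F - ?G \<in> I" using piece_in_I_iff by simp
    hence "x = I +>\<^bsub>B\<^esub> ?G" unfolding F(2) by (intro coset_eq) (use F sumY piece_carrier in auto)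
    thus "x \<in> {\<Oplus>\<^bsub>?Q\<^esub>s\<in>sumset t. c s \<otimes>\<^bsub>?Q\<^esub> u s | c. c \<in> sumset t \<rightarrow> range \<kappa>}"
      unfolding lin[symmetric] by (intro CollectI exI[of _ "\<lambda>s. \<kappa> (b s)"]) auto
  qed
  finally have "Q.dim (range \<kappa>) ((\<lambda>F. I +>\<^bsub>B\<^esub> F) ` multi_piece m t) = card (sumset t)"
    using Q.dimI[OF K] by (simp add: over_def)
  thus ?thesis unfolding hilbert_function_def Let_def \<kappa>_def .
qed

end

section \<open>Dickson's lemma\<close>

text \<open>
  A decreasing sequence of natural numbers is constant from the place on where its least value occurs.
\<close>

lemma nat_mono_subsequence:
  fixes g :: "nat \<Rightarrow> nat"
  shows "\<exists>\<phi> :: nat \<Rightarrow> nat. strict_mono \<phi> \<and> mono (\<lambda>n. g (\<phi> n))"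
proof -
  obtain \<phi> where \<phi>: "strict_mono \<phi>" "monoseq (\<lambda>n. g (\<phi> n))" using seq_monosub[of g] by blast
  show ?thesis
  proof (cases "\<forall>m n. m \<le> n \<longrightarrow> g (\<phi> m) \<le> g (\<phi> n)")
    case True
    thus ?thesis using \<phi>(1) by (auto simp: mono_def)
  next
    case False
    hence dec: "g (\<phi> n) \<le> g (\<phi> m)" if "m \<le> n" for m n
      using \<phi>(2) that unfolding monoseq_def by blast
    define v where "v = (LEAST v. v \<in> range (\<lambda>n. g (\<phi> n)))"
    have "v \<in> range (\<lambda>n. g (\<phi> n))" unfolding v_def by (rule LeastI_ex) blast
    then obtain N where N: "v = g (\<phi> N)" by blast
    have "v \<le> g (\<phi> n)" for n unfolding v_def by (rule Least_le) blast
    hence "g (\<phi> (n + N)) = v" for n using dec[of N "n + N"] by (simp add: N order_antisym)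
    moreover have "strict_mono (\<lambda>n. \<phi> (n + N))" using \<phi>(1) by (simp add: strict_mono_def)
    ultimately show ?thesis by (intro exI[of _ "\<lambda>n. \<phi> (n + N)"]) (auto simp: mono_def)
  qed
qed

lemma mono_subsequence_family:
  fixes s :: "nat \<Rightarrow> 'b \<Rightarrow> nat"
  assumes "finite J"
  shows "\<exists>\<phi> :: nat \<Rightarrow> nat. strict_mono \<phi> \<and> (\<forall>x\<in>J. mono (\<lambda>n. s (\<phi> n) x))"
  using assms
proof (induction J)
  case empty
  show ?case by (intro exI[of _ id]) (auto simp: strict_mono_def)
next
  case (insert y J)
  then obtain \<phi> :: "nat \<Rightarrow> nat" where \<phi>: "strict_mono \<phi>" "\<forall>x\<in>J. mono (\<lambda>n. s (\<phi> n) x)" by blast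
  obtain \<psi> :: "nat \<Rightarrow> nat" where \<psi>: "strict_mono \<psi>" "mono (\<lambda>n. s (\<phi> (\<psi> n)) y)"
    using nat_mono_subsequence[of "\<lambda>n. s (\<phi> n) y"] by blast
  have "strict_mono (\<lambda>n. \<phi> (\<psi> n))" using \<phi>(1) \<psi>(1) by (simp add: strict_mono_def)
  moreover have "mono (\<lambda>n. s (\<phi> (\<psi> n)) x)" if "x \<in> J" for x
    using \<phi>(2) that strict_mono_leD[OF \<psi>(1)] by (auto simp: mono_def)
  ultimately show ?case using \<psi>(2) by (intro exI[of _ "\<lambda>n. \<phi> (\<psi> n)"]) auto
qed

section \<open>Polynomial functions\<close>

definition poly_fun :: "(('p::finite \<Rightarrow> rat) \<Rightarrow> rat) \<Rightarrow> bool"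
  where "poly_fun g \<longleftrightarrow> (\<exists>P :: ('p, rat) mpoly. \<forall>x. mpoly_eval id x P = g x)"

lemma poly_fun_const: "poly_fun (\<lambda>_. c)"
  unfolding poly_fun_def by (rule exI[of _ "mpoly_const c"]) (simp add: mpoly_eval_const)

lemma poly_fun_coord: "poly_fun (\<lambda>x. x i)"
  unfolding poly_fun_def
  by (rule exI[of _ "single (single i 1) 1"]) (simp add: mpoly_eval_single monom_val_def)

lemma poly_fun_add:
  assumes "poly_fun g" "poly_fun h"
  shows "poly_fun (\<lambda>x. g x + h x)"
proof -
  obtain P Q where "\<And>x. mpoly_eval id x P = g x" "\<And>x. mpoly_eval id x Q = h x"
    using assms unfolding poly_fun_def by blast
  thus ?thesis unfolding poly_fun_def
    by (intro exI[of _ "P + Q"]) (simp add: mpoly_eval_add)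
qed

lemma poly_fun_mult:
  assumes "poly_fun g" "poly_fun h"
  shows "poly_fun (\<lambda>x. g x * h x)"
proof -
  obtain P Q where "\<And>x. mpoly_eval id x P = g x" "\<And>x. mpoly_eval id x Q = h x"
    using assms unfolding poly_fun_def by blast
  thus ?thesis unfolding poly_fun_def
    by (intro exI[of _ "P * Q"]) (simp add: mpoly_eval_mult)
qed

lemma poly_fun_diff: "poly_fun g \<Longrightarrow> poly_fun h \<Longrightarrow> poly_fun (\<lambda>x. g x - h x)"
  using poly_fun_add[of g "\<lambda>x. (-1) * h x"] poly_fun_mult[OF poly_fun_const[of "-1"], of h] by simp

lemma poly_fun_sum: "(\<And>s. s \<in> S \<Longrightarrow> poly_fun (g s)) \<Longrightarrow> poly_fun (\<lambda>x. \<Sum>s\<in>S. g s x)"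
  by (induction S rule: infinite_finite_induct) (simp_all add: poly_fun_const poly_fun_add)

lemma poly_fun_prod: "(\<And>s. s \<in> S \<Longrightarrow> poly_fun (g s)) \<Longrightarrow> poly_fun (\<lambda>x. \<Prod>s\<in>S. g s x)"
  by (induction S rule: infinite_finite_induct) (simp_all add: poly_fun_const poly_fun_mult)

lemma poly_fun_power: "poly_fun g \<Longrightarrow> poly_fun (\<lambda>x. g x ^ n)"
  by (induction n) (simp_all add: poly_fun_const poly_fun_mult)

lemma poly_fun_shift:
  assumes "poly_fun g"
  shows "poly_fun (\<lambda>x. g (\<lambda>i. x i - c i))"
proof -
  obtain P where P: "\<And>x. mpoly_eval id x P = g x" using assms unfolding poly_fun_def by blast
  have "poly_fun (\<lambda>x. mpoly_eval id (\<lambda>i. x i - c i) P)"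
    unfolding mpoly_eval_def
    by (intro poly_fun_sum poly_fun_mult poly_fun_prod poly_fun_power poly_fun_diff poly_fun_const poly_fun_coord)
  thus ?thesis by (simp add: P)
qed

text \<open>
  Agreement is required where all arguments are large, as in the definition of the multigraded Hilbert polynomial.
\<close>

definition eventually_poly :: "(('p::finite \<Rightarrow> nat) \<Rightarrow> nat) \<Rightarrow> bool"
  where "eventually_poly h \<longleftrightarrow> (\<exists>g N. poly_fun g \<and> (\<forall>t. (\<forall>i. N \<le> t i) \<longrightarrow> of_nat (h t) = g (\<lambda>i. of_nat (t i))))"

section \<open>The Hilbert function is eventually polynomial\<close>

context monomial_map
begin

definition supported :: "('p \<Rightarrow> nat \<Rightarrow> nat) set"
  where "supported = {e. \<forall>i j. m i < j \<longrightarrow> e i j = 0}"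

lemma comb_add: "comb (\<lambda>i j. z i j + z' i j) = (\<lambda>v. comb z v + comb z' v)"
  by (rule ext) (simp add: comb_def distrib_right sum.distrib)

lemma csum_add: "csum (\<lambda>i j. z i j + z' i j) = (\<lambda>i. csum z i + csum z' i)"
  by (rule ext) (simp add: csum_def sum.distrib)

lemma sumset_eq_supported: "sumset t = comb ` {e \<in> supported. csum e = t}"
proof -
  have "comb e \<in> comb ` {e \<in> supported. csum e = t}" if "csum e = t" for e :: "'p \<Rightarrow> nat \<Rightarrow> nat"
  proof
    let ?e = "\<lambda>i j. if j \<le> m i then e i j else 0"
    show "comb e = comb ?e" unfolding comb_def by (intro ext sum.cong) auto
    have "csum ?e = csum e" unfolding csum_def by (intro ext sum.cong) auto
    thus "?e \<in> {e \<in> supported. csum e = t}" using that by (auto simp: supported_def)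
  qed
  thus ?thesis unfolding sumset_def by auto
qed

text \<open>
  Stars and bars for each factor separately.
\<close>

lemma card_supported:
  "finite {e \<in> supported. csum e = t}"
  "card {e \<in> supported. csum e = t} = (\<Prod>i\<in>UNIV. (t i + m i) choose m i)"
proof -
  let ?L = "\<lambda>i. {l :: nat list. length l = Suc (m i) \<and> sum_list l = t i}"
  have cardL: "card (?L i) = (t i + m i) choose m i" for i
    using binomial_symmetric[of "m i" "t i + m i"] by (simp add: card_length_sum_list add.commute)
  have finL: "finite (?L i)" for i
    by (rule card_ge_0_finite) (simp add: cardL)
  have bij: "bij_betw (\<lambda>e i. map (e i) [0..<Suc (m i)]) {e \<in> supported. csum e = t} (PiE UNIV ?L)"
  proof (rule bij_betwI[where g = "\<lambda>l i j. if j \<le> m i then l i ! j else 0"])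
    show "(\<lambda>e i. map (e i) [0..<Suc (m i)]) \<in> {e \<in> supported. csum e = t} \<rightarrow> PiE UNIV ?L"
    proof
      fix e assume e: "e \<in> {e \<in> supported. csum e = t}"
      have "sum_list (map (e i) [0..<Suc (m i)]) = t i" for i
      proof -
        have "sum_list (map (e i) [0..<Suc (m i)]) = sum (e i) {0..<Suc (m i)}"
          by (simp only: interv_sum_list_conv_sum_set_nat set_upt)
        also have "{0..<Suc (m i)} = {..m i}" by auto
        finally show ?thesis using e by (auto simp: csum_def)
      qed
      thus "(\<lambda>i. map (e i) [0..<Suc (m i)]) \<in> PiE UNIV ?L" by (simp add: PiE_UNIV_domain)
    qed
    show "(\<lambda>l i j. if j \<le> m i then l i ! j else 0) \<in> PiE UNIV ?L \<rightarrow> {e \<in> supported. csum e = t}"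
    proof
      fix l assume l: "l \<in> PiE UNIV ?L"
      have "(\<Sum>j\<le>m i. if j \<le> m i then l i ! j else 0) = t i" for i
      proof -
        have li: "length (l i) = Suc (m i)" "sum_list (l i) = t i" using l by auto
        have "t i = (\<Sum>j = 0..<length (l i). l i ! j)" using li(2) by (metis sum_list_sum_nth)
        also have "{0..<length (l i)} = {..m i}" using li by auto
        finally show ?thesis by simp
      qed
      thus "(\<lambda>i j. if j \<le> m i then l i ! j else 0) \<in> {e \<in> supported. csum e = t}"
        by (auto simp: supported_def csum_def)
    qed
    fix e assume e: "e \<in> {e \<in> supported. csum e = t}"
    show "(\<lambda>i j. if j \<le> m i then map (e i) [0..<Suc (m i)] ! j else 0) = e"
      using e by (auto simp: supported_def fun_eq_iff simp del: upt_Suc)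
  next
    fix l assume l: "l \<in> PiE UNIV ?L"
    show "(\<lambda>i. map (\<lambda>j. if j \<le> m i then l i ! j else 0) [0..<Suc (m i)]) = l"
    proof
      fix i
      have "length (l i) = Suc (m i)" using l by auto
      thus "map (\<lambda>j. if j \<le> m i then l i ! j else 0) [0..<Suc (m i)] = l i"
        by (intro nth_equalityI) (auto simp del: upt_Suc)
    qed
  qed
  have "finite (PiE UNIV ?L)" using finL by (intro finite_PiE) auto
  thus "finite {e \<in> supported. csum e = t}" using bij_betw_finite[OF bij] by blast
  show "card {e \<in> supported. csum e = t} = (\<Prod>i\<in>UNIV. (t i + m i) choose m i)"
    unfolding bij_betw_same_card[OF bij] by (subst card_PiE) (simp_all add: cardL)
qed

definition avoid :: "('p \<Rightarrow> nat \<Rightarrow> nat) set \<Rightarrow> ('p \<Rightarrow> nat) \<Rightarrow> ('p \<Rightarrow> nat \<Rightarrow> nat) set"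
  where "avoid M t = {e \<in> supported. csum e = t \<and> (\<forall>u\<in>M. \<not> u \<le> e)}"

lemma finite_avoid: "finite (avoid M t)"
  by (rule finite_subset[OF _ card_supported(1)[of t]]) (auto simp: avoid_def)

text \<open>
  The exponents avoiding all multiples of the elements of \<open>M\<close> are counted by removing one generator
  \<open>u\<close>: an exponent avoiding \<open>M - {u}\<close> either avoids \<open>u\<close> too, or it is \<open>u\<close> plus an exponent avoiding
  the truncated differences \<open>x - u\<close>. Both \<open>M - {u}\<close> and the set of these differences are smaller than \<open>M\<close>.
\<close>

lemma eventually_poly_avoid:
  assumes "finite M" "M \<subseteq> supported"
  shows "eventually_poly (\<lambda>t. card (avoid M t))"
  using assms
proof (induction "card M" arbitrary: M rule: less_induct)
  case (less M)
  show ?case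
  proof (cases "M = {}")
    case True
    define g' where "g' x = (\<Prod>i\<in>UNIV. inverse (fact (m i)) * (\<Prod>k = 0..<m i. (x i - (of_nat k - of_nat (m i)))))"
      for x :: "'p \<Rightarrow> rat"
    have "poly_fun g'" unfolding g'_def
      by (intro poly_fun_prod poly_fun_mult poly_fun_diff poly_fun_const poly_fun_coord)
    moreover have "of_nat (card (avoid M t)) = g' (\<lambda>i. of_nat (t i))" for t
    proof -
      have "of_nat ((t i + m i) choose m i) = inverse (fact (m i)) * (\<Prod>k = 0..<m i. ((of_nat (t i) :: rat) - (of_nat k - of_nat (m i))))" for i
        by (simp add: binomial_gbinomial gbinomial_prod_rev divide_inverse algebra_simps)
      thus ?thesis using card_supported(2)[of t] True by (simp add: avoid_def g'_def)
    qed
    ultimately show ?thesis unfolding eventually_poly_def by blast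
  next
    case False
    then obtain u where u: "u \<in> M" by blast
    define M0 where "M0 = M - {u}"
    define M' where "M' = (\<lambda>x i j. x i j - u i j) ` M0"
    have fin: "finite M0" "finite M'" using less.prems by (auto simp: M0_def M'_def)
    have card0: "card M0 < card M" unfolding M0_def by (rule card_Diff1_less[OF less.prems(1) u])
    hence card': "card M' < card M" unfolding M'_def using card_image_le[OF fin(1)] by (rule le_less_trans[rotated])
    have sub: "M0 \<subseteq> supported" "M' \<subseteq> supported" using less.prems by (auto simp: M0_def M'_def supported_def)
    have ud: "u \<in> supported" using u less.prems by blast
    obtain g N where g: "poly_fun g" "\<And>t. (\<forall>i. N \<le> t i) \<Longrightarrow> of_nat (card (avoid M0 t)) = g (\<lambda>i. of_nat (t i))"
      using less.hyps[OF card0 fin(1) sub(1)] unfolding eventually_poly_def by blast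
    obtain g' N' where g': "poly_fun g'" "\<And>t. (\<forall>i. N' \<le> t i) \<Longrightarrow> of_nat (card (avoid M' t)) = g' (\<lambda>i. of_nat (t i))"
      using less.hyps[OF card' fin(2) sub(2)] unfolding eventually_poly_def by blast
    define c where "c = csum u"
    have split: "card (avoid M t) + card (avoid M' (\<lambda>i. t i - c i)) = card (avoid M0 t)" if t: "\<And>i. c i \<le> t i" for t
    proof -
      let ?s = "\<lambda>e i j. e i j + u i j"
      have "avoid M0 t = avoid M t \<union> ?s ` avoid M' (\<lambda>i. t i - c i)"
      proof (intro equalityI subsetI)
        fix e assume e: "e \<in> avoid M0 t"
        show "e \<in> avoid M t \<union> ?s ` avoid M' (\<lambda>i. t i - c i)"
        proof (cases "u \<le> e")
          case True
          let ?e = "\<lambda>i j. e i j - u i j"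
          have eq: "e = ?s ?e" using True by (auto simp: le_fun_def fun_eq_iff)
          have "csum e = (\<lambda>i. csum ?e i + c i)" by (subst eq, subst csum_add) (simp add: c_def)
          hence tc: "t = (\<lambda>i. csum ?e i + c i)" using e by (simp add: avoid_def)
          have "csum ?e = (\<lambda>i. t i - c i)" by (subst tc) simp
          moreover have "\<not> x \<le> ?e" if "x \<in> M'" for x
          proof
            assume "x \<le> ?e"
            obtain y where y: "y \<in> M0" "x = (\<lambda>i j. y i j - u i j)" using \<open>x \<in> M'\<close> by (auto simp: M'_def)
            have "y i j - u i j \<le> e i j - u i j" "u i j \<le> e i j" for i j
              using \<open>x \<le> ?e\<close> True y(2) by (auto simp: le_fun_def)
            hence "y i j \<le> e i j" for i j by (metis le_diff_iff nat_le_linear order_trans)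
            hence "y \<le> e" by (auto simp: le_fun_def)
            thus False using e y(1) by (auto simp: avoid_def)
          qed
          ultimately have "?e \<in> avoid M' (\<lambda>i. t i - c i)" using e by (auto simp: avoid_def supported_def)
          thus ?thesis by (intro UnI2 image_eqI[where f = ?s and x = ?e, OF eq])
        next
          case False
          thus ?thesis using e by (auto simp: avoid_def M0_def)
        qed
      next
        fix e assume "e \<in> avoid M t \<union> ?s ` avoid M' (\<lambda>i. t i - c i)"
        thus "e \<in> avoid M0 t"
        proof
          assume "e \<in> ?s ` avoid M' (\<lambda>i. t i - c i)"
          then obtain e' where e': "e' \<in> avoid M' (\<lambda>i. t i - c i)" "e = ?s e'" by blast
          have "csum e = t" unfolding e'(2) csum_add using e'(1) t by (auto simp: avoid_def c_def[symmetric])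
          moreover have "\<not> y \<le> e" if "y \<in> M0" for y
          proof
            assume "y \<le> e"
            hence "(\<lambda>i j. y i j - u i j) \<le> e'" by (auto simp: le_fun_def e'(2) le_diff_conv)
            thus False using e'(1) that by (auto simp: avoid_def M'_def)
          qed
          ultimately show ?thesis using e' ud by (auto simp: avoid_def supported_def)
        qed (auto simp: avoid_def M0_def)
      qed
      moreover have "avoid M t \<inter> ?s ` avoid M' (\<lambda>i. t i - c i) = {}"
        using u by (auto simp: avoid_def le_fun_def)
      moreover have "inj_on ?s A" for A by (rule inj_onI) (simp add: fun_eq_iff)
      ultimately show ?thesis by (simp add: card_Un_disjoint finite_avoid card_image)
    qed
    define h where "h x = g x - g' (\<lambda>i. x i - of_nat (c i))" for x
    have "poly_fun h" unfolding h_def using g(1) poly_fun_shift[OF g'(1)] by (rule poly_fun_diff)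
    moreover have "of_nat (card (avoid M t)) = h (\<lambda>i. of_nat (t i))" if t: "\<forall>i. N + N' + (\<Sum>i\<in>UNIV. c i) \<le> t i" for t
    proof -
      have ct: "c i + N' \<le> t i" "N \<le> t i" for i
        using t[rule_format, of i] member_le_sum[of i UNIV c] by auto
      have ci: "c i \<le> t i" for i using ct(1)[of i] by simp
      have 1: "of_nat (card (avoid M0 t)) = g (\<lambda>i. of_nat (t i))"
        by (rule g(2)) (use ct(2) in blast)
      have "N' \<le> t i - c i" for i using ct(1)[of i] by simp
      hence "of_nat (card (avoid M' (\<lambda>i. t i - c i))) = g' (\<lambda>i. of_nat (t i - c i))"
        by (intro g'(2)) blast
      also have "(\<lambda>i. of_nat (t i - c i) :: rat) = (\<lambda>i. of_nat (t i) - of_nat (c i))"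
        using ci by (intro ext of_nat_diff)
      finally have 2: "of_nat (card (avoid M' (\<lambda>i. t i - c i))) = g' (\<lambda>i. of_nat (t i) - of_nat (c i))" .
      have "of_nat (card (avoid M t)) + (of_nat (card (avoid M' (\<lambda>i. t i - c i))) :: rat) = of_nat (card (avoid M0 t))"
        using split[of t, OF ci] by (metis of_nat_add)
      hence "of_nat (card (avoid M t)) = (of_nat (card (avoid M0 t)) :: rat) - of_nat (card (avoid M' (\<lambda>i. t i - c i)))"
        by simp
      also have "\<dots> = h (\<lambda>i. of_nat (t i))" unfolding h_def 1 2 ..
      finally show ?thesis .
    qed
    ultimately show ?thesis unfolding eventually_poly_def by blast
  qed
qed

text \<open>
  An infinite set of minimal elements would contain an injective sequence, which has a
  subsequence that is increasing in each coordinate, contradicting minimality.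
\<close>

lemma dickson:
  assumes "U \<subseteq> supported"
  shows "\<exists>M\<subseteq>U. finite M \<and> (\<forall>e\<in>U. \<exists>u\<in>M. u \<le> e)"
proof -
  define M where "M = {u\<in>U. \<forall>x\<in>U. x \<le> u \<longrightarrow> x = u}"
  have "finite M"
  proof (rule ccontr)
    assume "infinite M"
    then obtain s :: "nat \<Rightarrow> 'p \<Rightarrow> nat \<Rightarrow> nat" where s: "inj s" "range s \<subseteq> M"
      using infinite_countable_subset by blast
    have fin: "finite (Sigma UNIV (\<lambda>i. {..m i}))" by simp
    obtain \<phi> :: "nat \<Rightarrow> nat" where \<phi>: "strict_mono \<phi>" "\<forall>x\<in>Sigma UNIV (\<lambda>i. {..m i}). mono (\<lambda>n. s (\<phi> n) (fst x) (snd x))"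
      using mono_subsequence_family[OF fin, of "\<lambda>n x. s n (fst x) (snd x)"] by blast
    have mem: "s n \<in> M" for n using s(2) by blast
    have "s (\<phi> 0) \<le> s (\<phi> 1)"
    proof (intro le_funI)
      fix i j
      show "s (\<phi> 0) i j \<le> s (\<phi> 1) i j"
      proof (cases "j \<le> m i")
        case True
        hence "mono (\<lambda>n. s (\<phi> n) i j)" using \<phi>(2) by force
        thus ?thesis by (simp add: mono_def)
      next
        case False
        have "s (\<phi> 0) \<in> supported" using mem assms by (auto simp: M_def)
        thus ?thesis using False by (auto simp: supported_def)
      qed
    qed
    hence "s (\<phi> 0) = s (\<phi> 1)" using mem[of "\<phi> 1"] mem[of "\<phi> 0"] by (auto simp: M_def)
    hence "\<phi> 0 = \<phi> 1" using s(1) by (simp add: inj_eq)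
    thus False using \<phi>(1) by (simp add: strict_mono_eq)
  qed
  moreover have "\<exists>u\<in>M. u \<le> e" if "e \<in> U" for e
    using that
  proof (induction "\<Sum>i\<in>UNIV. csum e i" arbitrary: e rule: less_induct)
    case (less e)
    show ?case
    proof (cases "e \<in> M")
      case False
      then obtain x where x: "x \<in> U" "x \<le> e" "x \<noteq> e" using less.prems by (auto simp: M_def)
      then obtain i j where ij: "x i j \<noteq> e i j" by (auto simp: fun_eq_iff)
      hence lt: "x i j < e i j" using x(2) by (simp add: le_fun_def order_less_le)
      have "j \<le> m i"
      proof (rule ccontr)
        assume "\<not> j \<le> m i"
        hence "e i j = 0" using less.prems assms by (auto simp: supported_def)
        thus False using lt by simp
      qed
      have le: "csum x k \<le> csum e k" for k
        unfolding csum_def using x(2) by (intro sum_mono) (auto simp: le_fun_def)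
      moreover have "csum x i < csum e i"
        unfolding csum_def using x(2) lt \<open>j \<le> m i\<close>
        by (intro sum_strict_mono_ex1) (auto simp: le_fun_def)
      ultimately have "(\<Sum>i\<in>UNIV. csum x i) < (\<Sum>i\<in>UNIV. csum e i)"
        by (intro sum_strict_mono_ex1) auto
      from less.hyps[OF this x(1)] x(2) show ?thesis by (meson order_trans)
    qed auto
  qed
  ultimately show ?thesis by (intro exI[of _ M]) (auto simp: M_def)
qed

text \<open>An additive, injective map into a linearly ordered cancellative monoid, used as term order.\<close>

definition term_key :: "('p \<Rightarrow> nat \<Rightarrow> nat) \<Rightarrow> (nat \<Rightarrow>\<^sub>0 nat)"
  where "term_key e = (\<Sum>i\<in>UNIV. \<Sum>j\<le>m i. single (to_nat (i, j)) (e i j))"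

lemma term_key_add: "term_key (\<lambda>i j. e i j + e' i j) = term_key e + term_key e'"
  by (simp add: term_key_def single_add sum.distrib)

lemma term_key_inject:
  assumes "e \<in> supported" "e' \<in> supported" "term_key e = term_key e'"
  shows "e = e'"
proof (intro ext)
  fix i j
  have *: "lookup (term_key e) (to_nat (i, j)) = e i j" if "j \<le> m i" for e
  proof -
    have "lookup (term_key e) (to_nat (i, j)) = (\<Sum>i'\<in>UNIV. \<Sum>j'\<le>m i'. if i' = i then if j' = j then e i j else 0 else 0)"
      unfolding term_key_def lookup_sum by (intro sum.cong) (auto simp: lookup_single when_def)
    also have "\<dots> = (\<Sum>i'\<in>UNIV. if i' = i then (\<Sum>j'\<le>m i. if j' = j then e i j else 0) else 0)"
      by (intro sum.cong) auto
    also have "\<dots> = e i j" using that by simp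
    finally show ?thesis .
  qed
  show "e i j = e' i j"
  proof (cases "j \<le> m i")
    case True
    thus ?thesis using * assms(3) by metis
  next
    case False
    thus ?thesis using assms by (simp add: supported_def)
  qed
qed

text \<open>
  Each element of the sumset has a least representation with respect to the term order. As the order
  is compatible with addition, the exponents that are not least form an upward closed set, which is
  finitely generated by Dickson's lemma; so the least ones are the exponents avoiding finitely many
  generators. This is Khovanskii's theorem on the growth of sumsets.
\<close>

theorem card_sumset_eventually_poly: "eventually_poly (\<lambda>t. card (sumset t))"
proof -
  define U where "U = {e \<in> supported. \<exists>e'\<in>supported. csum e' = csum e \<and> (comb e' :: 'v \<Rightarrow> nat) = comb e \<and> term_key e' < term_key e}"
  obtain M where M: "M \<subseteq> U" "finite M" "\<forall>e\<in>U. \<exists>u\<in>M. u \<le> e"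
    using dickson[of U] by (auto simp: U_def)
  have up: "x \<in> U" if "u \<in> U" "u \<le> x" "x \<in> supported" for u x
  proof -
    obtain e' where e': "e' \<in> supported" "csum e' = csum u" "(comb e' :: 'v \<Rightarrow> nat) = comb u" "term_key e' < term_key u"
      using \<open>u \<in> U\<close> by (auto simp: U_def)
    let ?g = "\<lambda>i j. x i j - u i j"
    have x: "x = (\<lambda>i j. u i j + ?g i j)" using that(2) by (auto simp: le_fun_def fun_eq_iff)
    let ?e = "\<lambda>i j. e' i j + ?g i j"
    have "?e \<in> supported" using e'(1) that(3) by (auto simp: supported_def)
    moreover have "csum ?e = csum x" by (subst (2) x) (simp only: csum_add e')
    moreover have "(comb ?e :: 'v \<Rightarrow> nat) = comb x" by (subst (2) x) (simp only: comb_add e')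
    moreover have "term_key ?e < term_key x" by (subst (2) x) (simp only: term_key_add add_strict_right_mono e')
    ultimately show ?thesis using that(3) unfolding U_def by blast
  qed
  have notU: "e \<notin> U \<longleftrightarrow> (\<forall>u\<in>M. \<not> u \<le> e)" if "e \<in> supported" for e
    using M up that by blast
  have "card (sumset t) = card (avoid M t)" for t
  proof -
    have av: "avoid M t = {e \<in> supported. csum e = t \<and> e \<notin> U}" using notU by (auto simp: avoid_def)
    have "inj_on (comb :: _ \<Rightarrow> 'v \<Rightarrow> nat) (avoid M t)"
    proof (rule inj_onI)
      fix e e' assume e: "e \<in> avoid M t" "e' \<in> avoid M t" "(comb e :: 'v \<Rightarrow> nat) = comb e'"
      have "\<not> term_key e < term_key e'" "\<not> term_key e' < term_key e" using e unfolding av U_def by auto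
      hence "term_key e = term_key e'" by simp
      thus "e = e'" using term_key_inject e by (simp add: av)
    qed
    moreover have "comb ` avoid M t = sumset t"
    proof (intro equalityI subsetI)
      fix s assume "s \<in> sumset t"
      define Fb where "Fb = {e \<in> supported. csum e = t \<and> comb e = s}"
      have fin: "finite Fb" by (rule finite_subset[OF _ card_supported(1)[of t]]) (auto simp: Fb_def)
      have "Fb \<noteq> {}" using \<open>s \<in> sumset t\<close> unfolding sumset_eq_supported Fb_def by auto
      hence "Min (term_key ` Fb) \<in> term_key ` Fb" using fin by simp
      then obtain e where e: "e \<in> Fb" "term_key e = Min (term_key ` Fb)" by auto
      have "e \<notin> U"
      proof
        assume "e \<in> U"
        then obtain e' where e': "e' \<in> supported" "csum e' = csum e" "comb e' = comb e" "term_key e' < term_key e"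
          by (auto simp: U_def)
        hence "e' \<in> Fb" using e(1) by (auto simp: Fb_def)
        hence "term_key e \<le> term_key e'" unfolding e(2) using fin by simp
        thus False using e'(4) by simp
      qed
      hence "e \<in> avoid M t" using e(1) unfolding av Fb_def by auto
      thus "s \<in> comb ` avoid M t" using e(1) by (auto simp: Fb_def)
    qed (auto simp: sumset_eq_supported avoid_def)
    ultimately show ?thesis using card_image by metis
  qed
  thus ?thesis using eventually_poly_avoid[OF M(2)] M(1) by (auto simp: U_def)
qed

end

section \<open>The binomial basis\<close>

definition binom_prod :: "('p::finite \<Rightarrow> nat) \<Rightarrow> ('p \<Rightarrow> 'a::field_char_0) \<Rightarrow> 'a"
  where "binom_prod d t = (\<Prod>i\<in>UNIV. (t i + of_nat (d i)) gchoose d i)"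

text \<open>
  Linear combinations are built one summand at a time, so that closure properties follow by rule
  induction without bookkeeping of supports.
\<close>

inductive binom_span :: "(('p::finite \<Rightarrow> rat) \<Rightarrow> rat) \<Rightarrow> bool" where
  zero: "binom_span (\<lambda>_. 0)"
| step: "binom_span g \<Longrightarrow> binom_span (\<lambda>t. c * binom_prod d t + g t)"

lemma binom_span_add: "binom_span g \<Longrightarrow> binom_span h \<Longrightarrow> binom_span (\<lambda>t. g t + h t)"
proof (induction rule: binom_span.induct)
  case (step g c d)
  from binom_span.step[OF step.IH[OF step.prems], of c d] show ?case by (simp add: add.assoc)
qed simp

lemma binom_span_scale: "binom_span g \<Longrightarrow> binom_span (\<lambda>t. b * g t)"
proof (induction rule: binom_span.induct)
  case (step g c d)
  from binom_span.step[OF step.IH, of "b * c" d] show ?case by (simp add: algebra_simps)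
qed (simp add: binom_span.zero)

lemma binom_prod_coord:
  "t i * binom_prod d t = of_nat (Suc (d i)) * binom_prod (d(i := Suc (d i))) t + - of_nat (Suc (d i)) * binom_prod d t"
  for t :: "'p::finite \<Rightarrow> 'a::field_char_0"
proof -
  have rem: "binom_prod e t = ((t i + of_nat (e i)) gchoose e i) * (\<Prod>j\<in>UNIV - {i}. (t j + of_nat (e j)) gchoose e j)" for e
    unfolding binom_prod_def by (rule prod.remove) auto
  have "of_nat (Suc (d i)) * ((t i + of_nat (Suc (d i))) gchoose Suc (d i)) = (t i + of_nat (Suc (d i))) * ((t i + of_nat (d i)) gchoose d i)"
    using Suc_times_gbinomial[of "d i" "t i + of_nat (d i)"] by (simp add: add_ac)
  moreover have "(\<Prod>j\<in>UNIV - {i}. (t j + of_nat ((d(i := Suc (d i))) j)) gchoose (d(i := Suc (d i))) j) =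
      (\<Prod>j\<in>UNIV - {i}. (t j + of_nat (d j)) gchoose d j)"
    by (rule prod.cong) auto
  moreover have "x * (b * q) = n * (b' * q) + - n * (b * q)" if "n * b' = (x + n) * b" for x n b b' q :: 'a
  proof -
    have "n * (b' * q) = (x + n) * b * q" by (simp only: that mult.assoc[symmetric])
    thus ?thesis by (simp add: algebra_simps)
  qed
  ultimately show ?thesis
    unfolding rem[of d] rem[of "d(i := Suc (d i))"] by (simp only: fun_upd_same)
qed

text \<open>
  Multiplication by a coordinate preserves the span by \<open>binom_prod_coord\<close>, a form of the absorption
  identity. Since the span contains \<open>1\<close>, it contains all polynomials.
\<close>

lemma binom_span_coord: "binom_span g \<Longrightarrow> binom_span (\<lambda>t. t i * g t)"
  for i :: "'p::finite"
proof (induction rule: binom_span.induct)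
  case (step g c d)
  let ?n = "of_nat (Suc (d i)) :: rat"
  have "binom_span (\<lambda>t. (c * ?n) * binom_prod (d(i := Suc (d i))) t + ((c * - ?n) * binom_prod d t + t i * g t))"
    by (intro binom_span.step step.IH)
  moreover have "(\<lambda>t. t i * (c * binom_prod d t + g t)) =
      (\<lambda>t. (c * ?n) * binom_prod (d(i := Suc (d i))) t + ((c * - ?n) * binom_prod d t + t i * g t))"
  proof
    fix t :: "'p \<Rightarrow> rat"
    have "t i * (c * binom_prod d t + g t) = c * (t i * binom_prod d t) + t i * g t"
      by (simp add: algebra_simps)
    also have "t i * binom_prod d t = ?n * binom_prod (d(i := Suc (d i))) t + - ?n * binom_prod d t"
      by (rule binom_prod_coord)
    finally show "t i * (c * binom_prod d t + g t) =
      (c * ?n) * binom_prod (d(i := Suc (d i))) t + ((c * - ?n) * binom_prod d t + t i * g t)"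
      by (simp add: algebra_simps)
  qed
  ultimately show ?case by simp
qed (simp add: binom_span.zero)

lemma binom_span_one: "binom_span (\<lambda>_. 1)"
  using binom_span.step[OF binom_span.zero, of 1 "\<lambda>_. 0"] by (simp add: binom_prod_def)

lemma binom_span_monomial: "binom_span (\<lambda>t. \<Prod>i\<in>A. t i ^ k i)"
proof (induction A rule: infinite_finite_induct)
  case (insert x A)
  have "binom_span (\<lambda>t. t x ^ n * (\<Prod>i\<in>A. t i ^ k i))" for n
  proof (induction n)
    case (Suc n)
    from binom_span_coord[OF this, of x] show ?case by (simp add: mult.assoc)
  qed (use insert in simp)
  thus ?case using insert by simp
qed (simp_all add: binom_span_one)

lemma binom_span_sum: "(\<And>s. s \<in> S \<Longrightarrow> binom_span (g s)) \<Longrightarrow> binom_span (\<lambda>t. \<Sum>s\<in>S. g s t)"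
  by (induction S rule: infinite_finite_induct) (simp_all add: binom_span.zero binom_span_add)

lemma binom_span_eval: "binom_span (\<lambda>t. mpoly_eval id t P)"
  unfolding mpoly_eval_def by (intro binom_span_sum binom_span_scale binom_span_monomial)

lemma binom_sum_superset:
  assumes "finite A" "{d. e d \<noteq> 0} \<subseteq> A"
  shows "(\<Sum>d | e d \<noteq> 0. e d * b d) = (\<Sum>d\<in>A. e d * (b d :: 'a::field_char_0))"
  by (rule sum.mono_neutral_left) (use assms in auto)

lemma binom_span_coeffs:
  "binom_span g \<Longrightarrow> \<exists>e. finite {d. e d \<noteq> 0} \<and> (\<forall>t. g t = (\<Sum>d | e d \<noteq> 0. e d * binom_prod d t))"
proof (induction rule: binom_span.induct)
  case zero
  show ?case by (rule exI[of _ "\<lambda>_. 0"]) simp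
next
  case (step g c d)
  then obtain e where e: "finite {d. e d \<noteq> 0}" "\<And>t. g t = (\<Sum>d | e d \<noteq> 0. e d * binom_prod d t)" by blast
  let ?e = "e(d := e d + c)"
  let ?A = "insert d {d. e d \<noteq> 0}"
  have sub: "{d. ?e d \<noteq> 0} \<subseteq> ?A" by auto
  have fin: "finite ?A" using e(1) by simp
  have "c * binom_prod d t + g t = (\<Sum>d | ?e d \<noteq> 0. ?e d * binom_prod d t)" for t
  proof -
    have "(\<Sum>d | ?e d \<noteq> 0. ?e d * binom_prod d t) = (\<Sum>d\<in>?A. ?e d * binom_prod d t)"
      by (rule binom_sum_superset[OF fin sub])
    also have "\<dots> = ?e d * binom_prod d t + (\<Sum>d\<in>?A - {d}. ?e d * binom_prod d t)"
      by (rule sum.remove) (use fin in auto)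
    also have "(\<Sum>d\<in>?A - {d}. ?e d * binom_prod d t) = (\<Sum>d\<in>?A - {d}. e d * binom_prod d t)"
      by (rule sum.cong) auto
    also have "?e d * binom_prod d t + \<dots> = c * binom_prod d t + (e d * binom_prod d t + (\<Sum>d\<in>?A - {d}. e d * binom_prod d t))"
      by (simp add: algebra_simps)
    also have "e d * binom_prod d t + (\<Sum>d\<in>?A - {d}. e d * binom_prod d t) = (\<Sum>d\<in>?A. e d * binom_prod d t)"
      by (rule sum.remove[symmetric]) (use fin in auto)
    also have "\<dots> = g t" unfolding e(2) by (rule binom_sum_superset[symmetric]) (use fin in auto)
    finally show ?thesis by simp
  qed
  thus ?case using finite_subset[OF sub fin] by blast
qed

text \<open>
  The binomial products are linearly independent: at \<open>t = - 1 - d0\<close> the product of type \<open>d\<close>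
  vanishes unless \<open>d \<le> d0\<close>, so the coefficient of a minimal \<open>d0\<close> can be read off there.
\<close>

lemma binom_prod_negative:
  "binom_prod d (\<lambda>i. - 1 - of_nat (d0 i) :: rat) = (\<Prod>i\<in>UNIV. (-1) ^ d i * of_nat (d0 i choose d i))"
  unfolding binom_prod_def
proof (rule prod.cong[OF refl])
  fix i
  show "((- 1 - of_nat (d0 i) + of_nat (d i)) gchoose d i) = (-1) ^ d i * (of_nat (d0 i choose d i) :: rat)"
    by (subst gbinomial_negated_upper) (simp add: binomial_gbinomial)
qed

lemma binom_coeffs_unique:
  assumes "finite D" and zero: "\<And>t :: 'p::finite \<Rightarrow> rat. (\<Sum>d\<in>D. c d * binom_prod d t) = 0" and "d0 \<in> D"
  shows "c d0 = 0"
  using \<open>d0 \<in> D\<close>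
proof (induction "\<Sum>i\<in>UNIV. d0 i" arbitrary: d0 rule: less_induct)
  case (less d0)
  let ?t = "\<lambda>i. - 1 - of_nat (d0 i) :: rat"
  have "c d * binom_prod d ?t = 0" if d: "d \<in> D" "d \<noteq> d0" for d
  proof (cases "d \<le> d0")
    case True
    then obtain i where "d i < d0 i" using d(2) by (metis ext le_funD le_neq_implies_less)
    hence "(\<Sum>i\<in>UNIV. d i) < (\<Sum>i\<in>UNIV. d0 i)"
      using True by (intro sum_strict_mono_ex1) (auto simp: le_fun_def)
    thus ?thesis using less.hyps d by simp
  next
    case False
    then obtain i where "d0 i < d i" by (auto simp: le_fun_def not_le)
    hence "(-1) ^ d i * (of_nat (d0 i choose d i) :: rat) = 0" by (simp add: binomial_eq_0)
    hence "binom_prod d ?t = 0" unfolding binom_prod_negative by (intro prod_zero) auto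
    thus ?thesis by simp
  qed
  hence "(\<Sum>d\<in>D - {d0}. c d * binom_prod d ?t) = 0" by (intro sum.neutral) blast
  hence "(\<Sum>d\<in>D. c d * binom_prod d ?t) = c d0 * binom_prod d0 ?t"
    using assms(1) less.prems by (subst sum.remove[of D d0]) auto
  moreover have "binom_prod d0 ?t \<noteq> 0" unfolding binom_prod_negative by simp
  ultimately show ?case using zero by simp
qed

lemma binomial_coeffs_eqI:
  assumes "finite {d. e d \<noteq> 0}" "\<And>t. mpoly_eval id t P = (\<Sum>d | e d \<noteq> 0. e d * binom_prod d t)"
  shows "binomial_coeffs P = e"
  unfolding binomial_coeffs_def
proof (rule the_equality)
  show "finite {d. e d \<noteq> 0} \<and> (\<forall>t. mpoly_eval id t P = (\<Sum>d | e d \<noteq> 0. e d * (\<Prod>i\<in>UNIV. (t i + of_nat (d i)) gchoose d i)))"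
    using assms by (simp add: binom_prod_def)
  fix e' assume e': "finite {d. e' d \<noteq> 0} \<and> (\<forall>t. mpoly_eval id t P = (\<Sum>d | e' d \<noteq> 0. e' d * (\<Prod>i\<in>UNIV. (t i + of_nat (d i)) gchoose d i)))"
  let ?A = "{d. e d \<noteq> 0} \<union> {d. e' d \<noteq> 0}"
  have fin: "finite ?A" using assms(1) e' by simp
  have "(\<Sum>d\<in>?A. (e' d - e d) * binom_prod d t) = 0" for t
  proof -
    have "(\<Sum>d\<in>?A. e d * binom_prod d t) = mpoly_eval id t P"
      unfolding assms(2) by (rule binom_sum_superset[symmetric]) (use fin in auto)
    moreover have "(\<Sum>d\<in>?A. e' d * binom_prod d t) = (\<Sum>d | e' d \<noteq> 0. e' d * binom_prod d t)"
      by (rule binom_sum_superset[symmetric]) (use fin in auto)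
    moreover have "\<dots> = mpoly_eval id t P" using e' by (simp add: binom_prod_def)
    ultimately show ?thesis by (simp add: left_diff_distrib sum_subtractf)
  qed
  hence "e' d - e d = 0" if "d \<in> ?A" for d
    using binom_coeffs_unique[OF fin, of "\<lambda>d. e' d - e d" d] that by blast
  thus "e' = e" by (intro ext) force
qed

text \<open>
  Two polynomials that agree where all arguments are at least \<open>N\<close> agree on the points \<open>s ^ w v\<close> with
  large \<open>s\<close> and positive weights, which determine a polynomial.
\<close>

lemma hilbert_polynomial_eqI:
  fixes P :: "('p::finite, rat) mpoly"
  assumes "\<And>t. (\<And>i. N \<le> t i) \<Longrightarrow> mpoly_eval id (\<lambda>i. of_nat (t i)) P = of_nat (hilbert_function m Y t)"
  shows "hilbert_polynomial m Y = P"
  unfolding hilbert_polynomial_def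
proof (rule the_equality)
  show "\<exists>N. \<forall>t. (\<forall>i. N \<le> t i) \<longrightarrow> mpoly_eval id (\<lambda>i. of_nat (t i)) P = of_nat (hilbert_function m Y t)"
    using assms by blast
  fix P' :: "('p, rat) mpoly"
  assume "\<exists>N. \<forall>t. (\<forall>i. N \<le> t i) \<longrightarrow> mpoly_eval id (\<lambda>i. of_nat (t i)) P' = of_nat (hilbert_function m Y t)"
  then obtain N' where N': "\<And>t. (\<And>i. N' \<le> t i) \<Longrightarrow> mpoly_eval id (\<lambda>i. of_nat (t i)) P' = of_nat (hilbert_function m Y t)"
    by blast
  have diff: "mpoly_eval id x (P' - P) = mpoly_eval id x P' - mpoly_eval id x P" for x
    using mpoly_eval_add[of id x "P' - P" P] by simp
  let ?S = "of_nat ` {N + N' + 1..} :: rat set"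
  have "P' - P = 0"
  proof (rule mpoly_zero_if_vanishing[of ?S id])
    show "infinite ?S" using infinite_Ici by (subst finite_image_iff) (auto simp: inj_on_def)
    fix s :: rat and w :: "'p \<Rightarrow> nat" assume s: "s \<in> ?S" and w: "\<And>v. 1 \<le> w v"
    then obtain n where n: "s = of_nat n" "N + N' + 1 \<le> n" by auto
    have "n \<le> n ^ w v" for v using n(2) w[of v] by (intro self_le_power) auto
    hence le: "N \<le> n ^ w v" "N' \<le> n ^ w v" for v using n(2) by (meson add_leE order_trans)+
    have "(\<lambda>v. s ^ w v) = (\<lambda>v. of_nat (n ^ w v))" by (simp add: n)
    thus "mpoly_eval id (\<lambda>v. s ^ w v) (P' - P) = 0"
      using assms[of "\<lambda>v. n ^ w v"] N'[of "\<lambda>v. n ^ w v"] le by (simp add: diff del: of_nat_power)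
  qed simp
  thus "P' = P" by simp
qed

context toric
begin

theorem multidegree_expansion:
  "\<exists>N. finite {d. multidegree m (image_closure m f) d \<noteq> 0} \<and>
    (\<forall>t. (\<forall>i. N \<le> t i) \<longrightarrow> (of_nat (card (sumset t)) :: rat) =
      (\<Sum>d | multidegree m (image_closure m f) d \<noteq> 0.
        multidegree m (image_closure m f) d * binom_prod d (\<lambda>i. of_nat (t i))))"
proof -
  obtain g N where g: "poly_fun g" "\<And>t. (\<forall>i. N \<le> t i) \<Longrightarrow> of_nat (card (sumset t)) = g (\<lambda>i. of_nat (t i))"
    using card_sumset_eventually_poly unfolding eventually_poly_def by blast
  obtain P :: "('p, rat) mpoly" where P: "\<And>x. mpoly_eval id x P = g x" using g(1) unfolding poly_fun_def by blast
  have HP: "hilbert_polynomial m (image_closure m f) = P"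
    by (rule hilbert_polynomial_eqI[of N]) (simp add: P hilbert_function_eq g(2))
  obtain e where e: "finite {d. e d \<noteq> 0}" "\<And>t. mpoly_eval id t P = (\<Sum>d | e d \<noteq> 0. e d * binom_prod d t)"
    using binom_span_coeffs[OF binom_span_eval[of P]] by blast
  have "multidegree m (image_closure m f) = e"
    by (rule ext) (simp add: multidegree_def HP binomial_coeffs_eqI[OF e])
  thus ?thesis using e(1) g(2) unfolding P[symmetric] e(2) by (intro exI[of _ N]) simp
qed

end

section \<open>Leading terms\<close>

lemma gbinomial_tendsto:
  fixes t c :: real
  shows "(\<lambda>n. ((real n * t + c + real d) gchoose d) / real n ^ d) \<longlonglongrightarrow> t ^ d / fact d"
proof -
  have "(\<lambda>n. (real n * t + (c + real d - real k)) / real n) \<longlonglongrightarrow> t" for k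
  proof -
    have "(\<lambda>n. t + (c + real d - real k) / real n) \<longlonglongrightarrow> t + 0"
      by (intro tendsto_add tendsto_const lim_const_over_n)
    moreover have "\<forall>\<^sub>F n in sequentially. t + (c + real d - real k) / real n = (real n * t + (c + real d - real k)) / real n"
      using eventually_gt_at_top[of 0] by eventually_elim (simp add: field_simps)
    ultimately show ?thesis using Lim_transform_eventually by fastforce
  qed
  hence "(\<lambda>n. (\<Prod>k = 0..<d. (real n * t + (c + real d - real k)) / real n) / fact d) \<longlonglongrightarrow> (\<Prod>k = 0..<d. t) / fact d"
    by (intro tendsto_divide tendsto_prod tendsto_const) auto
  moreover have "(\<Prod>k = 0..<d. (real n * t + (c + real d - real k)) / real n) / fact d = ((real n * t + c + real d) gchoose d) / real n ^ d" for n
    by (simp add: gbinomial_prod_rev prod_dividef algebra_simps)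
  ultimately show ?thesis by simp
qed

lemma binom_prod_tendsto:
  fixes t c :: "'p::finite \<Rightarrow> real"
  shows "(\<lambda>n. binom_prod d (\<lambda>i. real n * t i + c i) / real n ^ (\<Sum>i\<in>UNIV. d i)) \<longlonglongrightarrow> (\<Prod>i\<in>UNIV. t i ^ d i / fact (d i))"
proof -
  have "(\<lambda>n. \<Prod>i\<in>UNIV. ((real n * t i + c i + real (d i)) gchoose d i) / real n ^ d i) \<longlonglongrightarrow> (\<Prod>i\<in>UNIV. t i ^ d i / fact (d i))"
    by (intro tendsto_prod gbinomial_tendsto)
  thus ?thesis by (simp add: binom_prod_def prod_dividef power_sum)
qed

lemma inverse_power_tendsto: "k > 0 \<Longrightarrow> (\<lambda>n. 1 / real n ^ k) \<longlonglongrightarrow> 0"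
proof -
  assume "k > 0"
  have "(\<lambda>n. (1 / real n) ^ k) \<longlonglongrightarrow> 0 ^ k" by (intro tendsto_power lim_1_over_n)
  thus ?thesis using \<open>k > 0\<close> by (simp add: power_divide power_0_left)
qed

lemma binom_prod_tendsto_weight:
  fixes t c :: "'p::finite \<Rightarrow> real"
  assumes "(\<Sum>i\<in>UNIV. d i) \<le> R"
  shows "(\<lambda>n. binom_prod d (\<lambda>i. real n * t i + c i) / real n ^ R) \<longlonglongrightarrow>
    (if (\<Sum>i\<in>UNIV. d i) = R then (\<Prod>i\<in>UNIV. t i ^ d i / fact (d i)) else 0)"
proof (cases "(\<Sum>i\<in>UNIV. d i) = R")
  case True
  thus ?thesis using binom_prod_tendsto[of d t c] by simp
next
  case False
  let ?s = "\<Sum>i\<in>UNIV. d i"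
  have "(\<lambda>n. binom_prod d (\<lambda>i. real n * t i + c i) / real n ^ ?s * (1 / real n ^ (R - ?s))) \<longlonglongrightarrow>
      (\<Prod>i\<in>UNIV. t i ^ d i / fact (d i)) * 0"
    by (intro tendsto_mult binom_prod_tendsto inverse_power_tendsto) (use assms False in auto)
  moreover have "real n ^ ?s * real n ^ (R - ?s) = real n ^ R" for n
    using assms by (simp add: power_add[symmetric])
  ultimately show ?thesis using False by simp
qed

lemma monomials_independent_real:
  fixes b :: "('p::finite \<Rightarrow> nat) \<Rightarrow> real"
  assumes "finite E" "\<And>l :: 'p \<Rightarrow> nat. (\<Sum>d\<in>E. b d * (\<Prod>i\<in>UNIV. real (l i) ^ d i)) = 0" "d \<in> E"
  shows "b d = 0"
proof (rule coefficients_zero_if_vanishing[of E "range real" b])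
  show "infinite (range real)" by (rule range_inj_infinite) (simp add: inj_on_def)
  fix s and w :: "'p \<Rightarrow> nat" assume "s \<in> range real"
  then obtain n where "s = real n" by blast
  thus "(\<Sum>e\<in>E. b e * (\<Prod>v\<in>UNIV. (s ^ w v) ^ e v)) = 0" using assms(2)[of "\<lambda>v. n ^ w v"] by simp
qed (use assms in auto)

lemma finite_sum_eq: "finite {d :: 'p::finite \<Rightarrow> nat. (\<Sum>i\<in>UNIV. d i) = r}"
proof (rule finite_subset)
  show "{d :: 'p \<Rightarrow> nat. (\<Sum>i\<in>UNIV. d i) = r} \<subseteq> PiE UNIV (\<lambda>_. {..r})"
  proof
    fix d :: "'p \<Rightarrow> nat" assume "d \<in> {d. (\<Sum>i\<in>UNIV. d i) = r}"
    hence "d i \<le> r" for i using member_le_sum[of i UNIV d] by simp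
    thus "d \<in> PiE UNIV (\<lambda>_. {..r})" by (simp add: PiE_UNIV_domain)
  qed
qed (simp add: finite_PiE)

text \<open>
  Along the ray \<open>n \<mapsto> n * t + c\<close> a binomial product of type \<open>d\<close> grows like \<open>n ^ |d|\<close> times
  \<open>\<Prod>i. t i ^ d i / fact (d i)\<close>. If the largest \<open>|d|\<close> that occurs were some \<open>R > r\<close>, then the limit in the
  assumption would force the part of degree \<open>R\<close> to vanish at all \<open>t\<close>. So no \<open>|d|\<close> exceeds \<open>r\<close>, and the
  limit is the part of degree \<open>r\<close>. The shift \<open>c\<close> keeps the arguments in the range where \<open>h\<close> is
  polynomial even if some \<open>t i\<close> are zero.
\<close>

lemma leading_form:
  fixes e :: "('p::finite \<Rightarrow> nat) \<Rightarrow> real" and h V :: "('p \<Rightarrow> nat) \<Rightarrow> real"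
  assumes fin: "finite {d. e d \<noteq> 0}"
    and h: "\<And>t. (\<And>i. N \<le> t i) \<Longrightarrow> h t = (\<Sum>d | e d \<noteq> 0. e d * binom_prod d (\<lambda>i. real (t i)))"
    and c: "\<And>i. N \<le> c i"
    and lim: "\<And>t. (\<lambda>n. h (\<lambda>i. n * t i + c i) / real n ^ r) \<longlonglongrightarrow> V t"
  shows "V t = (\<Sum>d | sum d UNIV = r. e d * (\<Prod>i\<in>UNIV. real (t i) ^ d i / fact (d i)))"
proof -
  let ?D = "{d. e d \<noteq> 0}"
  let ?T = "\<lambda>R t. \<Sum>d | sum d UNIV = R. e d * (\<Prod>i\<in>UNIV. real (t i) ^ d i / fact (d i))"
  have T: "(\<lambda>n. h (\<lambda>i. n * t i + c i) / real n ^ R) \<longlonglongrightarrow> ?T R t" if R: "\<And>d. e d \<noteq> 0 \<Longrightarrow> sum d UNIV \<le> R" for R t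
  proof -
    have "h (\<lambda>i. n * t i + c i) / real n ^ R = (\<Sum>d\<in>?D. e d * (binom_prod d (\<lambda>i. real n * real (t i) + real (c i)) / real n ^ R))" for n
      using c by (subst h) (simp_all add: sum_divide_distrib trans_le_add2)
    moreover have "(\<lambda>n. \<Sum>d\<in>?D. e d * (binom_prod d (\<lambda>i. real n * real (t i) + real (c i)) / real n ^ R)) \<longlonglongrightarrow>
       (\<Sum>d\<in>?D. e d * (if sum d UNIV = R then (\<Prod>i\<in>UNIV. real (t i) ^ d i / fact (d i)) else 0))"
      by (intro tendsto_sum tendsto_mult tendsto_const binom_prod_tendsto_weight) (use R in auto)
    moreover have "(\<Sum>d\<in>?D. e d * (if sum d UNIV = R then (\<Prod>i\<in>UNIV. real (t i) ^ d i / fact (d i)) else 0)) = ?T R t"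
    proof -
      have "(\<Sum>d\<in>?D. e d * (if sum d UNIV = R then (\<Prod>i\<in>UNIV. real (t i) ^ d i / fact (d i)) else 0)) =
         (\<Sum>d\<in>?D \<inter> {d. sum d UNIV = R}. e d * (\<Prod>i\<in>UNIV. real (t i) ^ d i / fact (d i)))"
        using fin by (simp add: if_distrib sum.If_cases cong: if_cong)
      also have "\<dots> = ?T R t" by (rule sum.mono_neutral_left) (auto simp: finite_sum_eq)
      finally show ?thesis .
    qed
    ultimately show ?thesis by simp
  qed
  define R where "R = Max (insert r ((\<lambda>d. sum d UNIV) ` ?D))"
  have finR: "finite (insert r ((\<lambda>d. sum d UNIV) ` ?D))" using fin by simp
  have R: "sum d UNIV \<le> R" if "e d \<noteq> 0" for d unfolding R_def using finR that by (intro Max_ge) auto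
  have "r \<le> R" unfolding R_def using finR by (intro Max_ge) auto
  have "R = r"
  proof (rule ccontr)
    assume "R \<noteq> r"
    with \<open>r \<le> R\<close> have "r < R" by simp
    have "?T R t = 0" for t
    proof -
      have "(\<lambda>n. h (\<lambda>i. n * t i + c i) / real n ^ r * (1 / real n ^ (R - r))) \<longlonglongrightarrow> V t * 0"
        by (intro tendsto_mult lim inverse_power_tendsto) (use \<open>r < R\<close> in simp)
      moreover have "real n ^ r * real n ^ (R - r) = real n ^ R" for n
        using \<open>r \<le> R\<close> by (simp add: power_add[symmetric])
      ultimately have "(\<lambda>n. h (\<lambda>i. n * t i + c i) / real n ^ R) \<longlonglongrightarrow> 0" by simp
      with T[of R t] R show ?thesis using LIMSEQ_unique by blast
    qed
    hence "(\<Sum>d | sum d UNIV = R. e d / (\<Prod>i\<in>UNIV. fact (d i)) * (\<Prod>i\<in>UNIV. real (t i) ^ d i)) = 0" for t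
      by (simp add: prod_dividef)
    hence "e d / (\<Prod>i\<in>UNIV. fact (d i)) = 0" if "sum d UNIV = R" for d
      using monomials_independent_real[OF finite_sum_eq, of "\<lambda>d. e d / (\<Prod>i\<in>UNIV. fact (d i))" R d] that by blast
    hence ez: "e d = 0" if "sum d UNIV = R" for d using that by fastforce
    have "R \<in> insert r ((\<lambda>d. sum d UNIV) ` ?D)" unfolding R_def using finR by (intro Max_in) auto
    with \<open>R \<noteq> r\<close> ez show False by auto
  qed
  thus ?thesis using T[of R t] R lim[of t] LIMSEQ_unique by blast
qed

text \<open>
  Monomials are linearly independent as functions of \<open>l\<close>, so any homogeneous polynomial formula for
  the volume has the mixed volumes as coefficients.
\<close>

lemma mixed_volume_eqI:
  assumes "\<And>l. volume C (minkowski_comb C K l) = (\<Sum>d | sum d UNIV = card C. M d * (\<Prod>i\<in>UNIV. real (l i) ^ d i / fact (d i)))"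
    and "sum d UNIV = card C"
  shows "mixed_volume C K d = M d"
proof -
  define M' where "M' d = (if sum d UNIV = card C then M d else 0)" for d
  have "mixed_volume C K = M'" unfolding mixed_volume_def
  proof (rule the_equality)
    have "volume C (minkowski_comb C K l) =
        (\<Sum>d | sum d UNIV = card C. 1 / (\<Prod>i\<in>UNIV. fact (d i)) * M' d * (\<Prod>i\<in>UNIV. real (l i) ^ d i))" for l
      unfolding assms(1) by (rule sum.cong) (auto simp: M'_def prod_dividef)
    thus "(\<forall>d. sum d UNIV \<noteq> card C \<longrightarrow> M' d = 0) \<and> (\<forall>l. volume C (minkowski_comb C K l) =
        (\<Sum>d | sum d UNIV = card C. 1 / (\<Prod>i\<in>UNIV. fact (d i)) * M' d * (\<Prod>i\<in>UNIV. real (l i) ^ d i)))"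
      by (simp add: M'_def)
    fix M2 assume M2: "(\<forall>d. sum d UNIV \<noteq> card C \<longrightarrow> M2 d = 0) \<and> (\<forall>l. volume C (minkowski_comb C K l) =
        (\<Sum>d | sum d UNIV = card C. 1 / (\<Prod>i\<in>UNIV. fact (d i)) * M2 d * (\<Prod>i\<in>UNIV. real (l i) ^ d i)))"
    have "(\<Sum>d | sum d UNIV = card C. (M2 d - M d) / (\<Prod>i\<in>UNIV. fact (d i)) * (\<Prod>i\<in>UNIV. real (l i) ^ d i)) = 0" for l
    proof -
      have "(\<Sum>d | sum d UNIV = card C. 1 / (\<Prod>i\<in>UNIV. fact (d i)) * M2 d * (\<Prod>i\<in>UNIV. real (l i) ^ d i)) =
          (\<Sum>d | sum d UNIV = card C. M d * (\<Prod>i\<in>UNIV. real (l i) ^ d i / fact (d i)))"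
        using M2 assms(1) by metis
      thus ?thesis by (simp add: prod_dividef diff_divide_distrib left_diff_distrib sum_subtractf)
    qed
    hence "(M2 d - M d) / (\<Prod>i\<in>UNIV. fact (d i)) = 0" if "sum d UNIV = card C" for d
      using monomials_independent_real[OF finite_sum_eq, of "\<lambda>d. (M2 d - M d) / (\<Prod>i\<in>UNIV. fact (d i))" "card C" d] that by blast
    hence "M2 d = M d" if "sum d UNIV = card C" for d using that by fastforce
    thus "M2 = M'" using M2 by (intro ext) (auto simp: M'_def)
  qed
  thus ?thesis using assms(2) by (simp add: M'_def)
qed

section \<open>Volumes in coordinate spaces\<close>

text \<open>
  The bodies live in a product of copies of the real line over an index set, not in a Euclidean
  space type; the behaviour of the product measure under translations and dilations is derived
  from that of each factor.
\<close>

abbreviation leb :: "'v set \<Rightarrow> ('v \<Rightarrow> real) measure"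
  where "leb C \<equiv> (\<Pi>\<^sub>M v\<in>C. lborel)"

definition affine_map :: "'v set \<Rightarrow> real \<Rightarrow> ('v \<Rightarrow> real) \<Rightarrow> ('v \<Rightarrow> real) \<Rightarrow> 'v \<Rightarrow> real"
  where "affine_map C c y x = (\<lambda>v\<in>C. c * x v + y v)"

lemma space_leb: "space (leb C) = extensional C"
  by (simp add: space_PiM PiE_UNIV_domain) (auto simp: PiE_def)

lemma emeasure_lborel_affine_vimage:
  fixes c y :: real
  assumes c: "c > 0" and A: "A \<in> sets lborel"
  shows "emeasure lborel A = ennreal (1 / c) * emeasure lborel ((\<lambda>x. (x - y) / c) -` A)"
proof -
  have eq: "(\<lambda>x. - y / c + 1 / c * x) = (\<lambda>x. (x - y) / c)" by (simp add: diff_divide_distrib)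
  have "emeasure lborel A = emeasure (density (distr lborel borel (\<lambda>x. - y / c + 1 / c * x)) (\<lambda>_. ennreal \<bar>1 / c\<bar>)) A"
    using lborel_real_affine[of "1 / c" "- y / c"] c by simp
  also have "\<dots> = ennreal (1 / c) * emeasure (distr lborel borel (\<lambda>x. (x - y) / c)) A"
    unfolding eq using A c by (subst emeasure_density_const) auto
  also have "emeasure (distr lborel borel (\<lambda>x. (x - y) / c)) A = emeasure lborel ((\<lambda>x. (x - y) / c) -` A)"
    using A by (subst emeasure_distr) auto
  finally show ?thesis .
qed

lemma affine_vimage:
  assumes "c > 0" "A \<subseteq> extensional C"
  shows "affine_map C c y ` A = (\<lambda>x. \<lambda>v\<in>C. (x v - y v) / c) -` A \<inter> extensional C"
proof (intro equalityI subsetI)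
  fix x assume "x \<in> affine_map C c y ` A"
  then obtain z where z: "z \<in> A" "x = affine_map C c y z" by blast
  have "(\<lambda>v\<in>C. (x v - y v) / c) = z"
    using z assms by (auto simp: affine_map_def extensional_def fun_eq_iff restrict_def)
  thus "x \<in> (\<lambda>x. \<lambda>v\<in>C. (x v - y v) / c) -` A \<inter> extensional C" using z by (auto simp: affine_map_def)
next
  fix x assume x: "x \<in> (\<lambda>x. \<lambda>v\<in>C. (x v - y v) / c) -` A \<inter> extensional C"
  have "x = affine_map C c y (\<lambda>v\<in>C. (x v - y v) / c)"
    using x assms by (auto simp: affine_map_def extensional_def fun_eq_iff restrict_def)
  thus "x \<in> affine_map C c y ` A" using x by blast
qed

lemma volume_affine:
  assumes C: "finite C" and c: "c > 0" and A: "A \<in> sets (leb C)"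
  shows "affine_map C c y ` A \<in> sets (leb C)"
    and "volume C (affine_map C c y ` A) = c ^ card C * volume C A"
    and "A \<in> fmeasurable (leb C) \<Longrightarrow> affine_map C c y ` A \<in> fmeasurable (leb C)"
proof -
  interpret product_sigma_finite "\<lambda>_. lborel :: real measure" by standard
  let ?T = "\<lambda>x. \<lambda>v\<in>C. (x v - y v) / c"
  have T [measurable]: "?T \<in> measurable (leb C) (leb C)"
    by (intro measurable_restrict) auto
  have AC: "A \<subseteq> extensional C" using sets.sets_into_space[OF A] by (simp add: space_leb)
  have im: "affine_map C c y ` A = ?T -` A \<inter> space (leb C)"
    using affine_vimage[OF c AC] by (simp add: space_leb)
  show "affine_map C c y ` A \<in> sets (leb C)" unfolding im by (rule measurable_sets[OF T A])
  let ?P = "scale_measure (ennreal (1 / c ^ card C)) (distr (leb C) (leb C) ?T)"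
  have "?P = leb C"
  proof (rule PiM_eqI[OF C])
    fix S assume S: "\<And>i. i \<in> C \<Longrightarrow> S i \<in> sets (lborel :: real measure)"
    have "?T -` (Pi\<^sub>E C S) \<inter> space (leb C) = Pi\<^sub>E C (\<lambda>v. (\<lambda>x. (x - y v) / c) -` S v)"
      by (auto simp: space_leb PiE_iff extensional_def)
    moreover have "(\<lambda>x. (x - y v) / c) -` S v \<in> sets lborel" if "v \<in> C" for v
    proof -
      have "(\<lambda>x. (x - y v) / c) \<in> measurable lborel lborel" by measurable
      from measurable_sets[OF this S[OF that]] show ?thesis by simp
    qed
    ultimately have "emeasure ?P (Pi\<^sub>E C S) = ennreal (1 / c ^ card C) * (\<Prod>v\<in>C. emeasure lborel ((\<lambda>x. (x - y v) / c) -` S v))"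
      using C S by (subst emeasure_scale_measure, subst emeasure_distr) (auto intro!: sets_PiM_I_finite simp: emeasure_PiM)
    also have "\<dots> = (\<Prod>v\<in>C. emeasure lborel (S v))"
    proof -
      have k: "ennreal (1 / c ^ card C) = (\<Prod>v\<in>C. ennreal (1 / c))"
        using c by (simp add: ennreal_power power_divide)
      show ?thesis unfolding k prod.distrib[symmetric]
        using emeasure_lborel_affine_vimage[OF c] S by (intro prod.cong) auto
    qed
    finally show "emeasure ?P (Pi\<^sub>E C S) = (\<Prod>v\<in>C. emeasure lborel (S v))" .
  qed simp
  hence "emeasure (leb C) A = emeasure ?P A" by (rule arg_cong[where f = "\<lambda>M. emeasure M A", OF sym])
  also have "\<dots> = ennreal (1 / c ^ card C) * emeasure (distr (leb C) (leb C) ?T) A"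
    by (rule emeasure_scale_measure)
  also have "emeasure (distr (leb C) (leb C) ?T) A = emeasure (leb C) (affine_map C c y ` A)"
    unfolding im by (rule emeasure_distr[OF T A])
  finally have em: "emeasure (leb C) A = ennreal (1 / c ^ card C) * emeasure (leb C) (affine_map C c y ` A)" .
  show "affine_map C c y ` A \<in> fmeasurable (leb C)" if "A \<in> fmeasurable (leb C)"
  proof (rule fmeasurableI)
    show "affine_map C c y ` A \<in> sets (leb C)" unfolding im by (rule measurable_sets[OF T A])
    have "ennreal (1 / c ^ card C) * emeasure (leb C) (affine_map C c y ` A) < \<infinity>"
      using that em by (simp add: fmeasurable_def)
    thus "emeasure (leb C) (affine_map C c y ` A) < \<infinity>"
      using c by (auto simp: ennreal_mult_less_top)
  qed
  from em have "volume C A = (1 / c ^ card C) * volume C (affine_map C c y ` A)"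
    using c by (simp add: volume_def measure_def enn2real_mult)
  thus "volume C (affine_map C c y ` A) = c ^ card C * volume C A" using c by simp
qed


text \<open>
  A copy of the extensional functions inside a Euclidean space, where compactness and distances are available.
\<close>

definition embed :: "'v::finite set \<Rightarrow> ('v \<Rightarrow> real) \<Rightarrow> real ^ 'v"
  where "embed C x = (\<Sum>v\<in>C. x v *\<^sub>R axis v 1)"

lemma embed_nth: "embed C x $ w = (if w \<in> C then x w else 0)"
proof -
  have "embed C x $ w = (\<Sum>v\<in>C. if v = w then x v else 0)"
    unfolding embed_def sum_component by (rule sum.cong) (auto simp: axis_def)
  thus ?thesis by simp
qed

lemma embed_measurable [measurable]: "embed C \<in> borel_measurable (leb C)"
  for C :: "'v::finite set"
proof -
  have "(\<lambda>x. \<Sum>v\<in>C. x v *\<^sub>R (axis v 1 :: real ^ 'v)) \<in> borel_measurable (leb C)"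
    by (intro borel_measurable_sum borel_measurable_scaleR) auto
  thus ?thesis unfolding embed_def .
qed

lemma embed_vimage_closed:
  assumes "closed K"
  shows "{x \<in> extensional C. embed C x \<in> K} \<in> sets (leb C)"
proof -
  have "{x \<in> extensional C. embed C x \<in> K} = embed C -` K \<inter> space (leb C)" by (auto simp: space_leb)
  thus ?thesis using measurable_sets[OF embed_measurable] borel_closed[OF assms] by metis
qed

abbreviation cubebox :: "'v set \<Rightarrow> real \<Rightarrow> ('v \<Rightarrow> real) set"
  where "cubebox C b \<equiv> PiE C (\<lambda>_. {- b..b})"

lemma fmeasurable_PiE:
  fixes A :: "'v \<Rightarrow> real set"
  assumes "finite C" "\<And>v. v \<in> C \<Longrightarrow> A v \<in> fmeasurable lborel"
  shows "PiE C A \<in> fmeasurable (leb C)" "measure (leb C) (PiE C A) = (\<Prod>v\<in>C. measure lborel (A v))"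
proof -
  interpret product_sigma_finite "\<lambda>_. lborel :: real measure" by standard
  have s: "A v \<in> sets lborel" if "v \<in> C" for v using assms(2)[OF that] by auto
  have e: "emeasure (leb C) (PiE C A) = (\<Prod>v\<in>C. emeasure lborel (A v))"
    using assms(1) s by (rule emeasure_PiM)
  also have "\<dots> = (\<Prod>v\<in>C. ennreal (measure lborel (A v)))"
    using assms(2) by (intro prod.cong) (auto simp: emeasure_eq_measure2)
  also have "\<dots> = ennreal (\<Prod>v\<in>C. measure lborel (A v))" by (rule prod_ennreal) simp
  finally have e: "emeasure (leb C) (PiE C A) = ennreal (\<Prod>v\<in>C. measure lborel (A v))" .
  show "PiE C A \<in> fmeasurable (leb C)"
    using assms(1) s e by (intro fmeasurableI sets_PiM_I_finite) auto
  show "measure (leb C) (PiE C A) = (\<Prod>v\<in>C. measure lborel (A v))"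
    unfolding measure_def e by (simp add: prod_nonneg measure_def[symmetric])
qed

lemma fmeasurable_bounded:
  assumes "finite C" "A \<in> sets (leb C)" "A \<subseteq> cubebox C b"
  shows "A \<in> fmeasurable (leb C)"
proof (rule fmeasurableI2[OF _ assms(3,2)])
  have "{- b..b} \<in> fmeasurable lborel" using fmeasurable_cbox[of "- b" b] by simp
  thus "cubebox C b \<in> fmeasurable (leb C)" using assms(1) by (intro fmeasurable_PiE(1))
qed

definition unit_cube :: "'v set \<Rightarrow> ('v \<Rightarrow> int) \<Rightarrow> ('v \<Rightarrow> real) set"
  where "unit_cube C y = PiE C (\<lambda>v. {real_of_int (y v)..<real_of_int (y v) + 1})"

lemma unit_cube_measure:
  assumes "finite C"
  shows "unit_cube C y \<in> fmeasurable (leb C)" "measure (leb C) (unit_cube C y) = 1"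
  unfolding unit_cube_def using assms
  by (subst fmeasurable_PiE | simp add: fmeasurable_def)+

lemma unit_cubes_disjoint:
  assumes "v \<in> C" "y v \<noteq> y' v"
  shows "disjnt (unit_cube C y) (unit_cube C y')"
proof -
  have "False" if x: "x \<in> unit_cube C y" "x \<in> unit_cube C y'" for x
  proof -
    have "x v \<in> {real_of_int (y v)..<real_of_int (y v) + 1}" "x v \<in> {real_of_int (y' v)..<real_of_int (y' v) + 1}"
      using x assms(1) unfolding unit_cube_def by auto
    hence "floor (x v) = y v" "floor (x v) = y' v" by (simp_all add: floor_eq_iff)
    thus False using assms(2) by simp
  qed
  thus ?thesis unfolding disjnt_def by blast
qed

text \<open>
  Half-open unit cubes at distinct integer points are disjoint. This and the next lemma turn
  inclusions between sets and unions of cubes into estimates between volumes and numbers of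
  lattice points.
\<close>

lemma card_cubes_le_volume:
  assumes C: "finite C" and Y: "finite Y" "\<And>y y'. y \<in> Y \<Longrightarrow> y' \<in> Y \<Longrightarrow> y \<noteq> y' \<Longrightarrow> \<exists>v\<in>C. y v \<noteq> y' v"
    and A: "A \<in> fmeasurable (leb C)" "\<And>y. y \<in> Y \<Longrightarrow> unit_cube C y \<subseteq> A"
  shows "real (card Y) \<le> volume C A"
proof -
  have "real (card Y) = (\<Sum>y\<in>Y. measure (leb C) (unit_cube C y))" using C by (simp add: unit_cube_measure)
  also have "\<dots> = measure (leb C) (\<Union>y\<in>Y. unit_cube C y)"
  proof (rule measure_UNION'[symmetric, OF Y(1)])
    show "pairwise (\<lambda>i j. disjnt (unit_cube C i) (unit_cube C j)) Y"
      unfolding pairwise_def using unit_cubes_disjoint Y(2) by metis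
  qed (rule unit_cube_measure(1)[OF C])
  also have "\<dots> \<le> measure (leb C) A"
    using A Y(1) unit_cube_measure(1)[OF C] by (intro measure_mono_fmeasurable) auto
  finally show ?thesis by (simp add: volume_def)
qed

lemma volume_le_card_cubes:
  assumes C: "finite C" and Y: "finite Y" and A: "A \<in> sets (leb C)" "A \<subseteq> (\<Union>y\<in>Y. unit_cube C y)"
  shows "volume C A \<le> real (card Y)"
proof -
  have "measure (leb C) A \<le> measure (leb C) (\<Union>y\<in>Y. unit_cube C y)"
    using A Y unit_cube_measure(1)[OF C] by (intro measure_mono_fmeasurable fmeasurable.finite_UN) auto
  also have "\<dots> \<le> (\<Sum>y\<in>Y. measure (leb C) (unit_cube C y))"
    using unit_cube_measure(1)[OF C] Y by (intro measure_UNION_le) auto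
  also have "\<dots> = real (card Y)" using C by (simp add: unit_cube_measure)
  finally show ?thesis by (simp add: volume_def)
qed

text \<open>
  Infinitely many translates of a subset of a hyperplane along a transversal direction are
  disjoint and stay in a bounded region, so the set has volume zero.
\<close>

lemma volume_hyperplane:
  assumes C: "finite C" and A: "A \<in> sets (leb C)" "A \<subseteq> cubebox C b"
    and v: "v \<in> C" "\<beta> v \<noteq> 0" and plane: "\<And>x. x \<in> A \<Longrightarrow> (\<Sum>w\<in>C. x w * \<beta> w) = \<kappa>"
  shows "volume C A = 0"
proof -
  let ?y = "\<lambda>k w. if w = v then 1 / real (Suc k) else 0"
  let ?F = "\<lambda>k. affine_map C 1 (?y k) ` A"
  have F: "?F k \<in> sets (leb C)" "measure (leb C) (?F k) = volume C A" for k
    using volume_affine[OF C _ A(1), of 1 "?y k"] by (auto simp: volume_def)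
  have sub: "?F k \<subseteq> cubebox C (b + 1)" for k
  proof
    fix x assume "x \<in> ?F k"
    then obtain z where z: "z \<in> A" "x = affine_map C 1 (?y k) z" by blast
    show "x \<in> cubebox C (b + 1)"
    proof (rule PiE_I)
      fix w assume w: "w \<in> C"
      have "- b \<le> z w" "z w \<le> b" using A(2) z(1) w by (auto simp: PiE_iff)
      moreover have "x w = z w + ?y k w" using w by (simp add: z(2) affine_map_def)
      moreover have "0 \<le> ?y k w" "?y k w \<le> 1" by auto
      ultimately show "x w \<in> {- (b + 1)..b + 1}" unfolding atLeastAtMost_iff by linarith
    qed (simp add: z(2) affine_map_def)
  qed
  have fm: "?F k \<in> fmeasurable (leb C)" for k by (rule fmeasurable_bounded[OF C F(1) sub])
  have plane': "(\<Sum>w\<in>C. x w * \<beta> w) = \<kappa> + \<beta> v / real (Suc k)" if "x \<in> ?F k" for x k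
  proof -
    obtain z where z: "z \<in> A" "x = affine_map C 1 (?y k) z" using \<open>x \<in> ?F k\<close> by blast
    have "(\<Sum>w\<in>C. x w * \<beta> w) = (\<Sum>w\<in>C. z w * \<beta> w + (if w = v then \<beta> v / real (Suc k) else 0))"
      unfolding z(2) affine_map_def by (rule sum.cong) (auto simp: field_simps)
    also have "\<dots> = \<kappa> + \<beta> v / real (Suc k)" using C v(1) plane[OF z(1)] by (simp add: sum.distrib)
    finally show ?thesis .
  qed
  have disj: "disjnt (?F k) (?F l)" if "k \<noteq> l" for k l
  proof -
    have "\<beta> v / real (Suc k) \<noteq> \<beta> v / real (Suc l)" using v(2) that by (simp add: field_simps)
    thus ?thesis unfolding disjnt_def using plane'[of _ k] plane'[of _ l] by force
  qed
  let ?b = "measure (leb C) (cubebox C (b + 1))"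
  have bound: "real n * volume C A \<le> ?b" for n
  proof -
    have "real n * volume C A = (\<Sum>k<n. measure (leb C) (?F k))" by (simp add: F(2))
    also have "\<dots> = measure (leb C) (\<Union>k<n. ?F k)"
      by (rule measure_UNION'[symmetric]) (use fm disj in \<open>auto simp: pairwise_def\<close>)
    also have "\<dots> \<le> ?b"
    proof (rule measure_mono_fmeasurable)
      show "(\<Union>k<n. ?F k) \<subseteq> cubebox C (b + 1)" by (rule UN_least) (rule sub)
      show "(\<Union>k<n. ?F k) \<in> sets (leb C)" by (rule sets.finite_UN) (use F(1) in auto)
      have "{- (b + 1)..b + 1} \<in> fmeasurable lborel" using fmeasurable_cbox[of "- (b + 1)" "b + 1"] by simp
      thus "cubebox C (b + 1) \<in> fmeasurable (leb C)" using C by (intro fmeasurable_PiE(1))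
    qed
    finally show ?thesis .
  qed
  have nn: "0 \<le> volume C A" by (simp add: volume_def)
  show ?thesis
  proof (rule ccontr)
    assume "volume C A \<noteq> 0"
    with nn have pos: "volume C A > 0" by simp
    obtain n where "?b / volume C A < real n" using reals_Archimedean2 by blast
    thus False using bound[of n] pos by (simp add: field_simps)
  qed
qed

section \<open>The polytopes as images of products of simplices\<close>

context monomial_map
begin

lemma comb_scale: "comb (\<lambda>i j. c * z i j) = (\<lambda>v. c * comb z v)"
  by (rule ext) (simp add: comb_def sum_distrib_left mult.assoc)

lemma csum_scale: "csum (\<lambda>i j. c i * z i j) = (\<lambda>i. c i * csum z i)"
  by (rule ext) (simp add: csum_def sum_distrib_left)

lemma comb_sum: "comb (\<lambda>i j. \<Sum>s\<in>S. z s i j) = (\<lambda>v. \<Sum>s\<in>S. comb (z s) v)"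
  by (induction S rule: infinite_finite_induct) (simp_all add: comb_add, simp_all add: comb_def)

lemma csum_sum: "csum (\<lambda>i j. \<Sum>s\<in>S. z s i j) = (\<lambda>i. \<Sum>s\<in>S. csum (z s) i)"
  by (induction S rule: infinite_finite_induct) (simp_all add: csum_add, simp_all add: csum_def)

lemma comb_of_int: "comb (\<lambda>i j. real_of_int (z i j)) v = real_of_int (comb z v)"
  by (simp add: comb_def)

lemma csum_of_int: "csum (\<lambda>i j. real_of_int (z i j)) i = real_of_int (csum z i)"
  by (simp add: csum_def)

lemma comb_of_nat: "comb (\<lambda>i j. of_nat (z i j) :: 'r::comm_ring_1) v = of_nat (comb z v)"
  by (simp add: comb_def)

lemma csum_of_nat: "csum (\<lambda>i j. of_nat (z i j) :: 'r::comm_ring_1) i = of_nat (csum z i)"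
  by (simp add: csum_def)

lemma comb_diff: "comb (\<lambda>i j. z i j - z' i j :: 'r::comm_ring_1) = (\<lambda>v. comb z v - comb z' v)"
  by (rule ext) (simp add: comb_def left_diff_distrib sum_subtractf)

lemma csum_diff: "csum (\<lambda>i j. z i j - z' i j :: 'r::comm_ring_1) = (\<lambda>i. csum z i - csum z' i)"
  by (rule ext) (simp add: csum_def sum_subtractf)

end

locale graded_map = monomial_map m a
  for m :: "'p::finite \<Rightarrow> nat" and a :: "'p \<Rightarrow> nat \<Rightarrow> 'v::finite \<Rightarrow> nat" +
  fixes \<delta> :: "'p \<Rightarrow> nat" and x0 :: 'v
  assumes degree_sum: "\<And>i j. j \<le> m i \<Longrightarrow> (\<Sum>v\<in>UNIV. a i j v) = \<delta> i"
begin

abbreviation C :: "'v set" where "C \<equiv> - {x0}"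

lemma comb_total: "(\<Sum>v\<in>UNIV. comb z v) = (\<Sum>i\<in>UNIV. csum z i * of_nat (\<delta> i))"
proof -
  have "(\<Sum>v\<in>UNIV. comb z v) = (\<Sum>i\<in>UNIV. \<Sum>j\<le>m i. \<Sum>v\<in>UNIV. z i j * of_nat (a i j v))"
    unfolding comb_def by (subst sum.swap) (rule sum.cong[OF refl], rule sum.swap)
  also have "\<dots> = (\<Sum>i\<in>UNIV. \<Sum>j\<le>m i. z i j * of_nat (\<delta> i))"
    by (intro sum.cong refl) (simp add: sum_distrib_left[symmetric] degree_sum[symmetric])
  finally show ?thesis by (simp add: csum_def sum_distrib_right)
qed

text \<open>
  The Minkowski combination with weights \<open>l\<close> of the projected Newton polytopes. The weights may be
  arbitrary reals; taking all coefficient families of multidegree \<open>l\<close> instead of weighted sums of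
  convex combinations avoids a case distinction for \<open>l i = 0\<close>.
\<close>

definition body :: "('p \<Rightarrow> real) \<Rightarrow> ('v \<Rightarrow> real) set"
  where "body l = {restrict (comb \<mu>) C | \<mu>. (\<forall>i j. j \<le> m i \<longrightarrow> 0 \<le> \<mu> i j) \<and> csum \<mu> = l}"

lemma bodyI: "(\<And>i j. j \<le> m i \<Longrightarrow> 0 \<le> \<mu> i j) \<Longrightarrow> csum \<mu> = l \<Longrightarrow> x = restrict (comb \<mu>) C \<Longrightarrow> x \<in> body l"
  unfolding body_def by blast

lemma body_add:
  assumes "x \<in> body l" "y \<in> body l'"
  shows "(\<lambda>v\<in>C. x v + y v) \<in> body (\<lambda>i. l i + l' i)"
proof -
  obtain \<mu> where \<mu>: "\<forall>i j. j \<le> m i \<longrightarrow> 0 \<le> \<mu> i j" "csum \<mu> = l" "x = restrict (comb \<mu>) C"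
    using assms(1) unfolding body_def by blast
  obtain \<nu> where \<nu>: "\<forall>i j. j \<le> m i \<longrightarrow> 0 \<le> \<nu> i j" "csum \<nu> = l'" "y = restrict (comb \<nu>) C"
    using assms(2) unfolding body_def by blast
  show ?thesis
  proof (rule bodyI[where \<mu> = "\<lambda>i j. \<mu> i j + \<nu> i j"])
    show "csum (\<lambda>i j. \<mu> i j + \<nu> i j) = (\<lambda>i. l i + l' i)" by (simp add: csum_add \<mu> \<nu>)
    show "(\<lambda>v\<in>C. x v + y v) = restrict (comb (\<lambda>i j. \<mu> i j + \<nu> i j)) C"
      unfolding comb_add \<mu>(3) \<nu>(3) by (rule ext) simp
  qed (use \<mu> \<nu> in auto)
qed

text \<open>
  Each coefficient is distributed in the ratio of \<open>l i\<close> to \<open>l' i\<close>.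
\<close>

lemma body_split:
  assumes "x \<in> body (\<lambda>i. l i + l' i)" "\<And>i. 0 \<le> l i" "\<And>i. 0 \<le> l' i"
  obtains y y' where "y \<in> body l" "y' \<in> body l'" "x = (\<lambda>v\<in>C. y v + y' v)"
proof -
  obtain \<mu> where \<mu>: "\<forall>i j. j \<le> m i \<longrightarrow> 0 \<le> \<mu> i j" "csum \<mu> = (\<lambda>i. l i + l' i)" "x = restrict (comb \<mu>) C"
    using assms(1) unfolding body_def by blast
  \<comment> \<open>If \<open>l i = l' i = 0\<close>, then \<open>\<mu> i j = 0\<close> for all \<open>j \<le> m i\<close> and division by zero does no harm.\<close>
  let ?\<theta> = "\<lambda>i. l i / (l i + l' i)"
  have \<theta>: "0 \<le> ?\<theta> i" "?\<theta> i \<le> 1" "0 \<le> 1 - ?\<theta> i" for i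
    using assms(2,3)[of i] by (auto simp: divide_le_eq)
  have c1: "csum (\<lambda>i j. ?\<theta> i * \<mu> i j) = l"
  proof
    fix i
    show "csum (\<lambda>i j. ?\<theta> i * \<mu> i j) i = l i"
      using assms(2,3)[of i] by (cases "l i + l' i = 0") (simp_all only: csum_scale \<mu>(2), auto)
  qed
  have c2: "csum (\<lambda>i j. (1 - ?\<theta> i) * \<mu> i j) = l'"
  proof
    fix i
    have "csum (\<lambda>i j. (1 - ?\<theta> i) * \<mu> i j) i = (l i + l' i) - ?\<theta> i * (l i + l' i)"
      unfolding csum_scale \<mu>(2) by (simp add: left_diff_distrib)
    also have "?\<theta> i * (l i + l' i) = l i"
      using assms(2,3)[of i] by (cases "l i + l' i = 0") auto
    finally show "csum (\<lambda>i j. (1 - ?\<theta> i) * \<mu> i j) i = l' i" by simp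
  qed
  have sum: "comb \<mu> = (\<lambda>v. comb (\<lambda>i j. ?\<theta> i * \<mu> i j) v + comb (\<lambda>i j. (1 - ?\<theta> i) * \<mu> i j) v)"
    unfolding comb_add[symmetric] by (simp add: left_diff_distrib)
  show ?thesis
  proof (rule that)
    show "restrict (comb (\<lambda>i j. ?\<theta> i * \<mu> i j)) C \<in> body l"
      by (rule bodyI[OF _ c1 refl], rule mult_nonneg_nonneg[OF \<theta>(1)], use \<mu>(1) in blast)
    show "restrict (comb (\<lambda>i j. (1 - ?\<theta> i) * \<mu> i j)) C \<in> body l'"
      by (rule bodyI[OF _ c2 refl], rule mult_nonneg_nonneg[OF \<theta>(3)], use \<mu>(1) in blast)
    show "x = (\<lambda>v\<in>C. restrict (comb (\<lambda>i j. ?\<theta> i * \<mu> i j)) C v + restrict (comb (\<lambda>i j. (1 - ?\<theta> i) * \<mu> i j)) C v)"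
      unfolding \<mu>(3) by (subst sum) (rule ext, simp)
  qed
qed

lemma body_scale:
  assumes "x \<in> body l" "0 \<le> c"
  shows "(\<lambda>v\<in>C. c * x v) \<in> body (\<lambda>i. c * l i)"
proof -
  obtain \<mu> where \<mu>: "\<forall>i j. j \<le> m i \<longrightarrow> 0 \<le> \<mu> i j" "csum \<mu> = l" "x = restrict (comb \<mu>) C"
    using assms(1) unfolding body_def by blast
  show ?thesis
  proof (rule bodyI[where \<mu> = "\<lambda>i j. c * \<mu> i j"])
    show "(\<lambda>v\<in>C. c * x v) = restrict (comb (\<lambda>i j. c * \<mu> i j)) C"
      unfolding comb_scale \<mu>(3) by (rule ext) simp
  qed (use \<mu> assms csum_scale[of "\<lambda>_. c" \<mu>] in auto)
qed

lemma body_nonempty: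
  assumes "\<And>i. 0 \<le> l i"
  obtains x where "x \<in> body l"
proof (rule that)
  let ?\<mu> = "\<lambda>i j. if j = 0 then l i else 0"
  have "csum ?\<mu> = l" by (rule ext) (simp add: csum_def)
  thus "restrict (comb ?\<mu>) C \<in> body l" by (intro bodyI[where \<mu> = ?\<mu>]) (use assms in auto)
qed

text \<open>
  A crude common bound for the coordinates of all generators.
\<close>

definition entries :: real
  where "entries = (\<Sum>i\<in>UNIV. \<Sum>j\<le>m i. \<Sum>v\<in>UNIV. real (a i j v))"

lemma entries_nonneg: "0 \<le> entries"
  unfolding entries_def by (intro sum_nonneg) auto

lemma entry_le: "j \<le> m i \<Longrightarrow> real (a i j v) \<le> entries"
  unfolding entries_def
  by (rule order_trans[OF member_le_sum[of v UNIV] entry_le_sum[where g = "\<lambda>i j. \<Sum>v\<in>UNIV. real (a i j v)"]])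
     (auto intro: sum_nonneg)

lemma sum_split_x0: "(\<Sum>v\<in>UNIV. g v) = g x0 + (\<Sum>v\<in>C. g v :: 'r::comm_monoid_add)"
  using sum.remove[of UNIV x0 g] by (simp add: Compl_eq_Diff_UNIV)

lemma comb_bound:
  assumes "\<And>i j. j \<le> m i \<Longrightarrow> 0 \<le> \<mu> i j"
  shows "0 \<le> comb \<mu> v" "comb \<mu> v \<le> entries * (\<Sum>i\<in>UNIV. csum \<mu> i)"
proof -
  show "0 \<le> comb \<mu> v" unfolding comb_def by (intro sum_nonneg mult_nonneg_nonneg) (use assms in auto)
  have "comb \<mu> v \<le> (\<Sum>i\<in>UNIV. \<Sum>j\<le>m i. \<mu> i j * entries)"
    unfolding comb_def by (intro sum_mono mult_left_mono) (use assms entry_le in auto)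
  thus "comb \<mu> v \<le> entries * (\<Sum>i\<in>UNIV. csum \<mu> i)"
    by (simp add: csum_def sum_distrib_left mult.commute)
qed

lemma body_bound:
  assumes "x \<in> body l" "v \<in> C"
  shows "0 \<le> x v" "x v \<le> entries * (\<Sum>i\<in>UNIV. l i)"
proof -
  obtain \<mu> where \<mu>: "\<forall>i j. j \<le> m i \<longrightarrow> 0 \<le> \<mu> i j" "csum \<mu> = l" "x = restrict (comb \<mu>) C"
    using assms(1) unfolding body_def by blast
  show "0 \<le> x v" "x v \<le> entries * (\<Sum>i\<in>UNIV. l i)"
    using comb_bound[of \<mu> v, OF \<mu>(1)[rule_format]] assms(2) by (simp_all add: \<mu>(2,3))
qed

lemma body_extensional: "body l \<subseteq> extensional C"
  by (auto simp: body_def)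

text \<open>
  For nonnegative weights the body is a continuous image of a product of simplices, otherwise it is empty.
\<close>

lemma embed_body_compact: "compact (embed C ` body l)"
proof (cases "\<forall>i. 0 \<le> l i")
  case False
  have "body l = {}"
  proof (rule ccontr)
    assume "body l \<noteq> {}"
    then obtain x where "x \<in> body l" by blast
    then obtain \<mu> where "\<forall>i j. j \<le> m i \<longrightarrow> 0 \<le> \<mu> i j" "csum \<mu> = l" unfolding body_def by blast
    hence "0 \<le> l i" for i by (auto simp: csum_def intro!: sum_nonneg)
    thus False using False by blast
  qed
  thus ?thesis by simp
next
  case True
  let ?S = "PiE UNIV (\<lambda>(i, j). if j \<le> m i then {0..l i} else {0}) :: ('p \<times> nat \<Rightarrow> real) set"
  let ?T = "{\<mu> :: 'p \<times> nat \<Rightarrow> real. \<forall>i. (\<Sum>j\<le>m i. \<mu> (i, j)) = l i}"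
  let ?g = "\<lambda>\<mu>. \<Sum>v\<in>C. comb (\<lambda>i j. \<mu> (i, j)) v *\<^sub>R (axis v 1 :: real ^ 'v)"
  have "compactin (product_topology (\<lambda>_. euclidean) UNIV) ?S"
    unfolding compactin_PiE by (auto split: if_splits)
  hence cS: "compact ?S" by (simp add: euclidean_product_topology)
  have "closed ?T"
    by (intro closed_Collect_all closed_Collect_eq continuous_intros continuous_on_product_coordinates)
  hence "compact (?S \<inter> ?T)" using cS by (rule compact_Int_closed[rotated])
  moreover have "continuous_on UNIV ?g"
    unfolding comb_def by (intro continuous_intros continuous_on_product_coordinates)
  hence "continuous_on (?S \<inter> ?T) ?g" by (rule continuous_on_subset) simp
  ultimately have "compact (?g ` (?S \<inter> ?T))" by (rule compact_continuous_image[rotated])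
  moreover have "?g ` (?S \<inter> ?T) = embed C ` body l"
  proof (intro equalityI subsetI)
    fix y assume "y \<in> ?g ` (?S \<inter> ?T)"
    then obtain \<mu> where \<mu>: "\<mu> \<in> ?S" "\<mu> \<in> ?T" "y = ?g \<mu>" by blast
    let ?x = "restrict (comb (\<lambda>i j. \<mu> (i, j))) C"
    have "y = embed C ?x" unfolding \<mu>(3) embed_def by (rule sum.cong) auto
    moreover have "?x \<in> body l"
    proof (rule bodyI[OF _ _ refl])
      fix i j assume "j \<le> m i"
      have "\<mu> (i, j) \<in> (case (i, j) of (i, j) \<Rightarrow> if j \<le> m i then {0..l i} else {0})"
        using \<mu>(1) by (auto simp: PiE_iff)
      thus "0 \<le> \<mu> (i, j)" using \<open>j \<le> m i\<close> by simp
    qed (use \<mu>(2) in \<open>auto simp: csum_def\<close>)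
    ultimately show "y \<in> embed C ` body l" by blast
  next
    fix y assume "y \<in> embed C ` body l"
    then obtain x where x: "x \<in> body l" "y = embed C x" by blast
    obtain \<mu> where \<mu>: "\<forall>i j. j \<le> m i \<longrightarrow> 0 \<le> \<mu> i j" "csum \<mu> = l" "x = restrict (comb \<mu>) C"
      using x(1) unfolding body_def by blast
    let ?\<nu> = "\<lambda>(i, j). if j \<le> m i then \<mu> i j else 0"
    have "comb (\<lambda>i j. ?\<nu> (i, j)) = comb \<mu>" unfolding comb_def by (intro ext sum.cong) auto
    hence "y = ?g ?\<nu>" unfolding x(2) \<mu>(3) embed_def by (intro sum.cong) auto
    moreover have "?\<nu> \<in> ?T" using \<mu>(2) by (auto simp: csum_def)
    moreover have "?\<nu> \<in> ?S"
    proof -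
      have "\<mu> i j \<le> l i" if "j \<le> m i" for i j
        using member_le_sum[of j "{..m i}" "\<mu> i"] \<mu>(1,2) that by (auto simp: csum_def)
      thus ?thesis using \<mu>(1) by (auto simp: PiE_iff)
    qed
    ultimately show "y \<in> ?g ` (?S \<inter> ?T)" by blast
  qed
  ultimately show ?thesis by simp
qed

lemma embed_inject: "x \<in> extensional C \<Longrightarrow> y \<in> extensional C \<Longrightarrow> embed C x = embed C y \<Longrightarrow> x = y"
proof (rule extensionalityI[of x C y])
  fix v assume "embed C x = embed C y" "v \<in> C"
  thus "x v = y v" using embed_nth[of C x v] embed_nth[of C y v] by simp
qed

lemma body_sets: "body l \<in> sets (leb C)"
proof -
  have "body l = {x \<in> extensional C. embed C x \<in> embed C ` body l}"
    using embed_inject body_extensional by blast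
  also have "\<dots> \<in> sets (leb C)"
    by (rule embed_vimage_closed) (rule compact_imp_closed[OF embed_body_compact])
  finally show ?thesis .
qed

lemma body_subset_box: "body l \<subseteq> cubebox C (entries * (\<Sum>i\<in>UNIV. l i))"
proof
  fix x assume x: "x \<in> body l"
  show "x \<in> cubebox C (entries * (\<Sum>i\<in>UNIV. l i))"
  proof (rule PiE_I)
    fix v assume "v \<in> C"
    from body_bound[OF x this] show "x v \<in> {- (entries * (\<Sum>i\<in>UNIV. l i))..entries * (\<Sum>i\<in>UNIV. l i)}"
      by auto
  qed (use x body_extensional in \<open>auto simp: extensional_def\<close>)
qed

lemma body_fmeasurable: "body l \<in> fmeasurable (leb C)"
  by (rule fmeasurable_bounded[OF _ body_sets body_subset_box]) simp

definition vol :: "('p \<Rightarrow> real) \<Rightarrow> real" where "vol l = volume C (body l)"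

lemma vol_scale:
  assumes "c > 0"
  shows "vol (\<lambda>i. c * l i) = c ^ card C * vol l"
proof -
  have "body (\<lambda>i. c * l i) = affine_map C c (\<lambda>_. 0) ` body l"
  proof (intro equalityI subsetI)
    fix x assume x: "x \<in> body (\<lambda>i. c * l i)"
    from body_scale[OF this, of "1 / c"] assms have "(\<lambda>v\<in>C. x v / c) \<in> body l" by simp
    moreover have "x = affine_map C c (\<lambda>_. 0) (\<lambda>v\<in>C. x v / c)"
      using assms subsetD[OF body_extensional x] by (auto simp: affine_map_def extensional_def fun_eq_iff restrict_def)
    ultimately show "x \<in> affine_map C c (\<lambda>_. 0) ` body l" by blast
  next
    fix x assume "x \<in> affine_map C c (\<lambda>_. 0) ` body l"
    then obtain y where y: "y \<in> body l" "x = affine_map C c (\<lambda>_. 0) y" by blast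
    have "x = (\<lambda>v\<in>C. c * y v)" unfolding y(2) affine_map_def by simp
    thus "x \<in> body (\<lambda>i. c * l i)" using body_scale[OF y(1), of c] assms by simp
  qed
  thus ?thesis unfolding vol_def using volume_affine(2)[OF _ assms body_sets, of "\<lambda>_. 0" l] by simp
qed

text \<open>
  The larger body contains a translate of the smaller one.
\<close>

lemma vol_mono:
  assumes "\<And>i. 0 \<le> c i"
  shows "vol l \<le> vol (\<lambda>i. l i + c i)"
proof -
  obtain y where y: "y \<in> body c" using body_nonempty assms by blast
  have sub: "affine_map C 1 y ` body l \<subseteq> body (\<lambda>i. l i + c i)"
  proof
    fix x assume "x \<in> affine_map C 1 y ` body l"
    then obtain z where z: "z \<in> body l" "x = affine_map C 1 y z" by blast
    thus "x \<in> body (\<lambda>i. l i + c i)" using body_add[OF z(1) y] by (simp add: affine_map_def)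
  qed
  have "vol l = volume C (affine_map C 1 y ` body l)"
    unfolding vol_def using volume_affine(2)[OF _ _ body_sets, of 1 y l] by simp
  also have "\<dots> \<le> vol (\<lambda>i. l i + c i)"
    unfolding vol_def volume_def using volume_affine(1)[OF _ _ body_sets, of 1 y l]
    by (intro measure_mono_fmeasurable[OF sub _ body_fmeasurable]) simp
  finally show ?thesis .
qed

text \<open>
  After scaling by \<open>1 / n\<close>, the body of weight \<open>n * t + c\<close> lies in the neighbourhood of \<open>body t\<close> of radius
  proportional to \<open>1 / n\<close>. These neighbourhoods decrease to the compact set \<open>body t\<close>, so their
  volumes converge to its volume.
\<close>

lemma vol_tendsto:
  fixes t c :: "'p \<Rightarrow> nat"
  shows "(\<lambda>n. vol (\<lambda>i. real (n * t i + c i)) / real n ^ card C) \<longlonglongrightarrow> vol (\<lambda>i. real (t i))"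
proof -
  let ?l = "\<lambda>i. real (t i)"
  let ?K = "embed C ` body ?l"
  define b where "b = real (card C) * (entries * (\<Sum>i\<in>UNIV. real (c i)))"
  have b0: "0 \<le> b" unfolding b_def by (intro mult_nonneg_nonneg entries_nonneg sum_nonneg) auto
  have K: "closed ?K" "?K \<noteq> {}"
    using compact_imp_closed[OF embed_body_compact] body_nonempty[of ?l] by auto
  \<comment> \<open>indexed from \<open>1 / Suc 0\<close> on, so that no division by zero occurs\<close>
  define N where "N n = {x \<in> extensional C. embed C x \<in> {y. infdist y ?K \<le> b / real (Suc n)}}" for n
  have Nsets: "N n \<in> sets (leb C)" for n
    unfolding N_def by (intro embed_vimage_closed closed_Collect_le continuous_intros)
  have dec: "decseq N"
  proof (rule decseq_SucI)
    fix n
    have "b / real (Suc (Suc n)) \<le> b / real (Suc n)" using b0 by (intro divide_left_mono) auto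
    thus "N (Suc n) \<subseteq> N n" unfolding N_def by auto
  qed
  have Nbox: "N n \<subseteq> cubebox C (entries * (\<Sum>i\<in>UNIV. ?l i) + b)" for n
  proof
    fix x assume x: "x \<in> N n"
    obtain y where y: "y \<in> ?K" "infdist (embed C x) ?K = dist (embed C x) y"
      using infdist_attains_inf[OF K] by blast
    then obtain z where z: "z \<in> body ?l" "y = embed C z" by blast
    have "b / real (Suc n) \<le> b / 1" using b0 by (intro divide_left_mono) auto
    hence d: "dist (embed C x) (embed C z) \<le> b" using x y z by (simp add: N_def)
    show "x \<in> cubebox C (entries * (\<Sum>i\<in>UNIV. ?l i) + b)"
    proof (rule PiE_I)
      fix v assume v: "v \<in> C"
      have "\<bar>x v - z v\<bar> = \<bar>(embed C x - embed C z) $ v\<bar>" using v by (simp add: embed_nth)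
      also have "\<dots> \<le> norm (embed C x - embed C z)" by (rule component_le_norm_cart)
      finally have "\<bar>x v - z v\<bar> \<le> b" using d by (simp add: dist_norm)
      with body_bound[OF z(1) v]
      show "x v \<in> {- (entries * (\<Sum>i\<in>UNIV. ?l i) + b)..entries * (\<Sum>i\<in>UNIV. ?l i) + b}"
        unfolding atLeastAtMost_iff abs_le_iff by linarith
    qed (use x in \<open>auto simp: N_def extensional_def\<close>)
  qed
  have Nfm: "N n \<in> fmeasurable (leb C)" for n by (rule fmeasurable_bounded[OF _ Nsets Nbox]) simp
  have inter: "(\<Inter>n. N n) = body ?l"
  proof (intro equalityI subsetI)
    fix x assume x: "x \<in> (\<Inter>n. N n)"
    have le: "infdist (embed C x) ?K \<le> b / real (Suc n)" for n using x by (auto simp: N_def)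
    have "(\<lambda>n. b / real (Suc n)) \<longlonglongrightarrow> 0" using LIMSEQ_Suc[OF lim_const_over_n] .
    hence "infdist (embed C x) ?K \<le> 0" by (rule LIMSEQ_le_const) (use le in auto)
    hence "embed C x \<in> ?K" using K in_closed_iff_infdist_zero[of ?K "embed C x"] infdist_nonneg[of "embed C x" ?K] by force
    moreover have "x \<in> extensional C" using x by (auto simp: N_def)
    ultimately show "x \<in> body ?l" using embed_inject body_extensional by blast
  next
    fix x assume "x \<in> body ?l"
    thus "x \<in> (\<Inter>n. N n)" using b0 body_extensional by (auto simp: N_def)
  qed
  have "(\<lambda>n. measure (leb C) (N n)) \<longlonglongrightarrow> measure (leb C) (\<Inter>n. N n)"
    by (rule Lim_measure_decseq) (use Nsets dec fmeasurableD2[OF Nfm] in auto)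
  hence lim: "(\<lambda>n. measure (leb C) (N n)) \<longlonglongrightarrow> vol ?l" by (simp add: inter vol_def volume_def)
  let ?s = "\<lambda>n i. real (t i) + 1 / real (Suc n) * real (c i)"
  have sub: "body (?s n) \<subseteq> N n" for n
  proof
    fix x assume x: "x \<in> body (?s n)"
    obtain y y' where y: "y \<in> body ?l" "y' \<in> body (\<lambda>i. 1 / real (Suc n) * real (c i))" "x = (\<lambda>v\<in>C. y v + y' v)"
      by (rule body_split[OF x]) auto
    have "embed C x = embed C y + embed C y'" unfolding y(3) vec_eq_iff by (simp add: embed_nth)
    hence "dist (embed C x) (embed C y) = norm (embed C y')" by (simp add: dist_norm)
    also have "\<dots> \<le> (\<Sum>v\<in>C. norm (y' v *\<^sub>R (axis v 1 :: real ^ 'v)))" unfolding embed_def by (rule norm_sum)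
    also have "\<dots> \<le> (\<Sum>v\<in>C. entries * (\<Sum>i\<in>UNIV. 1 / real (Suc n) * real (c i)))"
    proof (rule sum_mono)
      fix v assume "v \<in> C"
      from body_bound[OF y(2) this] show "norm (y' v *\<^sub>R (axis v 1 :: real ^ 'v)) \<le> entries * (\<Sum>i\<in>UNIV. 1 / real (Suc n) * real (c i))"
        by simp
    qed
    also have "\<dots> = b / real (Suc n)" by (simp add: b_def sum_divide_distrib[symmetric])
    finally have "infdist (embed C x) ?K \<le> b / real (Suc n)"
      using infdist_le[of "embed C y" ?K "embed C x"] y(1) by auto
    thus "x \<in> N n" using subsetD[OF body_extensional x] by (auto simp: N_def)
  qed
  have "(\<lambda>n. vol (\<lambda>i. real (Suc n * t i + c i)) / real (Suc n) ^ card C) \<longlonglongrightarrow> vol ?l"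
  proof (rule tendsto_sandwich[OF _ _ tendsto_const lim])
    have eq: "vol (\<lambda>i. real (Suc n * t i + c i)) / real (Suc n) ^ card C = vol (?s n)" for n
    proof -
      have "(\<lambda>i. real (Suc n * t i + c i)) = (\<lambda>i. real (Suc n) * ?s n i)"
        by (rule ext) (simp add: field_simps)
      thus ?thesis using vol_scale[of "real (Suc n)" "?s n"] by simp
    qed
    show "\<forall>\<^sub>F n in sequentially. vol ?l \<le> vol (\<lambda>i. real (Suc n * t i + c i)) / real (Suc n) ^ card C"
      unfolding eq by (intro always_eventually allI vol_mono) auto
    show "\<forall>\<^sub>F n in sequentially. vol (\<lambda>i. real (Suc n * t i + c i)) / real (Suc n) ^ card C \<le> measure (leb C) (N n)"
      unfolding eq unfolding vol_def volume_def
      by (intro always_eventually allI measure_mono_fmeasurable[OF sub body_sets Nfm])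
  qed
  thus ?thesis by (rule LIMSEQ_imp_Suc)
qed

end

section \<open>Counting lattice points\<close>

context graded_map
begin

text \<open>
  The lattice generated by the differences of generators with the same index \<open>i\<close>.
\<close>

definition lat :: "('v \<Rightarrow> int) set"
  where "lat = {comb z | z. csum z = (\<lambda>_. 0)}"

lemma lat_zero: "(\<lambda>_. 0) \<in> lat"
  unfolding lat_def by (intro CollectI exI[of _ "\<lambda>_ _. 0"]) (simp add: comb_def csum_def fun_eq_iff)

lemma lat_diff: "u \<in> lat \<Longrightarrow> w \<in> lat \<Longrightarrow> (\<lambda>v. u v - w v) \<in> lat"
proof -
  assume "u \<in> lat" "w \<in> lat"
  then obtain z z' where "u = comb z" "csum z = (\<lambda>_. 0)" "w = comb z'" "csum z' = (\<lambda>_. 0)"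
    unfolding lat_def by blast
  thus ?thesis unfolding lat_def by (intro CollectI exI[of _ "\<lambda>i j. z i j - z' i j"]) (simp add: comb_diff csum_diff)
qed

lemma lat_add: "u \<in> lat \<Longrightarrow> w \<in> lat \<Longrightarrow> (\<lambda>v. u v + w v) \<in> lat"
  using lat_diff[of u "\<lambda>v. 0 - w v"] lat_diff[OF lat_zero, of w] by simp

lemma lat_scale: "u \<in> lat \<Longrightarrow> (\<lambda>v. c * u v) \<in> lat"
proof -
  assume "u \<in> lat"
  then obtain z where "u = comb z" "csum z = (\<lambda>_. 0)" unfolding lat_def by blast
  thus ?thesis unfolding lat_def
    by (intro CollectI exI[of _ "\<lambda>i j. c * z i j"]) (use csum_scale[of "\<lambda>_. c" z] in \<open>simp add: comb_scale\<close>)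
qed

lemma lat_total: "u \<in> lat \<Longrightarrow> (\<Sum>v\<in>UNIV. u v) = 0"
proof -
  assume "u \<in> lat"
  then obtain z where "u = comb z" "csum z = (\<lambda>_. 0)" unfolding lat_def by blast
  thus ?thesis using comb_total[of z] by simp
qed

abbreviation one_comb :: "'v \<Rightarrow> 'r::comm_semiring_1" where "one_comb \<equiv> comb (\<lambda>_ _. 1)"

lemma csum_one: "csum (\<lambda>_ _. 1) i = of_nat (m i) + 1"
  by (simp add: csum_def add.commute)

lemma of_int_one_comb: "of_int (one_comb v) = one_comb v"
  by (simp add: comb_def)

text \<open>
  This says that the lattice has finite index in the integer vectors of total degree zero. The
  explicit multiples give both a bounded fundamental domain and, below, a neighbourhood of an
  interior point of the bodies.
\<close>

definition full_rank :: bool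
  where "full_rank \<longleftrightarrow> (\<forall>v\<in>C. \<exists>n>0. (\<lambda>w. (if w = v then n else 0) - (if w = x0 then n else 0)) \<in> lat)"

text \<open>
  By full rank, the vectors with entries bounded by \<open>b\<close> are combinations of generators of multidegree
  zero with bounded real coefficients. Adding a large \<open>L\<close> to all coefficients makes them nonnegative.
\<close>

lemma deep_point:
  assumes full_rank
  shows "\<exists>L0 :: nat. \<forall>L\<ge>L0. \<forall>x. (\<forall>v\<in>C. \<bar>x v\<bar> \<le> b) \<longrightarrow>
    (\<lambda>v\<in>C. x v + real L * one_comb v) \<in> body (\<lambda>i. real L * (real (m i) + 1))"
proof -
  have "\<forall>v\<in>C. \<exists>n z. n > 0 \<and> csum z = (\<lambda>_. 0) \<and> (\<lambda>w. (if w = v then n else 0) - (if w = x0 then n else 0)) = (comb z :: 'v \<Rightarrow> int)"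
    using assms unfolding full_rank_def lat_def by blast
  from bchoice[OF this] obtain n where "\<forall>v\<in>C. \<exists>z. n v > 0 \<and> csum z = (\<lambda>_. 0) \<and>
      (\<lambda>w. (if w = v then n v else 0) - (if w = x0 then n v else 0)) = (comb z :: 'v \<Rightarrow> int)" ..
  from bchoice[OF this] obtain z where z: "\<forall>v\<in>C. n v > 0 \<and> csum (z v) = (\<lambda>_. 0) \<and>
      (\<lambda>w. (if w = v then n v else 0) - (if w = x0 then n v else 0)) = (comb (z v) :: 'v \<Rightarrow> int)" ..
  have nz: "n v > 0" "csum (z v) = (\<lambda>_. 0 :: int)"
    "(\<lambda>w. (if w = v then n v else 0) - (if w = x0 then n v else 0)) = (comb (z v) :: 'v \<Rightarrow> int)" if "v \<in> C" for v
    using z that by blast+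
  define S where "S = (\<Sum>v\<in>C. \<Sum>i\<in>UNIV. \<Sum>j\<le>m i. \<bar>real_of_int (z v i j)\<bar>)"
  define L0 where "L0 = nat \<lceil>\<bar>b\<bar> * S\<rceil>"
  have "(\<lambda>v\<in>C. x v + real L * one_comb v) \<in> body (\<lambda>i. real L * (real (m i) + 1))"
    if L: "L \<ge> L0" and x: "\<forall>v\<in>C. \<bar>x v\<bar> \<le> b" for L x
  proof -
    define \<nu> where "\<nu> i j = (\<Sum>v\<in>C. (x v / real_of_int (n v)) * real_of_int (z v i j))" for i j
    define \<mu> where "\<mu> i j = \<nu> i j + real L * 1" for i j
    have cs: "csum \<nu> = (\<lambda>_. 0)"
    proof
      fix i
      have "csum \<nu> i = (\<Sum>v\<in>C. (x v / real_of_int (n v)) * csum (\<lambda>i j. real_of_int (z v i j)) i)"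
        unfolding \<nu>_def csum_sum using csum_scale[of "\<lambda>_. x v / real_of_int (n v)" for v] by simp
      also have "\<dots> = 0" by (rule sum.neutral) (simp add: csum_of_int nz(2))
      finally show "csum \<nu> i = 0" .
    qed
    have cb: "comb \<nu> w = x w" if w: "w \<in> C" for w
    proof -
      have "comb \<nu> w = (\<Sum>v\<in>C. (x v / real_of_int (n v)) * comb (\<lambda>i j. real_of_int (z v i j)) w)"
        unfolding \<nu>_def comb_sum comb_scale ..
      also have "\<dots> = (\<Sum>v\<in>C. if v = w then x v else 0)"
      proof (rule sum.cong[OF refl])
        fix v assume v: "v \<in> C"
        have "comb (z v) w = (if w = v then n v else 0)" using fun_cong[OF nz(3)[OF v], of w] w by auto
        thus "x v / real_of_int (n v) * comb (\<lambda>i j. real_of_int (z v i j)) w = (if v = w then x v else 0)"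
          using nz(1)[OF v] by (cases "w = v") (simp_all add: comb_of_int)
      qed
      also have "\<dots> = x w" using w by simp
      finally show ?thesis .
    qed
    have \<nu>b: "\<bar>\<nu> i j\<bar> \<le> \<bar>b\<bar> * S" if j: "j \<le> m i" for i j
    proof -
      have "\<bar>\<nu> i j\<bar> \<le> (\<Sum>v\<in>C. \<bar>(x v / real_of_int (n v)) * real_of_int (z v i j)\<bar>)"
        unfolding \<nu>_def by (rule sum_abs)
      also have "\<dots> \<le> (\<Sum>v\<in>C. \<bar>b\<bar> * (\<Sum>i\<in>UNIV. \<Sum>j\<le>m i. \<bar>real_of_int (z v i j)\<bar>))"
      proof (rule sum_mono)
        fix v assume v: "v \<in> C"
        have n1: "1 \<le> real_of_int (n v)" using nz(1)[OF v] by simp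
        have "\<bar>x v\<bar> \<le> b" using x v by blast
        hence "\<bar>x v\<bar> \<le> \<bar>b\<bar>" by linarith
        hence "\<bar>x v\<bar> / real_of_int (n v) \<le> \<bar>b\<bar> / 1" using n1 by (intro frac_le) auto
        hence 1: "\<bar>x v / real_of_int (n v)\<bar> \<le> \<bar>b\<bar>" using n1 by simp
        have "\<bar>real_of_int (z v i j)\<bar> \<le> (\<Sum>i\<in>UNIV. \<Sum>j\<le>m i. \<bar>real_of_int (z v i j)\<bar>)"
          by (rule entry_le_sum[OF j]) simp
        thus "\<bar>(x v / real_of_int (n v)) * real_of_int (z v i j)\<bar> \<le> \<bar>b\<bar> * (\<Sum>i\<in>UNIV. \<Sum>j\<le>m i. \<bar>real_of_int (z v i j)\<bar>)"
          unfolding abs_mult using 1 by (intro mult_mono) auto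
      qed
      also have "\<dots> = \<bar>b\<bar> * S" by (simp add: S_def sum_distrib_left)
      finally show ?thesis .
    qed
    have "\<bar>b\<bar> * S \<le> real L" using L unfolding L0_def by linarith
    hence pos: "0 \<le> \<mu> i j" if "j \<le> m i" for i j using \<nu>b[OF that] unfolding \<mu>_def by linarith
    show ?thesis
    proof (rule bodyI[OF pos])
      show "csum \<mu> = (\<lambda>i. real L * (real (m i) + 1))"
        unfolding \<mu>_def csum_add cs using csum_scale[of "\<lambda>_. real L" "\<lambda>_ _. 1"] by (simp add: csum_one)
      show "(\<lambda>v\<in>C. x v + real L * one_comb v) = restrict (comb \<mu>) C"
        unfolding \<mu>_def comb_add comb_scale by (rule ext) (simp add: cb)
    qed
  qed
  thus ?thesis by blast
qed

lemma finite_bounded_int_functions: "finite {\<rho> :: 'b::finite \<Rightarrow> int. \<forall>v. \<bar>\<rho> v\<bar> \<le> b}"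
proof (rule finite_subset)
  show "{\<rho> :: 'b \<Rightarrow> int. \<forall>v. \<bar>\<rho> v\<bar> \<le> b} \<subseteq> PiE UNIV (\<lambda>_. {- b..b})"
    by (auto simp: PiE_iff abs_le_iff minus_le_iff)
qed (simp add: finite_PiE)

text \<open>
  Rounding down the real coefficients of a lattice point of \<open>body t\<close> leaves one of finitely many
  remainders, and one fixed multiple of the sum of all generators makes the coefficients of all
  these remainders nonnegative.
\<close>

lemma lattice_point_in_sumset:
  "\<exists>K0. \<forall>K\<ge>K0. \<forall>t (z :: 'p \<Rightarrow> nat \<Rightarrow> int). csum z = (\<lambda>i. int (t i)) \<longrightarrow>
     (\<lambda>v\<in>C. real_of_int (comb z v)) \<in> body (\<lambda>i. real (t i)) \<longrightarrow>
     (\<exists>s\<in>sumset (\<lambda>i. t i + K * (m i + 1)). \<forall>v. int (s v) = comb z v + int K * one_comb v)"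
proof -
  define b where "b = \<lceil>entries * (\<Sum>i\<in>UNIV. real (m i) + 1)\<rceil> + (\<Sum>i\<in>UNIV. int (m i) + 1)"
  \<comment> \<open>the pairs of a value and a multidegree that a remainder can have\<close>
  define R where "R = {\<rho> :: 'v \<Rightarrow> int. \<forall>v. \<bar>\<rho> v\<bar> \<le> b} \<times> {q :: 'p \<Rightarrow> int. \<forall>i. \<bar>q i\<bar> \<le> b}"
  have finR: "finite R" unfolding R_def by (intro finite_cartesian_product finite_bounded_int_functions)
  \<comment> \<open>an integer combination with that value and multidegree, if there is one\<close>
  define zz where "zz p = (SOME z :: 'p \<Rightarrow> nat \<Rightarrow> int. comb z = fst p \<and> csum z = snd p)" for p :: "('v \<Rightarrow> int) \<times> ('p \<Rightarrow> int)"
  have zz: "comb (zz (comb z, csum z)) = comb z" "csum (zz (comb z, csum z)) = csum z" for z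
    unfolding zz_def using someI[of "\<lambda>z'. comb z' = fst (comb z, csum z) \<and> csum z' = snd (comb z, csum z)" z] by auto
  define K0 where "K0 = nat (\<Sum>p\<in>R. \<Sum>i\<in>UNIV. \<Sum>j\<le>m i. \<bar>zz p i j\<bar>)"
  have K0: "\<bar>zz p i j\<bar> \<le> int K0" if p: "p \<in> R" and j: "j \<le> m i" for p i j
  proof -
    have "\<bar>zz p i j\<bar> \<le> (\<Sum>i\<in>UNIV. \<Sum>j\<le>m i. \<bar>zz p i j\<bar>)"
      by (rule entry_le_sum[OF j]) simp
    also have "\<dots> \<le> (\<Sum>p\<in>R. \<Sum>i\<in>UNIV. \<Sum>j\<le>m i. \<bar>zz p i j\<bar>)"
      by (rule member_le_sum[of p _ "\<lambda>p. \<Sum>i\<in>UNIV. \<Sum>j\<le>m i. \<bar>zz p i j\<bar>"]) (use p finR in \<open>auto intro!: sum_nonneg\<close>)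
    finally have "\<bar>zz p i j\<bar> \<le> (\<Sum>p\<in>R. \<Sum>i\<in>UNIV. \<Sum>j\<le>m i. \<bar>zz p i j\<bar>)" .
    moreover have "int K0 = (\<Sum>p\<in>R. \<Sum>i\<in>UNIV. \<Sum>j\<le>m i. \<bar>zz p i j\<bar>)"
      unfolding K0_def by (intro nat_0_le sum_nonneg) auto
    ultimately show ?thesis by simp
  qed
  have "\<exists>s\<in>sumset (\<lambda>i. t i + K * (m i + 1)). \<forall>v. int (s v) = comb z v + int K * one_comb v"
    if K: "K \<ge> K0" and cz: "csum z = (\<lambda>i. int (t i))"
      and bz: "(\<lambda>v\<in>C. real_of_int (comb z v)) \<in> body (\<lambda>i. real (t i))" for K t and z :: "'p \<Rightarrow> nat \<Rightarrow> int"
  proof -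
    obtain \<mu> where \<mu>: "\<forall>i j. j \<le> m i \<longrightarrow> 0 \<le> \<mu> i j" "csum \<mu> = (\<lambda>i. real (t i))"
      "(\<lambda>v\<in>C. real_of_int (comb z v)) = restrict (comb \<mu>) C"
      using bz unfolding body_def by blast
    have onC: "comb \<mu> v = real_of_int (comb z v)" if "v \<in> C" for v
      using fun_cong[OF \<mu>(3), of v] that by simp
    have tot: "(\<Sum>v\<in>UNIV. comb \<mu> v) = real_of_int (\<Sum>v\<in>UNIV. comb z v)"
      unfolding comb_total by (simp add: \<mu>(2) cz)
    \<comment> \<open>the coordinate forgotten by the projection is determined by the total degree\<close>
    have "comb \<mu> x0 = real_of_int (comb z x0)"
    proof -
      have "(\<Sum>v\<in>C. comb \<mu> v) = real_of_int (\<Sum>v\<in>C. comb z v)" by (simp add: onC)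
      thus ?thesis using tot by (simp add: sum_split_x0)
    qed
    hence all: "comb \<mu> v = real_of_int (comb z v)" for v using onC by (cases "v = x0") auto
    define \<phi> where "\<phi> i j = \<lfloor>\<mu> i j\<rfloor>" for i j
    define \<rho> where "\<rho> i j = z i j - \<phi> i j" for i j
    define fr where "fr i j = \<mu> i j - real_of_int (\<phi> i j)" for i j
    have fr: "0 \<le> fr i j" "fr i j \<le> 1" for i j unfolding fr_def \<phi>_def by linarith+
    have "comb fr v = real_of_int (comb \<rho> v)" for v
      unfolding fr_def \<rho>_def comb_diff by (simp add: comb_of_int all)
    moreover have csf: "csum fr i = real_of_int (csum \<rho> i)" for i
      unfolding fr_def \<rho>_def csum_diff by (simp add: csum_of_int \<mu>(2) cz)
    moreover have cfb: "0 \<le> csum fr i" "csum fr i \<le> real (m i) + 1" for i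
    proof -
      show "0 \<le> csum fr i" unfolding csum_def by (intro sum_nonneg) (use fr in auto)
      have "csum fr i \<le> (\<Sum>j\<le>m i. 1)" unfolding csum_def by (intro sum_mono) (use fr in auto)
      thus "csum fr i \<le> real (m i) + 1" by simp
    qed
    moreover have "0 \<le> comb fr v" "comb fr v \<le> entries * (\<Sum>i\<in>UNIV. real (m i) + 1)" for v
    proof -
      show "0 \<le> comb fr v" by (rule comb_bound(1)) (rule fr)
      have "comb fr v \<le> entries * (\<Sum>i\<in>UNIV. csum fr i)" by (rule comb_bound(2)) (rule fr)
      also have "\<dots> \<le> entries * (\<Sum>i\<in>UNIV. real (m i) + 1)"
        by (intro mult_left_mono sum_mono cfb entries_nonneg)
      finally show "comb fr v \<le> entries * (\<Sum>i\<in>UNIV. real (m i) + 1)" .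
    qed
    ultimately have rb: "0 \<le> real_of_int (comb \<rho> v)" "real_of_int (comb \<rho> v) \<le> entries * (\<Sum>i\<in>UNIV. real (m i) + 1)"
      "0 \<le> real_of_int (csum \<rho> i)" "real_of_int (csum \<rho> i) \<le> real (m i) + 1" for v i
      by metis+
    have "\<bar>comb \<rho> v\<bar> \<le> b" for v
    proof -
      have "comb \<rho> v \<le> \<lceil>entries * (\<Sum>i\<in>UNIV. real (m i) + 1)\<rceil>" using rb(2)[of v] by (simp add: le_ceiling_iff)
      moreover have "0 \<le> (\<Sum>i\<in>UNIV. int (m i) + 1)" by (intro sum_nonneg) auto
      ultimately show ?thesis using rb(1)[of v] unfolding b_def by simp
    qed
    moreover have "\<bar>csum \<rho> i\<bar> \<le> b" for i
    proof -
      have "csum \<rho> i \<le> int (m i) + 1" using rb(4)[of i] by linarith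
      also have "\<dots> \<le> (\<Sum>i\<in>UNIV. int (m i) + 1)" by (rule member_le_sum) auto
      finally have "csum \<rho> i \<le> (\<Sum>i\<in>UNIV. int (m i) + 1)" .
      moreover have "0 \<le> entries * (\<Sum>i\<in>UNIV. real (m i) + 1)"
        by (intro mult_nonneg_nonneg entries_nonneg sum_nonneg) auto
      hence "0 \<le> \<lceil>entries * (\<Sum>i\<in>UNIV. real (m i) + 1)\<rceil>" by linarith
      ultimately show ?thesis using rb(3)[of i] unfolding b_def by linarith
    qed
    ultimately have inR: "(comb \<rho>, csum \<rho>) \<in> R" by (simp add: R_def)
    let ?z = "zz (comb \<rho>, csum \<rho>)"
    define e where "e i j = nat (\<phi> i j + (?z i j + int K * 1))" for i j
    have e: "int (e i j) = \<phi> i j + (?z i j + int K * 1)" if j: "j \<le> m i" for i j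
    proof -
      have "0 \<le> \<phi> i j" using \<mu>(1) j by (simp add: \<phi>_def)
      moreover have "- int K \<le> ?z i j" using K0[OF inR j] K by linarith
      ultimately show ?thesis by (simp add: e_def)
    qed
    have ce: "comb (\<lambda>i j. int (e i j)) = comb (\<lambda>i j. \<phi> i j + (?z i j + int K * 1))"
      "csum (\<lambda>i j. int (e i j)) = csum (\<lambda>i j. \<phi> i j + (?z i j + int K * 1))"
      by (rule comb_cong, erule e) (rule csum_cong, erule e)
    have comb_e: "int (comb e v) = comb z v + int K * one_comb v" for v
    proof -
      have "int (comb e v) = comb \<phi> v + (comb \<rho> v + int K * one_comb v)"
        using comb_of_nat[of e v, where 'r = int] by (simp only: ce comb_add comb_scale zz)
      also have "comb \<rho> v = comb z v - comb \<phi> v" unfolding \<rho>_def comb_diff ..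
      finally show ?thesis by simp
    qed
    have csum_e: "csum e i = t i + K * (m i + 1)" for i
    proof -
      have "int (csum e i) = csum \<phi> i + (csum \<rho> i + int K * (int (m i) + 1))"
        using csum_of_nat[of e i, where 'r = int] csum_scale[of "\<lambda>_. int K" "\<lambda>_ _. 1"]
        by (simp only: ce csum_add zz csum_one)
      also have "csum \<rho> i = int (t i) - csum \<phi> i" unfolding \<rho>_def csum_diff cz ..
      finally have "int (csum e i) = int (t i + K * (m i + 1))" by (simp add: algebra_simps)
      thus ?thesis by (simp only: of_nat_eq_iff)
    qed
    have "comb e \<in> sumset (\<lambda>i. t i + K * (m i + 1))" unfolding sumset_def using csum_e by blast
    thus ?thesis using comb_e by blast
  qed
  thus ?thesis by blast
qed

text \<open>
  One representative for each coset of the lattice in the integer vectors of total degree zero.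
\<close>

definition transversal :: "('v \<Rightarrow> int) set \<Rightarrow> bool"
  where "transversal G \<longleftrightarrow> (\<forall>g\<in>G. (\<Sum>v\<in>UNIV. g v) = 0) \<and>
    (\<forall>y. (\<Sum>v\<in>UNIV. y v) = 0 \<longrightarrow> (\<exists>g\<in>G. (\<lambda>v. y v - g v) \<in> lat)) \<and>
    (\<forall>g\<in>G. \<forall>h\<in>G. (\<lambda>v. g v - h v) \<in> lat \<longrightarrow> g = h)"

lemma sumset_body: "s \<in> sumset t \<Longrightarrow> (\<lambda>v\<in>C. real (s v)) \<in> body (\<lambda>i. real (t i))"
proof -
  assume "s \<in> sumset t"
  then obtain e where e: "s = comb e" "csum e = t" unfolding sumset_def by blast
  show ?thesis
  proof (rule bodyI[where \<mu> = "\<lambda>i j. real (e i j)"])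
    show "csum (\<lambda>i j. real (e i j)) = (\<lambda>i. real (t i))"
      using e(2) by (auto simp: csum_of_nat)
    show "(\<lambda>v\<in>C. real (s v)) = restrict (comb (\<lambda>i j. real (e i j))) C"
      by (rule ext) (simp add: e comb_of_nat)
  qed simp
qed

text \<open>
  The projection that forgets the coordinate \<open>x0\<close> is injective on vectors of fixed total degree.
\<close>

lemma eq_on_C_imp_eq:
  assumes "(\<Sum>v\<in>UNIV. y v) = (\<Sum>v\<in>UNIV. y' v :: int)" "\<And>v. v \<in> C \<Longrightarrow> y v = y' v"
  shows "y = y'"
proof
  fix v
  have "(\<Sum>v\<in>C. y v) = (\<Sum>v\<in>C. y' v)" using assms(2) by (rule sum.cong[OF refl])
  hence "y x0 = y' x0" using assms(1) by (simp add: sum_split_x0)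
  thus "y v = y' v" using assms(2)[of v] by (cases "v = x0") auto
qed

lemma sumset_total:
  assumes "s \<in> sumset t"
  shows "(\<Sum>v\<in>UNIV. int (s v)) = (\<Sum>i\<in>UNIV. int (t i) * int (\<delta> i))"
proof -
  obtain e where e: "s = comb e" "csum e = t" using assms unfolding sumset_def by blast
  have "(\<Sum>v\<in>UNIV. s v) = (\<Sum>i\<in>UNIV. t i * \<delta> i)" using comb_total[of e] by (simp add: e)
  from arg_cong[OF this, of int] show ?thesis by simp
qed

lemma sumset_diff_lat:
  assumes "s \<in> sumset t" "s' \<in> sumset t"
  shows "(\<lambda>v. int (s v) - int (s' v)) \<in> lat"
proof -
  obtain e e' where e: "s = comb e" "csum e = t" "s' = comb e'" "csum e' = t"
    using assms unfolding sumset_def by blast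
  have "(\<lambda>v. int (s v) - int (s' v)) = comb (\<lambda>i j. int (e i j) - int (e' i j))"
    by (rule ext) (simp add: comb_diff comb_of_nat e)
  moreover have "csum (\<lambda>i j. int (e i j) - int (e' i j)) = (\<lambda>_. 0)"
    by (rule ext) (simp add: csum_diff csum_of_nat e)
  ultimately show ?thesis unfolding lat_def by blast
qed

lemma transversal_bounded:
  fixes G :: "('v \<Rightarrow> int) set"
  assumes "finite G"
  shows "\<exists>b. \<forall>g\<in>G. \<forall>v. \<bar>real_of_int (g v)\<bar> + 1 \<le> b"
proof (intro exI ballI allI)
  fix g v assume g: "g \<in> G"
  have "\<bar>real_of_int (g v)\<bar> \<le> (\<Sum>v\<in>UNIV. \<bar>real_of_int (g v)\<bar>)"
    by (rule member_le_sum[of v _ "\<lambda>v. \<bar>real_of_int (g v)\<bar>"]) auto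
  also have "\<dots> \<le> (\<Sum>g\<in>G. \<Sum>v\<in>UNIV. \<bar>real_of_int (g v)\<bar>)"
    by (rule member_le_sum[of g _ "\<lambda>g. \<Sum>v\<in>UNIV. \<bar>real_of_int (g v)\<bar>"]) (use g assms in \<open>auto intro!: sum_nonneg\<close>)
  finally show "\<bar>real_of_int (g v)\<bar> + 1 \<le> (\<Sum>g\<in>G. \<Sum>v\<in>UNIV. \<bar>real_of_int (g v)\<bar>) + 1" by simp
qed

text \<open>
  The points \<open>s + g\<close> with \<open>s\<close> in the sumset and \<open>g\<close> in the transversal are distinct, and the unit cubes
  at these points stay at bounded distance from \<open>body t\<close>. So they fit into a translate of the body
  of a weight that exceeds \<open>t\<close> by a constant.
\<close>

lemma card_sumset_le_volume:
  assumes full_rank: full_rank and G: "finite G" "transversal G"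
  shows "\<exists>L0. \<forall>K\<ge>L0. \<forall>t. real (card G * card (sumset t)) \<le> vol (\<lambda>i. real (t i + K * (m i + 1)))"
proof -
  obtain b where gb: "\<And>g v. g \<in> G \<Longrightarrow> \<bar>real_of_int (g v)\<bar> + 1 \<le> b"
    using transversal_bounded[OF G(1)] by blast
  obtain L0 :: nat where L0: "\<And>L x. L \<ge> L0 \<Longrightarrow> (\<forall>v\<in>C. \<bar>x v\<bar> \<le> b) \<Longrightarrow>
    (\<lambda>v\<in>C. x v + real L * one_comb v) \<in> body (\<lambda>i. real L * (real (m i) + 1))"
    using deep_point[OF full_rank, of b] by blast
  have "real (card G * card (sumset t)) \<le> vol (\<lambda>i. real (t i + K * (m i + 1)))" if K: "K \<ge> L0" for K t
  proof -
    let ?Y = "(\<lambda>(s, g) v. int (s v) + g v) ` (sumset t \<times> G)"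
    let ?B = "body (\<lambda>i. real (t i + K * (m i + 1)))"
    let ?A = "affine_map C 1 (\<lambda>v. - (real K * one_comb v)) ` ?B"
    have inj: "inj_on (\<lambda>(s, g) v. int (s v) + g v) (sumset t \<times> G)"
    proof (rule inj_onI, clarify)
      fix s g s' g'
      assume *: "s \<in> sumset t" "g \<in> G" "s' \<in> sumset t" "g' \<in> G"
        and eq: "(\<lambda>v. int (s v) + g v) = (\<lambda>v. int (s' v) + g' v)"
      have "(\<lambda>v. g v - g' v) = (\<lambda>v. int (s' v) - int (s v))"
        using fun_cong[OF eq] by (intro ext) (smt (verit))
      hence "(\<lambda>v. g v - g' v) \<in> lat" using sumset_diff_lat[OF *(3,1)] by simp
      hence "g = g'" using G(2) * unfolding transversal_def by blast
      moreover have "s = s'" using fun_cong[OF eq] \<open>g = g'\<close> by (intro ext) simp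
      ultimately show "s = s' \<and> g = g'" by simp
    qed
    have finY: "finite ?Y" using G(1) finite_sumset by simp
    have tot: "(\<Sum>v\<in>UNIV. y v) = (\<Sum>i\<in>UNIV. int (t i) * int (\<delta> i))" if "y \<in> ?Y" for y
      using that G(2) by (auto simp: sum.distrib sumset_total transversal_def)
    have "real (card ?Y) \<le> volume C ?A"
    proof (rule card_cubes_le_volume[OF _ finY])
      fix y y' assume Y: "y \<in> ?Y" "y' \<in> ?Y" "y \<noteq> y'"
      show "\<exists>v\<in>C. y v \<noteq> y' v"
      proof (rule ccontr)
        assume "\<not> (\<exists>v\<in>C. y v \<noteq> y' v)"
        hence "y = y'" by (intro eq_on_C_imp_eq) (use tot[OF Y(1)] tot[OF Y(2)] in auto)
        thus False using Y(3) by blast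
      qed
    next
      show "?A \<in> fmeasurable (leb C)" by (rule volume_affine(3)) (use body_fmeasurable in auto)
      fix y assume "y \<in> ?Y"
      then obtain s g where sg: "s \<in> sumset t" "g \<in> G" "y = (\<lambda>v. int (s v) + g v)" by auto
      show "unit_cube C y \<subseteq> ?A"
      proof
        fix x assume x: "x \<in> unit_cube C y"
        let ?d = "\<lambda>v. x v - real (s v)"
        have "\<bar>?d v\<bar> \<le> b" if "v \<in> C" for v
        proof -
          have "real_of_int (y v) \<le> x v" "x v < real_of_int (y v) + 1"
            using x that by (auto simp: unit_cube_def PiE_iff)
          thus ?thesis using gb[OF sg(2), of v] unfolding sg(3) by simp
        qed
        hence "(\<lambda>v\<in>C. ?d v + real K * one_comb v) \<in> body (\<lambda>i. real K * (real (m i) + 1))"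
          using L0[OF K, of ?d] by blast
        from body_add[OF sumset_body[OF sg(1)] this]
        have "(\<lambda>v\<in>C. x v + real K * one_comb v) \<in> body (\<lambda>i. real (t i) + real K * (real (m i) + 1))"
          by (rule back_subst[of "\<lambda>x. x \<in> _"]) (rule ext, simp)
        hence "(\<lambda>v\<in>C. x v + real K * one_comb v) \<in> ?B" by (simp add: algebra_simps)
        moreover have "x = affine_map C 1 (\<lambda>v. - (real K * one_comb v)) (\<lambda>v\<in>C. x v + real K * one_comb v)"
          using x by (auto simp: affine_map_def unit_cube_def PiE_iff extensional_def fun_eq_iff restrict_def)
        ultimately show "x \<in> ?A" by blast
      qed
    qed simp
    also have "volume C ?A = vol (\<lambda>i. real (t i + K * (m i + 1)))"
      unfolding vol_def using volume_affine(2)[of C 1 ?B "\<lambda>v. - (real K * one_comb v)"] body_sets by simp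
    also have "card ?Y = card G * card (sumset t)"
      by (simp add: card_image[OF inj] card_cartesian_product mult.commute)
    finally show ?thesis .
  qed
  thus ?thesis by blast
qed

text \<open>
  The unit cubes at the integer points \<open>y\<close> that are obtained by rounding down the points of \<open>body t\<close>
  cover it. Each \<open>y\<close> is \<open>w + g\<close> with \<open>g\<close> in the transversal and \<open>w\<close> in the coset of combinations of
  multidegree \<open>t\<close>, at bounded distance from the body. A constant translation moves \<open>w\<close> first into a
  larger body and then, by the rounding argument, into a larger sumset.
\<close>

lemma volume_le_card_sumset:
  assumes full_rank: full_rank and G: "finite G" "transversal G"
  shows "\<exists>K0. \<forall>K\<ge>K0. \<forall>t. vol (\<lambda>i. real (t i)) \<le> real (card G * card (sumset (\<lambda>i. t i + K * (m i + 1))))"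
proof -
  obtain b where gb: "\<And>g v. g \<in> G \<Longrightarrow> \<bar>real_of_int (g v)\<bar> + 1 \<le> b"
    using transversal_bounded[OF G(1)] by blast
  obtain L0 :: nat where L0: "\<And>L x. L \<ge> L0 \<Longrightarrow> (\<forall>v\<in>C. \<bar>x v\<bar> \<le> b) \<Longrightarrow>
    (\<lambda>v\<in>C. x v + real L * one_comb v) \<in> body (\<lambda>i. real L * (real (m i) + 1))"
    using deep_point[OF full_rank, of b] by blast
  obtain K1 where K1: "\<And>K t (z :: 'p \<Rightarrow> nat \<Rightarrow> int). K \<ge> K1 \<Longrightarrow> csum z = (\<lambda>i. int (t i)) \<Longrightarrow>
     (\<lambda>v\<in>C. real_of_int (comb z v)) \<in> body (\<lambda>i. real (t i)) \<Longrightarrow>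
     (\<exists>s\<in>sumset (\<lambda>i. t i + K * (m i + 1)). \<forall>v. int (s v) = comb z v + int K * one_comb v)"
    using lattice_point_in_sumset by blast
  have "vol (\<lambda>i. real (t i)) \<le> real (card G * card (sumset (\<lambda>i. t i + K * (m i + 1))))" if K: "K \<ge> L0 + K1" for K t
  proof -
    define L where "L = K - K1"
    have L: "L \<ge> L0" "K = L + K1" using K by (auto simp: L_def)
    define \<tau> where "\<tau> = (\<Sum>i\<in>UNIV. int (t i) * int (\<delta> i))"
    define Y where "Y = {y :: 'v \<Rightarrow> int. (\<Sum>v\<in>UNIV. y v) = \<tau> \<and> (\<exists>x\<in>body (\<lambda>i. real (t i)). \<forall>v\<in>C. y v = \<lfloor>x v\<rfloor>)}"
    let ?S = "sumset (\<lambda>i. t i + K * (m i + 1))"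
    let ?img = "(\<lambda>(s, g) v. int (s v) + g v - int K * one_comb v) ` (?S \<times> G)"
    have YI: "Y \<subseteq> ?img"
    proof
      fix y assume "y \<in> Y"
      then obtain x where y: "(\<Sum>v\<in>UNIV. y v) = \<tau>" "x \<in> body (\<lambda>i. real (t i))" "\<forall>v\<in>C. y v = \<lfloor>x v\<rfloor>"
        unfolding Y_def by blast
      define o0 where "o0 = (\<lambda>i (j :: nat). if j = 0 then int (t i) else 0)"
      have co: "csum o0 = (\<lambda>i. int (t i))" by (rule ext) (simp add: csum_def o0_def)
      have "(\<Sum>v\<in>UNIV. y v - comb o0 v) = 0"
        by (simp add: sum_subtractf y(1) comb_total co \<tau>_def)
      then obtain g where g: "g \<in> G" "(\<lambda>v. y v - comb o0 v - g v) \<in> lat"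
        using G(2) unfolding transversal_def by blast
      then obtain z0 where z0: "(\<lambda>v. y v - comb o0 v - g v) = comb z0" "csum z0 = (\<lambda>_. 0)"
        unfolding lat_def by blast
      define z where "z i j = o0 i j + (z0 i j + int L * 1)" for i j
      have cz: "comb z v = y v - g v + int L * one_comb v" for v
        unfolding z_def comb_add comb_scale using fun_cong[OF z0(1), of v] by simp
      have sz: "csum z = (\<lambda>i. int (t i + L * (m i + 1)))"
        unfolding z_def csum_add co z0(2) using csum_scale[of "\<lambda>_. int L" "\<lambda>_ _. 1"]
        by (intro ext) (simp add: csum_one algebra_simps)
      let ?d = "\<lambda>v. real_of_int (y v) - real_of_int (g v) - x v"
      have "\<bar>?d v\<bar> \<le> b" if "v \<in> C" for v
      proof -
        have "y v = \<lfloor>x v\<rfloor>" using y(3) that by blast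
        hence "\<bar>real_of_int (y v) - x v\<bar> \<le> 1" by linarith
        thus ?thesis using gb[OF g(1), of v] by linarith
      qed
      hence "(\<lambda>v\<in>C. ?d v + real L * one_comb v) \<in> body (\<lambda>i. real L * (real (m i) + 1))"
        using L0[OF L(1), of ?d] by blast
      from body_add[OF y(2) this]
      have "(\<lambda>v\<in>C. real_of_int (comb z v)) \<in> body (\<lambda>i. real (t i) + real L * (real (m i) + 1))"
        by (rule back_subst[of "\<lambda>x. x \<in> _"]) (rule ext, simp add: cz of_int_one_comb)
      hence "(\<lambda>v\<in>C. real_of_int (comb z v)) \<in> body (\<lambda>i. real (t i + L * (m i + 1)))"
        by (simp add: algebra_simps)
      from K1[OF order_refl sz this] obtain s where
        s: "s \<in> sumset (\<lambda>i. t i + L * (m i + 1) + K1 * (m i + 1))" "\<forall>v. int (s v) = comb z v + int K1 * one_comb v"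
        by blast
      have "(\<lambda>i. t i + L * (m i + 1) + K1 * (m i + 1)) = (\<lambda>i. t i + K * (m i + 1))"
        by (rule ext) (simp add: L(2) algebra_simps)
      with s(1) have sS: "s \<in> ?S" by simp
      have "y = (\<lambda>v. int (s v) + g v - int K * one_comb v)"
        by (rule ext) (simp add: s(2)[rule_format] cz L(2) algebra_simps)
      thus "y \<in> ?img" using sS g(1) by (intro image_eqI[of _ _ "(s, g)"]) auto
    qed
    have finI: "finite ?img" using G(1) finite_sumset by simp
    have finY: "finite Y" using YI finI by (rule finite_subset)
    have "vol (\<lambda>i. real (t i)) \<le> real (card Y)"
      unfolding vol_def
    proof (rule volume_le_card_cubes[OF _ finY body_sets])
      show "body (\<lambda>i. real (t i)) \<subseteq> (\<Union>y\<in>Y. unit_cube C y)"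
      proof
        fix x assume x: "x \<in> body (\<lambda>i. real (t i))"
        define y where "y = (\<lambda>v. if v = x0 then \<tau> - (\<Sum>v\<in>C. \<lfloor>x v\<rfloor>) else \<lfloor>x v\<rfloor>)"
        have "(\<Sum>v\<in>C. y v) = (\<Sum>v\<in>C. \<lfloor>x v\<rfloor>)" by (rule sum.cong) (auto simp: y_def)
        hence "(\<Sum>v\<in>UNIV. y v) = \<tau>" by (simp add: sum_split_x0 y_def)
        moreover have yC: "\<forall>v\<in>C. y v = \<lfloor>x v\<rfloor>" by (simp add: y_def)
        ultimately have "y \<in> Y" using x unfolding Y_def by blast
        moreover have "x \<in> unit_cube C y"
          unfolding unit_cube_def
        proof (rule PiE_I)
          fix v assume "v \<in> C"
          thus "x v \<in> {real_of_int (y v)..<real_of_int (y v) + 1}" using yC by simp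
        qed (use subsetD[OF body_extensional x] in \<open>auto simp: extensional_def\<close>)
        ultimately show "x \<in> (\<Union>y\<in>Y. unit_cube C y)" by blast
      qed
    qed simp
    also have "real (card Y) \<le> real (card (?S \<times> G))"
      unfolding of_nat_le_iff
      by (rule order_trans[OF card_mono[OF finI YI] card_image_le]) (use G(1) finite_sumset in simp)
    also have "card (?S \<times> G) = card G * card ?S" by (simp add: card_cartesian_product mult.commute)
    finally show ?thesis .
  qed
  thus ?thesis by blast
qed

text \<open>
  The two estimates sandwich the count along the ray between \<open>vol (n * t)\<close> and \<open>vol (n * t + 2 * c)\<close>.
  The constant \<open>c\<close> may be taken as large as desired.
\<close>

lemma count_tendsto:
  assumes full_rank: full_rank and G: "finite G" "transversal G"
  shows "\<exists>c. (\<forall>i. N \<le> c i) \<and> (\<forall>t. (\<lambda>n. real (card G * card (sumset (\<lambda>i. n * t i + c i))) / real n ^ card C)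
    \<longlonglongrightarrow> vol (\<lambda>i. real (t i)))"
proof -
  obtain K1 where K1: "\<And>K t. K \<ge> K1 \<Longrightarrow> real (card G * card (sumset t)) \<le> vol (\<lambda>i. real (t i + K * (m i + 1)))"
    using card_sumset_le_volume[OF assms] by blast
  obtain K2 where K2: "\<And>K t. K \<ge> K2 \<Longrightarrow> vol (\<lambda>i. real (t i)) \<le> real (card G * card (sumset (\<lambda>i. t i + K * (m i + 1))))"
    using volume_le_card_sumset[OF assms] by blast
  define K where "K = K1 + K2 + N"
  define c where "c i = K * (m i + 1)" for i
  have "N \<le> c i" for i unfolding c_def K_def by (simp add: add.assoc trans_le_add2 trans_le_add1 algebra_simps)
  moreover have "(\<lambda>n. real (card G * card (sumset (\<lambda>i. n * t i + c i))) / real n ^ card C) \<longlonglongrightarrow> vol (\<lambda>i. real (t i))" for t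
  proof (rule tendsto_sandwich[OF _ _ tendsto_const vol_tendsto[of t "\<lambda>i. c i + c i"]])
    show "\<forall>\<^sub>F n in sequentially. vol (\<lambda>i. real (t i)) \<le> real (card G * card (sumset (\<lambda>i. n * t i + c i))) / real n ^ card C"
      using eventually_gt_at_top[of 0]
    proof eventually_elim
      case (elim n)
      have "real n ^ card C * vol (\<lambda>i. real (t i)) = vol (\<lambda>i. real (n * t i))"
        using vol_scale[of "real n" "\<lambda>i. real (t i)"] elim by simp
      also have "\<dots> \<le> real (card G * card (sumset (\<lambda>i. n * t i + c i)))"
        unfolding c_def by (rule K2) (simp add: K_def)
      finally show ?case using elim by (simp add: field_simps)
    qed
    show "\<forall>\<^sub>F n in sequentially. real (card G * card (sumset (\<lambda>i. n * t i + c i))) / real n ^ card C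
        \<le> vol (\<lambda>i. real (n * t i + (c i + c i))) / real n ^ card C"
    proof (intro always_eventually allI divide_right_mono)
      fix n
      show "real (card G * card (sumset (\<lambda>i. n * t i + c i))) \<le> vol (\<lambda>i. real (n * t i + (c i + c i)))"
        using K1[of K "\<lambda>i. n * t i + c i"] by (simp add: c_def K_def add.assoc)
    qed simp
  qed
  ultimately show ?thesis by blast
qed

end

section \<open>Lattices of smaller rank\<close>

context graded_map
begin

text \<open>For \<open>n = 1\<close> and \<open>v \<noteq> x0\<close> these vectors are a basis of the integer vectors of total degree zero.\<close>

abbreviation unit_diff :: "'v \<Rightarrow> int \<Rightarrow> 'v \<Rightarrow> int"
  where "unit_diff v n \<equiv> \<lambda>w. (if w = v then n else 0) - (if w = x0 then n else 0)"

lemma generator_diff_lat: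
  assumes "j \<le> m i"
  shows "(\<lambda>v. int (a i j v) - int (a i 0 v)) \<in> lat"
proof -
  let ?e = "\<lambda>j i' j'. if i' = i then if j' = j then (1 :: int) else 0 else 0"
  have c: "comb (?e j) = (\<lambda>v. int (a i j v))" if "j \<le> m i" for j
  proof
    fix v
    have "comb (?e j) v = (\<Sum>i'\<in>UNIV. \<Sum>j'\<le>m i'. if i' = i then if j' = j then int (a i' j' v) else 0 else 0)"
      unfolding comb_def by (intro sum.cong refl) simp
    also have "\<dots> = (\<Sum>i'\<in>UNIV. if i' = i then (\<Sum>j'\<le>m i'. if j' = j then int (a i' j' v) else 0) else 0)"
      by (rule sum.cong) auto
    also have "\<dots> = int (a i j v)" using that by simp
    finally show "comb (?e j) v = int (a i j v)" .
  qed
  have s: "csum (?e j) = (\<lambda>i'. if i' = i then 1 else 0)" if "j \<le> m i" for j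
    using that by (intro ext) (simp add: csum_def)
  show ?thesis unfolding lat_def
    by (intro CollectI exI[of _ "\<lambda>i' j'. ?e j i' j' - ?e 0 i' j'"])
       (simp only: comb_diff csum_diff c[OF assms] c[OF le0] s[OF assms] s[OF le0], simp)
qed

text \<open>
  If no positive multiple of \<open>unit_diff v0 1\<close> lies in the lattice, then it is not in the rational
  span of the lattice, so a rational functional separates it from the lattice. The lattice, hence
  every body up to translation, lies in the kernel of that functional.
\<close>

lemma separating_functional:
  assumes v0: "v0 \<in> C" and notin: "\<And>n. n > 0 \<Longrightarrow> unit_diff v0 n \<notin> lat"
  obtains \<beta> :: "'v \<Rightarrow> rat" where "\<beta> x0 = 0" "\<beta> v0 \<noteq> 0"
    "\<And>u. u \<in> lat \<Longrightarrow> (\<Sum>w\<in>UNIV. of_int (u w) * \<beta> w) = 0"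
proof -
  define q where "q u = (\<chi> w. (of_int (u w) :: rat))" for u :: "'v \<Rightarrow> int"
  define e where "e = q (unit_diff v0 1)"
  \<comment> \<open>elements of the rational span become lattice vectors after clearing denominators\<close>
  have span: "\<exists>n>0. \<exists>u\<in>lat. of_int n *s x = q u" if "x \<in> vec.span (q ` lat)" for x
    using that
  proof (induction rule: vec.span_induct_alt)
    case base
    show ?case
      by (intro exI[of _ 1] conjI bexI[of _ "\<lambda>_. 0"] lat_zero) (auto simp: q_def vec_eq_iff)
  next
    case (step c x y)
    then obtain u' where u': "u' \<in> lat" "x = q u'" by blast
    obtain n u where nu: "n > 0" "u \<in> lat" "of_int n *s y = q u" using step.IH by blast
    obtain a b where ab: "c = Rat.Fract a b" "b > 0" using Rat_cases by blast
    have c: "of_int b * c = of_int a" using ab by (simp add: Fract_of_int_quotient)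
    have "of_int (b * n) *s (c *s x + y) = q (\<lambda>v. n * a * u' v + b * u v)"
    proof (subst vec_eq_iff, rule allI)
      fix w
      have y: "of_int n * y $ w = of_int (u w)" using arg_cong[OF nu(3), of "\<lambda>x. x $ w"] by (simp add: q_def)
      have "(of_int (b * n) *s (c *s x + y)) $ w = of_int n * (of_int b * c) * of_int (u' w) + of_int b * (of_int n * y $ w)"
        by (simp add: u'(2) q_def algebra_simps)
      also have "\<dots> = q (\<lambda>v. n * a * u' v + b * u v) $ w" unfolding c y by (simp add: q_def)
      finally show "(of_int (b * n) *s (c *s x + y)) $ w = q (\<lambda>v. n * a * u' v + b * u v) $ w" .
    qed
    moreover have "(\<lambda>v. n * a * u' v + b * u v) \<in> lat"
      by (intro lat_add lat_scale u'(1) nu(2))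
    moreover have "b * n > 0" using ab(2) nu(1) by simp
    ultimately show ?case by blast
  qed
  have eS: "e \<notin> vec.span (q ` lat)"
  proof
    assume "e \<in> vec.span (q ` lat)"
    then obtain n u where n: "n > 0" "u \<in> lat" "of_int n *s e = q u" using span by blast
    have "u = unit_diff v0 n"
    proof
      fix w
      have "(of_int n :: rat) * of_int (unit_diff v0 1 w) = of_int (u w)"
        using arg_cong[OF n(3), of "\<lambda>x. x $ w"] by (simp add: q_def e_def)
      hence "(of_int (n * unit_diff v0 1 w) :: rat) = of_int (u w)" by (simp only: of_int_mult)
      hence "n * unit_diff v0 1 w = u w" by (simp only: of_int_eq_iff)
      thus "u w = unit_diff v0 n w" by auto
    qed
    thus False using notin[OF n(1)] n(2) by simp
  qed
  obtain Bs where Bs: "Bs \<subseteq> q ` lat" "vec.independent Bs" "q ` lat \<subseteq> vec.span Bs"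
    using vec.maximal_independent_subset by blast
  have eB: "e \<notin> vec.span Bs" using eS vec.span_mono[OF Bs(1)] by blast
  have "vec.independent (insert e Bs)" by (rule vec.independent_insertI[OF eB Bs(2)])
  from vec.linear_independent_extend[OF this, of "\<lambda>x. if x = e then e else 0"]
  obtain g where g: "Vector_Spaces.linear (*s) (*s) g" "\<And>x. x \<in> insert e Bs \<Longrightarrow> g x = (if x = e then e else 0)"
    by blast
  interpret g: Vector_Spaces.linear "(*s)" "(*s)" g by (rule g(1))
  have ge: "g e = e" using g(2) by simp
  have gB: "g x = 0" if "x \<in> Bs" for x using g(2)[of x] that eB vec.span_base[of x Bs] by auto
  have gS: "g x = 0" if "x \<in> q ` lat" for x
    using vec.linear_eq_0_on_span[OF g(1) gB] Bs(3) that by blast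
  define \<alpha> where "\<alpha> w = g (axis w 1) $ v0" for w
  have gq: "g (q u) $ v0 = (\<Sum>w\<in>UNIV. of_int (u w) * \<alpha> w)" for u
  proof -
    have "q u = (\<Sum>w\<in>UNIV. of_int (u w) *s axis w 1)"
      using basis_expansion[of "q u"] by (simp add: q_def)
    hence "g (q u) = (\<Sum>w\<in>UNIV. of_int (u w) *s g (axis w 1))" by (simp add: g.sum g.scale)
    thus ?thesis by (simp add: \<alpha>_def)
  qed
  have v0x0: "v0 \<noteq> x0" using v0 by simp
  have "g (q (unit_diff v0 1)) $ v0 = 1" using ge v0x0 by (simp add: e_def q_def)
  moreover have "(\<Sum>w\<in>UNIV. of_int (unit_diff v0 1 w) * \<alpha> w) = \<alpha> v0 - \<alpha> x0"
  proof -
    have "(\<Sum>w\<in>UNIV. of_int (unit_diff v0 1 w) * \<alpha> w) =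
        (\<Sum>w\<in>UNIV. (if w = v0 then \<alpha> w else 0) - (if w = x0 then \<alpha> w else 0))"
      by (rule sum.cong) auto
    thus ?thesis by (simp add: sum_subtractf)
  qed
  ultimately have diff: "\<alpha> v0 - \<alpha> x0 = 1" using gq by metis
  show ?thesis
  proof (rule that[of "\<lambda>w. \<alpha> w - \<alpha> x0"])
    fix u assume u: "u \<in> lat"
    have "(\<Sum>w\<in>UNIV. of_int (u w) * (\<alpha> w - \<alpha> x0)) =
        (\<Sum>w\<in>UNIV. of_int (u w) * \<alpha> w) - of_int (\<Sum>w\<in>UNIV. u w) * \<alpha> x0"
      by (simp add: right_diff_distrib sum_subtractf sum_distrib_right)
    also have "\<dots> = 0" using gq[of u] gS[of "q u"] u by (simp add: lat_total)
    finally show "(\<Sum>w\<in>UNIV. of_int (u w) * (\<alpha> w - \<alpha> x0)) = 0" .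
  qed (use diff in auto)
qed

text \<open>
  The functional that vanishes on the lattice takes the same value on all generators \<open>a i j\<close> with
  the same \<open>i\<close>, so it is constant on each body.
\<close>

lemma vol_zero_if_not_full_rank:
  assumes "\<not> full_rank"
  shows "vol l = 0"
proof -
  obtain v0 where v0: "v0 \<in> C" "\<And>n. n > 0 \<Longrightarrow> unit_diff v0 n \<notin> lat"
    using assms unfolding full_rank_def by blast
  obtain \<beta>' :: "'v \<Rightarrow> rat" where b': "\<beta>' x0 = 0" "\<beta>' v0 \<noteq> 0"
    "\<And>u. u \<in> lat \<Longrightarrow> (\<Sum>w\<in>UNIV. of_int (u w) * \<beta>' w) = 0"
    using separating_functional[OF v0] by metis
  define \<beta> where "\<beta> w = real_of_rat (\<beta>' w)" for w
  have \<beta>: "\<beta> x0 = 0" "\<beta> v0 \<noteq> 0" using b' by (auto simp: \<beta>_def)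
  have \<beta>lat: "(\<Sum>w\<in>UNIV. real_of_int (u w) * \<beta> w) = 0" if "u \<in> lat" for u
  proof -
    have "(\<Sum>w\<in>UNIV. real_of_int (u w) * \<beta> w) = real_of_rat (\<Sum>w\<in>UNIV. of_int (u w) * \<beta>' w)"
      by (simp add: \<beta>_def of_rat_sum of_rat_mult)
    thus ?thesis using b'(3)[OF that] by simp
  qed
  define \<kappa> where "\<kappa> i = (\<Sum>w\<in>UNIV. real (a i 0 w) * \<beta> w)" for i
  have \<kappa>: "(\<Sum>w\<in>UNIV. real (a i j w) * \<beta> w) = \<kappa> i" if "j \<le> m i" for i j
    using \<beta>lat[OF generator_diff_lat[OF that]] by (simp add: \<kappa>_def left_diff_distrib sum_subtractf)
  show ?thesis unfolding vol_def
  proof (rule volume_hyperplane[where \<beta> = \<beta> and v = v0, OF _ body_sets body_subset_box v0(1) \<beta>(2)])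
    fix x assume "x \<in> body l"
    then obtain \<mu> where \<mu>: "csum \<mu> = l" "x = restrict (comb \<mu>) C" unfolding body_def by blast
    have "(\<Sum>w\<in>C. x w * \<beta> w) = (\<Sum>w\<in>C. comb \<mu> w * \<beta> w)" by (rule sum.cong) (auto simp: \<mu>(2))
    also have "\<dots> = (\<Sum>w\<in>UNIV. comb \<mu> w * \<beta> w)"
      by (rule sum.mono_neutral_left) (use \<beta> in auto)
    also have "\<dots> = (\<Sum>i\<in>UNIV. \<Sum>j\<le>m i. \<Sum>w\<in>UNIV. \<mu> i j * real (a i j w) * \<beta> w)"
      unfolding comb_def sum_distrib_right by (subst sum.swap) (rule sum.cong[OF refl], rule sum.swap)
    also have "\<dots> = (\<Sum>i\<in>UNIV. \<Sum>j\<le>m i. \<mu> i j * \<kappa> i)"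
      by (intro sum.cong refl) (simp add: mult.assoc sum_distrib_left[symmetric] \<kappa>)
    also have "\<dots> = (\<Sum>i\<in>UNIV. l i * \<kappa> i)" using \<mu>(1) by (auto simp: csum_def sum_distrib_right)
    finally show "(\<Sum>w\<in>C. x w * \<beta> w) = (\<Sum>i\<in>UNIV. l i * \<kappa> i)" .
  qed simp
qed

lemma unit_diff_total: "(\<Sum>w\<in>UNIV. unit_diff v n w) = 0"
  by (simp add: sum_subtractf)

text \<open>
  The multiples of a vector none of whose positive multiples lies in the lattice.
\<close>

lemma incongruent_family:
  assumes "\<not> full_rank"
  shows "\<exists>U. finite U \<and> card U = k \<and> (\<forall>u\<in>U. (\<Sum>w\<in>UNIV. u w) = (0::int)) \<and>
    (\<forall>u\<in>U. \<forall>u'\<in>U. (\<lambda>w. u w - u' w) \<in> lat \<longrightarrow> u = u')"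
proof -
  obtain v0 where v0: "v0 \<in> C" "\<And>n. n > 0 \<Longrightarrow> unit_diff v0 n \<notin> lat"
    using assms unfolding full_rank_def by blast
  have ud: "(\<lambda>w. unit_diff v0 n w - unit_diff v0 n' w) = unit_diff v0 (n - n')" for n n'
    by (rule ext) auto
  have eq: "i = i'" if l: "unit_diff v0 (int i - int i') \<in> lat" for i i'
  proof (rule ccontr)
    assume "i \<noteq> i'"
    hence "int i - int i' > 0 \<or> int i' - int i > 0" by linarith
    moreover have "unit_diff v0 (int i' - int i) \<in> lat"
    proof -
      have "(\<lambda>w. (- 1) * unit_diff v0 (int i - int i') w) = unit_diff v0 (int i' - int i)" by (rule ext) auto
      thus ?thesis using lat_scale[OF l, of "- 1"] by simp
    qed
    ultimately show False using v0(2) l by blast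
  qed
  let ?U = "(\<lambda>i. unit_diff v0 (int i)) ` {..<k}"
  have "inj_on (\<lambda>i. unit_diff v0 (int i)) {..<k}"
  proof (rule inj_onI)
    fix i i' assume "unit_diff v0 (int i) = unit_diff v0 (int i')"
    from fun_cong[OF this, of v0] show "i = i'" using v0(1) by simp
  qed
  hence "card ?U = k" by (simp add: card_image)
  moreover have "u = u'" if U: "u \<in> ?U" "u' \<in> ?U" "(\<lambda>w. u w - u' w) \<in> lat" for u u'
  proof -
    obtain i i' where i: "u = unit_diff v0 (int i)" "u' = unit_diff v0 (int i')" using U(1,2) by blast
    have "i = i'" using eq U(3) unfolding i ud by blast
    thus ?thesis unfolding i by (rule arg_cong[where f = "\<lambda>i. unit_diff v0 (int i)"])
  qed
  ultimately show ?thesis using unit_diff_total by (intro exI[of _ ?U]) blast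
qed

text \<open>
  Division with remainder by the multiples in the definition of full rank reduces every vector to one
  with bounded coordinates. Equal cosets choose equal representatives, because the choice only
  depends on the set of bounded vectors in the coset.
\<close>

lemma finite_transversal:
  assumes full_rank
  shows "\<exists>G. finite G \<and> transversal G"
proof -
  have "\<forall>v\<in>C. \<exists>n. n > 0 \<and> unit_diff v n \<in> lat" using assms unfolding full_rank_def by blast
  from bchoice[OF this] obtain n where n: "\<forall>v\<in>C. n v > 0 \<and> unit_diff v (n v) \<in> lat" ..
  define Bx where "Bx = {y :: 'v \<Rightarrow> int. (\<Sum>v\<in>UNIV. y v) = 0 \<and> (\<forall>v\<in>C. 0 \<le> y v \<and> y v < n v)}"
  have red: "\<exists>h\<in>Bx. (\<lambda>w. y w - h w) \<in> lat" if y: "(\<Sum>v\<in>UNIV. y v) = 0" for y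
  proof -
    let ?u = "\<lambda>w. \<Sum>v\<in>C. (y v div n v) * unit_diff v (n v) w"
    have "?u \<in> lat"
    proof -
      have "(\<lambda>w. \<Sum>v\<in>A. (y v div n v) * unit_diff v (n v) w) \<in> lat" if "A \<subseteq> C" for A
        using finite_subset[OF that] that
      proof (induction A rule: infinite_finite_induct)
        case (insert v A)
        hence "(\<lambda>w. (y v div n v) * unit_diff v (n v) w + (\<Sum>v\<in>A. (y v div n v) * unit_diff v (n v) w)) \<in> lat"
          by (intro lat_add lat_scale) (use n in auto)
        thus ?case using insert by simp
      qed (simp_all add: lat_zero)
      thus ?thesis by blast
    qed
    moreover have "(\<lambda>w. y w - ?u w) \<in> Bx"
    proof -
      have "(\<Sum>w\<in>UNIV. y w - ?u w) = 0" using lat_total[OF \<open>?u \<in> lat\<close>] y by (simp add: sum_subtractf)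
      moreover have "y w - ?u w = y w mod n w" if w: "w \<in> C" for w
      proof -
        have "?u w = (\<Sum>v\<in>C. if v = w then (y v div n v) * n v else 0)"
          by (rule sum.cong) (use w in auto)
        also have "\<dots> = (y w div n w) * n w" using w by simp
        finally show ?thesis by (simp add: minus_div_mult_eq_mod)
      qed
      ultimately show ?thesis unfolding Bx_def using n by simp
    qed
    ultimately show ?thesis by (intro bexI[of _ "\<lambda>w. y w - ?u w"]) simp_all
  qed
  have finB: "finite Bx"
  proof -
    have "inj_on (\<lambda>y. restrict y C) Bx"
    proof (rule inj_onI)
      fix y y' assume y: "y \<in> Bx" "y' \<in> Bx" "restrict y C = restrict y' C"
      show "y = y'"
      proof (rule eq_on_C_imp_eq)
        fix v assume "v \<in> C"
        thus "y v = y' v" using fun_cong[OF y(3), of v] by simp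
      qed (use y in \<open>simp add: Bx_def\<close>)
    qed
    moreover have "(\<lambda>y. restrict y C) ` Bx \<subseteq> PiE C (\<lambda>v. {0..<n v})"
    proof (rule image_subsetI)
      fix y assume "y \<in> Bx"
      thus "restrict y C \<in> PiE C (\<lambda>v. {0..<n v})" unfolding restrict_PiE_iff by (auto simp: Bx_def)
    qed
    moreover have "finite (PiE C (\<lambda>v. {0..<n v}))" by (intro finite_PiE) auto
    ultimately show ?thesis by (meson finite_imageD finite_subset)
  qed
  define rep where "rep y = (SOME h. h \<in> Bx \<and> (\<lambda>w. y w - h w) \<in> lat)" for y
  have rep: "rep y \<in> Bx \<and> (\<lambda>w. y w - rep y w) \<in> lat" if "(\<Sum>v\<in>UNIV. y v) = 0" for y
  proof -
    have "\<exists>h. h \<in> Bx \<and> (\<lambda>w. y w - h w) \<in> lat" using red[OF that] by blast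
    from someI_ex[OF this] show ?thesis unfolding rep_def .
  qed
  have repeq: "rep y = rep y'" if "(\<lambda>w. y w - y' w) \<in> lat" for y y'
  proof -
    have "(\<lambda>w. y w - h w) \<in> lat \<longleftrightarrow> (\<lambda>w. y' w - h w) \<in> lat" for h
      using lat_add[OF that, of "\<lambda>w. y' w - h w"] lat_diff[OF _ that, of "\<lambda>w. y w - h w"] by auto
    thus ?thesis unfolding rep_def by simp
  qed
  let ?L = "{y :: 'v \<Rightarrow> int. (\<Sum>v\<in>UNIV. y v) = 0}"
  have "finite (rep ` ?L)" by (rule finite_subset[OF _ finB]) (use rep in auto)
  moreover have "transversal (rep ` ?L)"
    unfolding transversal_def
  proof (intro conjI ballI allI impI)
    fix g assume "g \<in> rep ` ?L"
    thus "(\<Sum>v\<in>UNIV. g v) = 0" using rep by (auto simp: Bx_def)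
  next
    fix y :: "'v \<Rightarrow> int" assume "(\<Sum>v\<in>UNIV. y v) = 0"
    thus "\<exists>g\<in>rep ` ?L. (\<lambda>v. y v - g v) \<in> lat" using rep[of y] by blast
  next
    fix g h assume "g \<in> rep ` ?L" "h \<in> rep ` ?L" and gh: "(\<lambda>v. g v - h v) \<in> lat"
    then obtain y y' where y: "y \<in> ?L" "g = rep y" "y' \<in> ?L" "h = rep y'" by blast
    have "(\<lambda>w. y w - y' w) \<in> lat"
    proof -
      have "(\<lambda>w. y w - g w) \<in> lat" "(\<lambda>w. y' w - h w) \<in> lat" using rep[of y] rep[of y'] y by simp_all
      from lat_diff[OF lat_add[OF this(1) gh] this(2)]
      have "(\<lambda>w. (y w - g w) + (g w - h w) - (y' w - h w)) \<in> lat" .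
      thus ?thesis by simp
    qed
    thus "g = h" using repeq y by simp
  qed
  ultimately show ?thesis by blast
qed

end

section \<open>The polytopes of the statement\<close>

text \<open>
  The points of the family may coincide, so the weights belong to indices and not to points.
\<close>

lemma convex_hull_finite_family:
  fixes g :: "'j \<Rightarrow> 'a::real_vector"
  assumes "finite J"
  shows "convex hull (g ` J) = {\<Sum>j\<in>J. u j *\<^sub>R g j | u. (\<forall>j\<in>J. 0 \<le> u j) \<and> sum u J = 1}" (is "_ = ?R")
proof
  show "convex hull (g ` J) \<subseteq> ?R"
  proof (rule hull_minimal)
    show "g ` J \<subseteq> ?R"
    proof
      fix x assume "x \<in> g ` J"
      then obtain j where j: "j \<in> J" "x = g j" by blast
      let ?u = "\<lambda>i. if i = j then 1 else (0 :: real)"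
      have "(\<Sum>i\<in>J. ?u i *\<^sub>R g i) = (\<Sum>i\<in>J. if i = j then g i else 0)" by (rule sum.cong) auto
      hence "x = (\<Sum>i\<in>J. ?u i *\<^sub>R g i)" using assms j by simp
      moreover have "sum ?u J = 1" using assms j by simp
      ultimately show "x \<in> ?R" by (intro CollectI exI[of _ ?u]) auto
    qed
    show "convex ?R"
    proof (rule convexI)
      fix x y and s t :: real assume x: "x \<in> ?R" "y \<in> ?R" and st: "0 \<le> s" "0 \<le> t" "s + t = 1"
      obtain u where u: "x = (\<Sum>j\<in>J. u j *\<^sub>R g j)" "\<forall>j\<in>J. 0 \<le> u j" "sum u J = 1" using x(1) by blast
      obtain w where w: "y = (\<Sum>j\<in>J. w j *\<^sub>R g j)" "\<forall>j\<in>J. 0 \<le> w j" "sum w J = 1" using x(2) by blast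
      have "s *\<^sub>R x + t *\<^sub>R y = (\<Sum>j\<in>J. (s * u j + t * w j) *\<^sub>R g j)"
        by (simp add: u(1) w(1) scaleR_sum_right scaleR_left_distrib sum.distrib)
      moreover have "(\<Sum>j\<in>J. s * u j + t * w j) = 1"
        using u(3) w(3) st(3) by (simp add: sum.distrib sum_distrib_left[symmetric])
      moreover have "\<forall>j\<in>J. 0 \<le> s * u j + t * w j" using u(2) w(2) st by simp
      ultimately show "s *\<^sub>R x + t *\<^sub>R y \<in> ?R"
        by (intro CollectI exI[of _ "\<lambda>j. s * u j + t * w j"]) auto
    qed
  qed
  show "?R \<subseteq> convex hull (g ` J)"
  proof
    fix y assume "y \<in> ?R"
    then obtain u where u: "y = (\<Sum>j\<in>J. u j *\<^sub>R g j)" "\<forall>j\<in>J. 0 \<le> u j" "sum u J = 1" by blast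
    show "y \<in> convex hull (g ` J)" unfolding u(1)
      by (rule convex_sum[OF assms convex_convex_hull u(3)]) (use u(2) in \<open>auto intro: hull_inc\<close>)
  qed
qed

context graded_map
begin

lemma minkowski_body:
  assumes K: "\<And>i. K i = drop_coord x0 ` (convex hull ((\<lambda>j. \<chi> v. real (a i j v)) ` {..m i}))"
  shows "minkowski_comb C K l = body (\<lambda>i. real (l i))"
proof -
  have Kx: "y \<in> K i \<longleftrightarrow> (\<exists>u. (\<forall>j\<le>m i. 0 \<le> u j) \<and> sum u {..m i} = 1 \<and> y = (\<lambda>v\<in>C. \<Sum>j\<le>m i. u j * real (a i j v)))" for y i
  proof -
    have dc: "drop_coord x0 (\<Sum>j\<le>m i. u j *\<^sub>R (\<chi> v. real (a i j v))) = (\<lambda>v\<in>C. \<Sum>j\<le>m i. u j * real (a i j v))" for u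
      by (simp add: drop_coord_def sum_component)
    have "K i = {drop_coord x0 (\<Sum>j\<le>m i. u j *\<^sub>R (\<chi> v. real (a i j v))) | u. (\<forall>j\<in>{..m i}. 0 \<le> u j) \<and> sum u {..m i} = 1}"
      unfolding K convex_hull_finite_family[OF finite_atMost] by blast
    thus ?thesis unfolding dc by simp blast
  qed
  show ?thesis
  proof (intro equalityI subsetI)
    fix y assume "y \<in> minkowski_comb C K l"
    then obtain x where x: "y = (\<lambda>v\<in>C. \<Sum>i\<in>UNIV. real (l i) * x i v)" "\<forall>i. x i \<in> K i"
      unfolding minkowski_comb_def by blast
    from x(2) have "\<forall>i. \<exists>u. (\<forall>j\<le>m i. 0 \<le> u j) \<and> sum u {..m i} = 1 \<and> x i = (\<lambda>v\<in>C. \<Sum>j\<le>m i. u j * real (a i j v))"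
      unfolding Kx .
    from choice[OF this] obtain u where u: "\<forall>i. (\<forall>j\<le>m i. 0 \<le> u i j) \<and> sum (u i) {..m i} = 1 \<and>
      x i = (\<lambda>v\<in>C. \<Sum>j\<le>m i. u i j * real (a i j v))" ..
    show "y \<in> body (\<lambda>i. real (l i))"
    proof (rule bodyI[where \<mu> = "\<lambda>i j. real (l i) * u i j"])
      show "csum (\<lambda>i j. real (l i) * u i j) = (\<lambda>i. real (l i))"
        unfolding csum_scale using u by (simp add: csum_def)
      show "y = restrict (comb (\<lambda>i j. real (l i) * u i j)) C"
        unfolding x(1) by (rule ext) (auto simp: u comb_def sum_distrib_left mult.assoc)
    qed (use u in auto)
  next
    fix y assume "y \<in> body (\<lambda>i. real (l i))"
    then obtain \<mu> where \<mu>: "\<forall>i j. j \<le> m i \<longrightarrow> 0 \<le> \<mu> i j" "csum \<mu> = (\<lambda>i. real (l i))" "y = restrict (comb \<mu>) C"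
      unfolding body_def by blast
    define u where "u i j = (if l i = 0 then if j = 0 then 1 else 0 else \<mu> i j / real (l i))" for i j
    have lu: "real (l i) * u i j = \<mu> i j" if j: "j \<le> m i" for i j
    proof (cases "l i = 0")
      case True
      hence "sum (\<mu> i) {..m i} = 0" using fun_cong[OF \<mu>(2), of i] by (simp add: csum_def)
      hence "\<mu> i j = 0" using sum_nonneg_eq_0_iff[of "{..m i}" "\<mu> i"] \<mu>(1) j by simp
      thus ?thesis using True by simp
    qed (simp add: u_def)
    have us: "sum (u i) {..m i} = 1" for i
    proof (cases "l i = 0")
      case False
      have "sum (u i) {..m i} = csum \<mu> i / real (l i)" using False by (simp add: u_def csum_def sum_divide_distrib)
      thus ?thesis using False \<mu>(2) by simp
    qed (simp add: u_def)
    define x where "x i = (\<lambda>v\<in>C. \<Sum>j\<le>m i. u i j * real (a i j v))" for i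
    have "x i \<in> K i" for i
      unfolding Kx x_def by (intro exI[of _ "u i"] conjI us) (use \<mu>(1) in \<open>auto simp: u_def\<close>)
    moreover have "y = (\<lambda>v\<in>C. \<Sum>i\<in>UNIV. real (l i) * x i v)"
    proof
      fix v
      show "y v = (\<lambda>v\<in>C. \<Sum>i\<in>UNIV. real (l i) * x i v) v"
      proof (cases "v \<in> C")
        case True
        hence "y v = comb \<mu> v" by (simp add: \<mu>(3))
        also have "\<dots> = (\<Sum>i\<in>UNIV. \<Sum>j\<le>m i. real (l i) * u i j * real (a i j v))"
          unfolding comb_def by (intro sum.cong refl) (simp add: lu)
        also have "\<dots> = (\<Sum>i\<in>UNIV. real (l i) * x i v)"
          using True by (simp add: x_def sum_distrib_left mult.assoc)
        finally show ?thesis using True by simp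
      qed (simp add: \<mu>(3))
    qed
    ultimately show "y \<in> minkowski_comb C K l" unfolding minkowski_comb_def by blast
  qed
qed

end

section \<open>Homogeneous polynomials\<close>

lemma homogeneous_add: "homogeneous n P \<Longrightarrow> homogeneous n Q \<Longrightarrow> homogeneous n (P + Q)"
  using keys_add[of P Q] unfolding homogeneous_def by blast

lemma homogeneous_mult:
  fixes P Q :: "('v::finite, 'k::comm_ring_1) mpoly"
  assumes "homogeneous n P" "homogeneous n' Q"
  shows "homogeneous (n + n') (P * Q)"
  unfolding homogeneous_def
proof
  fix e assume "e \<in> keys (P * Q)"
  then obtain e1 e2 where "e = e1 + e2" "e1 \<in> keys P" "e2 \<in> keys Q" using keys_mult[of P Q] by blast
  thus "(\<Sum>v\<in>UNIV. lookup e v) = n + n'" using assms by (simp add: homogeneous_def lookup_add sum.distrib)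
qed

lemma lookup_mult_single:
  fixes P :: "('v::finite, 'k::comm_ring_1) mpoly"
  shows "lookup (P * single q 1) k = (\<Sum>e\<in>keys P. if e + q = k then lookup P e else 0)"
proof -
  have "P * single q 1 = (\<Sum>e\<in>keys P. single e (lookup P e)) * single q 1"
    by (rule arg_cong[where f = "\<lambda>P. P * single q 1", OF poly_mapping_sum_single])
  also have "\<dots> = (\<Sum>e\<in>keys P. single (e + q) (lookup P e))"
    by (simp add: sum_distrib_right mult_single)
  finally have "lookup (P * single q 1) k = (\<Sum>e\<in>keys P. lookup (single (e + q) (lookup P e)) k)"
    by (simp add: lookup_sum)
  also have "\<dots> = (\<Sum>e\<in>keys P. if e + q = k then lookup P e else 0)"
    by (rule sum.cong) (auto simp: lookup_single when_def)
  finally show ?thesis .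
qed

section \<open>Laurent monomials in the function field of projective space\<close>

definition xpow :: "('v::{finite,linorder} \<Rightarrow> nat) \<Rightarrow> ('v, 'k::field) mpoly"
  where "xpow e = single (exponent e) 1"

text \<open>
  The Laurent monomial with exponent \<open>u\<close>.
\<close>

definition laurent :: "('v::{finite,linorder} \<Rightarrow> int) \<Rightarrow> ('v, 'k::field) mpoly fract"
  where "laurent u = Fract (xpow (\<lambda>v. nat (u v))) (xpow (\<lambda>v. nat (- u v)))"

lemma xpow_mult: "xpow e * xpow e' = xpow (\<lambda>v. e v + e' v)"
proof -
  have "exponent e + exponent e' = exponent (\<lambda>v. e v + e' v)"
    by (rule poly_mapping_eqI) (simp add: lookup_add)
  thus ?thesis by (simp add: xpow_def mult_single)
qed

lemma xpow_nonzero [simp]: "xpow e \<noteq> (0 :: ('v::{finite,linorder}, 'k::field) mpoly)"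
proof
  assume "(xpow e :: ('v, 'k) mpoly) = 0"
  hence "lookup (xpow e :: ('v, 'k) mpoly) (exponent e) = 0" by simp
  thus False by (simp add: xpow_def)
qed

lemma Fract_xpow: "Fract (xpow p) (xpow q) = laurent (\<lambda>v. int (p v) - int (q v))"
proof -
  have "(\<lambda>v. p v + nat (- (int (p v) - int (q v)))) = (\<lambda>v. nat (int (p v) - int (q v)) + q v)"
    by (rule ext) linarith
  thus ?thesis unfolding laurent_def by (simp add: eq_fract xpow_mult)
qed

lemma laurent_mult: "laurent u * laurent w = (laurent (\<lambda>v. u v + w v) :: ('v::{finite,linorder}, 'k::field) mpoly fract)"
proof -
  have eq: "(\<lambda>v. int (nat (u v) + nat (w v)) - int (nat (- u v) + nat (- w v))) = (\<lambda>v. u v + w v)"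
    by (rule ext) linarith
  show ?thesis unfolding laurent_def[of u] laurent_def[of w] mult_fract xpow_mult by (simp only: Fract_xpow eq)
qed

lemma laurent_nat: "laurent (\<lambda>v. int (p v)) = Fract (xpow p :: ('v::{finite,linorder}, 'k::field) mpoly) 1"
proof -
  have "exponent (\<lambda>_ :: 'v. 0) = 0" by (rule poly_mapping_eqI) simp
  hence "xpow (\<lambda>_. 0) = (1 :: ('v, 'k) mpoly)" by (simp add: xpow_def)
  thus ?thesis by (simp add: laurent_def)
qed

lemma Fract_sum: "Fract (\<Sum>s\<in>S. P s) 1 = (\<Sum>s\<in>S. Fract (P s) (1 :: 'a::idom))"
proof -
  have add: "Fract (x + y) 1 = Fract x 1 + Fract y (1 :: 'a)" for x y by simp
  show ?thesis
    by (induction S rule: infinite_finite_induct) (simp_all add: Zero_fract_def[symmetric] add del: add_fract)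
qed

lemma Fract_eq_zero: "Fract P (1 :: 'a::idom) = 0 \<Longrightarrow> P = 0"
  by (simp add: Zero_fract_def eq_fract)

section \<open>The field extension defined by the monomial map\<close>

locale pointed_toric = toric m a f \<delta>
  for m :: "'p::finite \<Rightarrow> nat" and a :: "'p \<Rightarrow> nat \<Rightarrow> 'v::{finite,linorder} \<Rightarrow> nat"
    and f :: "'p \<Rightarrow> nat \<Rightarrow> ('v, 'k::field) mpoly" and \<delta> :: "'p \<Rightarrow> nat" +
  fixes x0 :: 'v

sublocale pointed_toric \<subseteq> graded_map m a \<delta> x0
  by unfold_locales (rule deg)

context pointed_toric
begin

abbreviation Q :: "('v, 'k) mpoly fract ring" where "Q \<equiv> ring_of_type_algebra"
abbreviation L :: "('v, 'k) mpoly fract set" where "L \<equiv> pullback_function_field m f"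
abbreviation KP :: "('v, 'k) mpoly fract set" where "KP \<equiv> proj_function_field"

text \<open>
  The denominators avoid the vanishing ideal exactly if they do not vanish after substitution.
\<close>

lemma L_iff: "x \<in> L \<longleftrightarrow> (\<exists>F G t. x = Fract (ev F) (ev G) \<and> F \<in> multi_piece m t \<and> G \<in> multi_piece m t \<and> ev G \<noteq> 0)"
proof -
  have "x \<in> L \<longleftrightarrow> (\<exists>F G t. x = Fract (ev F) (ev G) \<and> F \<in> multi_piece m t \<and> G \<in> multi_piece m t \<and> G \<notin> I)"
    unfolding pullback_function_field_def ev_def[symmetric] by simp
  also have "\<dots> \<longleftrightarrow> (\<exists>F G t. x = Fract (ev F) (ev G) \<and> F \<in> multi_piece m t \<and> G \<in> multi_piece m t \<and> ev G \<noteq> 0)"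
    by (intro ex_cong1 conj_cong refl) (simp add: piece_in_I_iff)
  finally show ?thesis .
qed

lemma L_I: "F \<in> multi_piece m t \<Longrightarrow> G \<in> multi_piece m t \<Longrightarrow> ev G \<noteq> 0 \<Longrightarrow> Fract (ev F) (ev G) \<in> L"
  using L_iff by blast

lemma L_const: "Fract (mpoly_const c) 1 \<in> L"
  using L_I[OF const_piece one_piece, of c] by (simp add: ev_const ev_one)

lemma L_zero: "0 \<in> L" and L_one: "1 \<in> L"
  using L_const[of 0] L_const[of 1] by (simp_all add: mpoly_const_zero mpoly_const_one Zero_fract_def One_fract_def)

lemma L_add:
  assumes "x \<in> L" "y \<in> L"
  shows "x + y \<in> L"
proof -
  obtain F G t where x: "x = Fract (ev F) (ev G)" "F \<in> multi_piece m t" "G \<in> multi_piece m t" "ev G \<noteq> 0"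
    using assms(1) L_iff by blast
  obtain F' G' t' where y: "y = Fract (ev F') (ev G')" "F' \<in> multi_piece m t'" "G' \<in> multi_piece m t'" "ev G' \<noteq> 0"
    using assms(2) L_iff by blast
  have "x + y = Fract (ev (F * G' + G * F')) (ev (G * G'))"
    using x y by (simp add: ev_add ev_mult mult_ac)
  moreover have "F * G' + G * F' \<in> multi_piece m (\<lambda>i. t i + t' i)"
    using x y by (intro multi_piece_closed)
  moreover have "G * G' \<in> multi_piece m (\<lambda>i. t i + t' i)" using x y by (intro multi_piece_closed)
  moreover have "ev (G * G') \<noteq> 0" using x y by (simp add: ev_mult)
  ultimately show ?thesis using L_iff by blast
qed

lemma L_mult:
  assumes "x \<in> L" "y \<in> L"
  shows "x * y \<in> L"
proof -
  obtain F G t where x: "x = Fract (ev F) (ev G)" "F \<in> multi_piece m t" "G \<in> multi_piece m t" "ev G \<noteq> 0"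
    using assms(1) L_iff by blast
  obtain F' G' t' where y: "y = Fract (ev F') (ev G')" "F' \<in> multi_piece m t'" "G' \<in> multi_piece m t'" "ev G' \<noteq> 0"
    using assms(2) L_iff by blast
  have "x * y = Fract (ev (F * F')) (ev (G * G'))" using x y by (simp add: ev_mult)
  moreover have "F * F' \<in> multi_piece m (\<lambda>i. t i + t' i)" "G * G' \<in> multi_piece m (\<lambda>i. t i + t' i)"
    using x y by (intro multi_piece_closed; simp)+
  moreover have "ev (G * G') \<noteq> 0" using x y by (simp add: ev_mult)
  ultimately show ?thesis using L_iff by blast
qed

lemma L_minus: "x \<in> L \<Longrightarrow> - x \<in> L"
  using L_mult[OF L_const[of "- 1"], of x]
  by (simp add: mpoly_const_def single_uminus One_fract_def[symmetric] flip: minus_fract)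

lemma L_inverse:
  assumes "x \<in> L" "x \<noteq> 0"
  shows "inverse x \<in> L"
proof -
  obtain F G t where x: "x = Fract (ev F) (ev G)" "F \<in> multi_piece m t" "G \<in> multi_piece m t" "ev G \<noteq> 0"
    using assms(1) L_iff by blast
  hence "ev F \<noteq> 0" using assms(2) by (auto simp: fract_collapse)
  thus ?thesis using L_I[OF x(3,2)] x(1) by simp
qed

lemma L_subfield: "subfield L Q"
proof -
  interpret Q: field Q by (rule field_from_type_algebra)
  have neg: "\<ominus>\<^bsub>Q\<^esub> x = - x" for x by (rule Q.minus_equality) auto
  have "subring L Q"
    by (rule Q.subringI) (use L_one L_minus L_mult L_add in \<open>auto simp: neg\<close>)
  moreover have "inv\<^bsub>Q\<^esub> x \<in> L" if "x \<in> L - {\<zero>\<^bsub>Q\<^esub>}" for x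
  proof -
    have "inv\<^bsub>Q\<^esub> x = inverse x" by (rule Q.comm_inv_char) (use that in auto)
    thus ?thesis using L_inverse that by auto
  qed
  ultimately show ?thesis by (rule Q.subfieldI')
qed

lemma L_laurent:
  assumes "u \<in> lat"
  shows "laurent u \<in> L"
proof -
  obtain z :: "'p \<Rightarrow> nat \<Rightarrow> int" where z: "u = comb z" "csum z = (\<lambda>_. 0)" using assms unfolding lat_def by blast
  let ?p = "\<lambda>i j. nat (z i j)" and ?n = "\<lambda>i j. nat (- z i j)"
  have d: "(\<lambda>i j. int (?p i j) - int (?n i j)) = z" by (intro ext) simp
  have c: "int (comb ?p v) - int (comb ?n v) = u v" for v
    using fun_cong[OF comb_diff[of "\<lambda>i j. int (?p i j)" "\<lambda>i j. int (?n i j)"], of v]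
    by (simp only: d comb_of_nat z(1))
  have "int (csum ?p i) - int (csum ?n i) = 0" for i
    using fun_cong[OF csum_diff[of "\<lambda>i j. int (?p i j)" "\<lambda>i j. int (?n i j)"], of i]
    by (simp only: d csum_of_nat z(2))
  hence "csum ?p = csum ?n" by (intro ext) simp
  hence pc: "single (yexp ?p) (1::'k) \<in> multi_piece m (csum ?n)" "single (yexp ?n) (1::'k) \<in> multi_piece m (csum ?n)"
    using single_yexp_piece[of ?p] single_yexp_piece[of ?n] by simp_all
  have e: "ev (single (yexp e) 1) = xpow (comb e)" for e by (simp add: ev_single_yexp xpow_def)
  have "Fract (xpow (comb ?p)) (xpow (comb ?n)) \<in> L"
    using L_I[OF pc] by (simp add: e)
  thus ?thesis unfolding Fract_xpow c .
qed

text \<open>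
  After clearing denominators the coefficients are polynomials of a common multidegree. All exponents
  of such a polynomial are congruent modulo the lattice, so the products with Laurent monomials of
  distinct cosets have disjoint supports, and there is no cancellation.
\<close>

lemma laurent_independent:
  assumes U: "finite U" "\<And>u u'. u \<in> U \<Longrightarrow> u' \<in> U \<Longrightarrow> (\<lambda>v. u v - u' v) \<in> lat \<Longrightarrow> u = u'"
    and c: "\<And>u. u \<in> U \<Longrightarrow> c u \<in> L" and zero: "(\<Sum>u\<in>U. c u * laurent u) = 0" and u0: "u0 \<in> U"
  shows "c u0 = 0"
proof -
  have "\<forall>u\<in>U. \<exists>x. c u = Fract (ev (fst x)) (ev (fst (snd x))) \<and> fst x \<in> multi_piece m (snd (snd x)) \<and>
      fst (snd x) \<in> multi_piece m (snd (snd x)) \<and> ev (fst (snd x)) \<noteq> 0"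
  proof
    fix u assume "u \<in> U"
    hence "c u \<in> L" by (rule c)
    then obtain F G t where "c u = Fract (ev F) (ev G)" "F \<in> multi_piece m t" "G \<in> multi_piece m t" "ev G \<noteq> 0"
      using L_iff by blast
    thus "\<exists>x. c u = Fract (ev (fst x)) (ev (fst (snd x))) \<and> fst x \<in> multi_piece m (snd (snd x)) \<and>
      fst (snd x) \<in> multi_piece m (snd (snd x)) \<and> ev (fst (snd x)) \<noteq> 0"
      by (intro exI[of _ "(F, G, t)"]) simp
  qed
  from bchoice[OF this] obtain y where y: "\<forall>u\<in>U. c u = Fract (ev (fst (y u))) (ev (fst (snd (y u)))) \<and>
      fst (y u) \<in> multi_piece m (snd (snd (y u))) \<and>
      fst (snd (y u)) \<in> multi_piece m (snd (snd (y u))) \<and> ev (fst (snd (y u))) \<noteq> 0" ..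
  define F where "F u = fst (y u)" for u
  define G where "G u = fst (snd (y u))" for u
  define t where "t u = snd (snd (y u))" for u
  have FG: "c u = Fract (ev (F u)) (ev (G u))" "F u \<in> multi_piece m (t u)" "G u \<in> multi_piece m (t u)" "ev (G u) \<noteq> 0"
    if "u \<in> U" for u using y that by (simp_all add: F_def G_def t_def)
  \<comment> \<open>bring the coefficients to a common denominator, the product of all \<open>ev (G u)\<close>\<close>
  define T where "T = (\<lambda>i. \<Sum>u\<in>U. t u i)"
  define H where "H u = F u * (\<Prod>u'\<in>U - {u}. G u')" for u
  have H: "H u \<in> multi_piece m T" if "u \<in> U" for u
  proof -
    have "H u \<in> multi_piece m (\<lambda>i. t u i + (\<Sum>u'\<in>U - {u}. t u' i))"
      unfolding H_def using FG that by (intro multi_piece_closed(3) multi_piece_prod) auto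
    also have "(\<lambda>i. t u i + (\<Sum>u'\<in>U - {u}. t u' i)) = T"
      unfolding T_def by (intro ext sum.remove[symmetric] U(1) that)
    finally show ?thesis .
  qed
  let ?g = "\<Prod>u\<in>U. ev (G u)"
  have g0: "?g \<noteq> 0" using FG(4) U(1) by simp
  have cH: "c u * Fract ?g 1 = Fract (ev (H u)) 1" if "u \<in> U" for u
  proof -
    have "?g = ev (G u) * (\<Prod>u'\<in>U - {u}. ev (G u'))" by (rule prod.remove[OF U(1) that])
    thus ?thesis using FG[OF that] by (simp add: H_def ev_mult ev_prod eq_fract mult_ac)
  qed
  \<comment> \<open>multiplication by a large monomial makes all exponents nonnegative\<close>
  define N where "N v = (\<Sum>u\<in>U. nat \<bar>u v\<bar>)" for v
  have N: "0 \<le> u v + int (N v)" if "u \<in> U" for u v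
  proof -
    have "nat \<bar>u v\<bar> \<le> N v" unfolding N_def by (rule member_le_sum[of u U "\<lambda>u. nat \<bar>u v\<bar>"]) (use that U(1) in auto)
    thus ?thesis by linarith
  qed
  define sh where "sh u = (\<lambda>v. nat (u v + int (N v)))" for u
  have lsh: "laurent u * laurent (\<lambda>v. int (N v)) = Fract (xpow (sh u)) 1" if "u \<in> U" for u
  proof -
    have "(\<lambda>v. u v + int (N v)) = (\<lambda>v. int (sh u v))" using N[OF that] by (simp add: sh_def)
    thus ?thesis by (simp add: laurent_mult laurent_nat[symmetric])
  qed
  have "(\<Sum>u\<in>U. ev (H u) * xpow (sh u)) = 0"
  proof (rule Fract_eq_zero)
    have "Fract (\<Sum>u\<in>U. ev (H u) * xpow (sh u)) 1 = (\<Sum>u\<in>U. Fract (ev (H u)) 1 * Fract (xpow (sh u)) 1)"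
      by (simp add: Fract_sum)
    also have "\<dots> = (\<Sum>u\<in>U. c u * laurent u * (Fract ?g 1 * laurent (\<lambda>v. int (N v))))"
      by (rule sum.cong) (simp_all add: cH[symmetric] lsh[symmetric] mult_ac del: mult_fract)
    also have "\<dots> = (\<Sum>u\<in>U. c u * laurent u) * (Fract ?g 1 * laurent (\<lambda>v. int (N v)))"
      by (simp only: sum_distrib_right)
    also have "\<dots> = 0" by (simp add: zero)
    finally show "Fract (\<Sum>u\<in>U. ev (H u) * xpow (sh u)) 1 = 0" .
  qed
  have "ev (H u0) = 0"
  proof (rule ccontr)
    assume "ev (H u0) \<noteq> 0"
    then obtain e where e: "e \<in> keys (ev (H u0))"
      by (metis keys_eq_empty ex_in_conv in_keys_iff lookup_zero poly_mapping_eqI)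
    let ?k = "e + exponent (sh u0)"
    have tm: "lookup (ev (H u) * xpow (sh u)) ?k = (if u = u0 then lookup (ev (H u0)) e else 0)" if u: "u \<in> U" for u
    proof (cases "u = u0")
      case True
      have "lookup (ev (H u0) * xpow (sh u0)) ?k = (\<Sum>e'\<in>keys (ev (H u0)). if e' = e then lookup (ev (H u0)) e' else 0)"
        unfolding xpow_def lookup_mult_single by (rule sum.cong) auto
      thus ?thesis using True e by simp
    next
      case False
      have "e' + exponent (sh u) \<noteq> ?k" if e': "e' \<in> keys (ev (H u))" for e'
      proof
        assume eq: "e' + exponent (sh u) = ?k"
        have S: "lookup e \<in> sumset T" "lookup e' \<in> sumset T"
          using keys_ev[OF H[OF u0] e] keys_ev[OF H[OF u] e'] .
        have "u v - u0 v = int (lookup e v) - int (lookup e' v)" for v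
        proof -
          have "lookup e' v + sh u v = lookup e v + sh u0 v"
            using arg_cong[OF eq, of "\<lambda>p. lookup p v"] by (simp add: lookup_add)
          hence "int (lookup e' v) + int (sh u v) = int (lookup e v) + int (sh u0 v)" by linarith
          thus ?thesis using N[OF u, of v] N[OF u0, of v] by (simp add: sh_def)
        qed
        hence "(\<lambda>v. u v - u0 v) \<in> lat" using sumset_diff_lat[OF S] by simp
        thus False using U(2)[OF u u0] False by blast
      qed
      hence "lookup (ev (H u) * xpow (sh u)) ?k = 0"
        unfolding xpow_def lookup_mult_single by (intro sum.neutral) auto
      thus ?thesis using False by simp
    qed
    have "0 = lookup (\<Sum>u\<in>U. ev (H u) * xpow (sh u)) ?k" using \<open>(\<Sum>u\<in>U. ev (H u) * xpow (sh u)) = 0\<close> by simp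
    also have "\<dots> = (\<Sum>u\<in>U. if u = u0 then lookup (ev (H u0)) e else 0)"
      unfolding lookup_sum by (rule sum.cong) (simp_all add: tm)
    also have "\<dots> = lookup (ev (H u0)) e" using U(1) u0 by simp
    finally show False using e by (simp add: in_keys_iff)
  qed
  hence "ev (F u0) = 0 \<or> (\<Prod>u'\<in>U - {u0}. ev (G u')) = 0" by (simp add: H_def ev_mult ev_prod)
  moreover have "(\<Prod>u'\<in>U - {u0}. ev (G u')) \<noteq> 0" using FG(4) U(1) by auto
  ultimately show ?thesis using FG(1)[OF u0] by (simp add: fract_collapse)
qed

lemma KP_I: "homogeneous n P \<Longrightarrow> homogeneous n R \<Longrightarrow> R \<noteq> 0 \<Longrightarrow> Fract P R \<in> KP"
  unfolding proj_function_field_def by blast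

lemma KP_E:
  assumes "x \<in> KP"
  obtains P R n where "x = Fract P R" "homogeneous n P" "homogeneous n R" "R \<noteq> 0"
  using assms unfolding proj_function_field_def by blast

lemma KP_add:
  assumes "x \<in> KP" "y \<in> KP"
  shows "x + y \<in> KP"
proof -
  obtain P R n where x: "x = Fract P R" "homogeneous n P" "homogeneous n R" "R \<noteq> 0" using assms(1) by (rule KP_E)
  obtain P' R' n' where y: "y = Fract P' R'" "homogeneous n' P'" "homogeneous n' R'" "R' \<noteq> 0" using assms(2) by (rule KP_E)
  have "homogeneous (n + n') (P * R' + P' * R)"
    using homogeneous_add[OF homogeneous_mult[OF x(2) y(3)], of "P' * R"] homogeneous_mult[OF y(2) x(3)] by (simp add: add.commute)
  thus ?thesis using KP_I[OF _ homogeneous_mult[OF x(3) y(3)]] x y by simp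
qed

lemma KP_mult:
  assumes "x \<in> KP" "y \<in> KP"
  shows "x * y \<in> KP"
proof -
  obtain P R n where x: "x = Fract P R" "homogeneous n P" "homogeneous n R" "R \<noteq> 0" using assms(1) by (rule KP_E)
  obtain P' R' n' where y: "y = Fract P' R'" "homogeneous n' P'" "homogeneous n' R'" "R' \<noteq> 0" using assms(2) by (rule KP_E)
  show ?thesis using KP_I[OF homogeneous_mult[OF x(2) y(2)] homogeneous_mult[OF x(3) y(3)]] x y by simp
qed

lemma homogeneous_ev:
  assumes "F \<in> multi_piece m t"
  shows "homogeneous (\<Sum>i\<in>UNIV. t i * \<delta> i) (ev F)"
  unfolding homogeneous_def
proof
  fix e assume "e \<in> keys (ev F)"
  hence "lookup e \<in> sumset t" by (rule keys_ev[OF assms])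
  then obtain e' where "lookup e = comb e'" "csum e' = t" unfolding sumset_def by blast
  thus "(\<Sum>v\<in>UNIV. lookup e v) = (\<Sum>i\<in>UNIV. t i * \<delta> i)" using comb_total[of e'] by simp
qed

lemma L_subset_KP: "L \<subseteq> KP"
proof
  fix x assume "x \<in> L"
  then obtain F G t where x: "x = Fract (ev F) (ev G)" "F \<in> multi_piece m t" "G \<in> multi_piece m t" "ev G \<noteq> 0"
    using L_iff by blast
  thus "x \<in> KP" using KP_I[OF homogeneous_ev[OF x(2)] homogeneous_ev[OF x(3)]] by simp
qed

lemma homogeneous_xpow: "homogeneous (\<Sum>v\<in>UNIV. e v) (xpow e)"
  by (simp add: homogeneous_def xpow_def)

lemma laurent_KP:
  assumes "(\<Sum>v\<in>UNIV. u v) = 0"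
  shows "laurent u \<in> KP"
proof -
  have "int (\<Sum>v\<in>UNIV. nat (u v)) - int (\<Sum>v\<in>UNIV. nat (- u v)) = (\<Sum>v\<in>UNIV. int (nat (u v)) - int (nat (- u v)))"
    by (simp only: of_nat_sum sum_subtractf)
  also have "\<dots> = (\<Sum>v\<in>UNIV. u v)" by (rule sum.cong) auto
  finally have "(\<Sum>v\<in>UNIV. nat (u v)) = (\<Sum>v\<in>UNIV. nat (- u v))" using assms by linarith
  hence "homogeneous (\<Sum>v\<in>UNIV. nat (u v)) (xpow (\<lambda>v. nat (- u v)) :: ('v, 'k) mpoly)"
    using homogeneous_xpow[of "\<lambda>v. nat (- u v)"] by simp
  thus ?thesis unfolding laurent_def by (intro KP_I[OF homogeneous_xpow]) simp_all
qed

lemma type_algebra_UNIV: "ring_of_type_algebra\<lparr>carrier := UNIV\<rparr> = ring_of_type_algebra"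
  by (simp add: ring_of_type_algebra_def)

lemma finsum_Q: "finite S \<Longrightarrow> finsum Q g S = sum g S"
proof -
  assume "finite S"
  moreover have "cring (ring_of_type_algebra\<lparr>carrier := UNIV\<rparr> :: ('v, 'k) mpoly fract ring)"
    unfolding type_algebra_UNIV by (rule cring_from_type_algebra)
  ultimately show ?thesis using finsum_type_algebra[of UNIV g S] by (simp add: type_algebra_UNIV)
qed

text \<open>
  The Laurent monomials of a transversal span a finite dimensional domain over the field of the
  image. Multiplication by a nonzero element of it is injective, hence surjective, so the span is
  a field; it contains all homogeneous polynomials divided by the power of \<open>x0\<close> of the same degree.
\<close>

lemma KP_dimension:
  assumes G: "finite G" "transversal G"
  shows "ring.dimension Q (card G) L KP"
proof -
  interpret Q: field Q by (rule field_from_type_algebra)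
  define V where "V = {\<Sum>s\<in>G. c s * laurent s | c. c \<in> G \<rightarrow> L}"
  have inc: "u = u'" if "u \<in> G" "u' \<in> G" "(\<lambda>v. u v - u' v) \<in> lat" for u u'
    using G(2) that unfolding transversal_def by blast
  have fam: "Q.dimension (card G) L {\<Sum>s\<in>G. c s * (w * laurent s) | c. c \<in> G \<rightarrow> L}"
    "\<exists>us. Q.independent L us \<and> length us = card G \<and> set us = (\<lambda>s. w * laurent s) ` G \<and>
      Q.Span L us = {\<Sum>s\<in>G. c s * (w * laurent s) | c. c \<in> G \<rightarrow> L}"
    if w: "w \<noteq> 0" for w
  proof -
    have ind: "c s = \<zero>\<^bsub>Q\<^esub>" if "c \<in> G \<rightarrow> L" "(\<Oplus>\<^bsub>Q\<^esub>s\<in>G. c s \<otimes>\<^bsub>Q\<^esub> (w * laurent s)) = \<zero>\<^bsub>Q\<^esub>" "s \<in> G" for c s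
    proof -
      have "(\<Sum>s\<in>G. c s * (w * laurent s)) = w * (\<Sum>s\<in>G. c s * laurent s)"
        by (simp add: sum_distrib_left mult_ac)
      hence sum0: "(\<Sum>s\<in>G. c s * laurent s) = 0" using that(2) w G(1) by (simp add: finsum_Q)
      have "c s = 0"
      proof (rule laurent_independent[where U = G and c = c])
        show "u = u'" if "u \<in> G" "u' \<in> G" "(\<lambda>v. u v - u' v) \<in> lat" for u u' using inc that by blast
        show "c u \<in> L" if "u \<in> G" for u using \<open>c \<in> G \<rightarrow> L\<close> that by auto
      qed (rule G(1) sum0 that(3))+
      thus ?thesis by simp
    qed
    have eq: "{\<Oplus>\<^bsub>Q\<^esub>s\<in>G. c s \<otimes>\<^bsub>Q\<^esub> (w * laurent s) | c. c \<in> G \<rightarrow> L} = {\<Sum>s\<in>G. c s * (w * laurent s) | c. c \<in> G \<rightarrow> L}"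
      using G(1) by (simp add: finsum_Q)
    note * = Q.dimension_family[OF L_subfield G(1), of "\<lambda>s. w * laurent s", unfolded eq]
    show "Q.dimension (card G) L {\<Sum>s\<in>G. c s * (w * laurent s) | c. c \<in> G \<rightarrow> L}"
      by (rule *(1)) (use ind in simp_all)
    show "\<exists>us. Q.independent L us \<and> length us = card G \<and> set us = (\<lambda>s. w * laurent s) ` G \<and>
      Q.Span L us = {\<Sum>s\<in>G. c s * (w * laurent s) | c. c \<in> G \<rightarrow> L}"
      by (rule *(2)) (use ind in simp_all)
  qed
  have dimV: "Q.dimension (card G) L V" using fam(1)[of 1] by (simp add: V_def)
  have VI: "x \<in> V" if "x = (\<Sum>s\<in>G. c s * laurent s)" "c \<in> G \<rightarrow> L" for x c
    using that unfolding V_def by blast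
  have Vadd: "x + y \<in> V" if xy: "x \<in> V" "y \<in> V" for x y
  proof -
    obtain c where c: "c \<in> G \<rightarrow> L" "x = (\<Sum>s\<in>G. c s * laurent s)" using xy(1) unfolding V_def by blast
    obtain d where d: "d \<in> G \<rightarrow> L" "y = (\<Sum>s\<in>G. d s * laurent s)" using xy(2) unfolding V_def by blast
    have "x + y = (\<Sum>s\<in>G. (c s + d s) * laurent s)" by (simp add: c d distrib_right sum.distrib)
    moreover have "(\<lambda>s. c s + d s) \<in> G \<rightarrow> L" using c(1) d(1) L_add by auto
    ultimately show ?thesis by (rule VI)
  qed
  have Vscale: "k * x \<in> V" if kx: "k \<in> L" "x \<in> V" for k x
  proof -
    obtain c where c: "c \<in> G \<rightarrow> L" "x = (\<Sum>s\<in>G. c s * laurent s)" using kx(2) unfolding V_def by blast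
    have "k * x = (\<Sum>s\<in>G. (k * c s) * laurent s)" by (simp add: c sum_distrib_left mult.assoc)
    moreover have "(\<lambda>s. k * c s) \<in> G \<rightarrow> L" using c(1) kx(1) L_mult by auto
    ultimately show ?thesis by (rule VI)
  qed
  have V0: "0 \<in> V" using L_zero unfolding V_def by (intro CollectI exI[of _ "\<lambda>_. 0"]) auto
  have Vsum: "(\<Sum>s\<in>S. g s) \<in> V" if "\<And>s. s \<in> S \<Longrightarrow> g s \<in> V" for g and S :: "'z set"
    using that by (induction S rule: infinite_finite_induct) (simp_all add: V0 Vadd)
  have Vlaurent: "laurent u \<in> V" if u: "(\<Sum>v\<in>UNIV. u v) = 0" for u
  proof -
    obtain g where g: "g \<in> G" "(\<lambda>v. u v - g v) \<in> lat" using G(2) u unfolding transversal_def by blast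
    have "(\<Sum>s\<in>G. (if s = g then laurent (\<lambda>v. u v - g v) else 0) * laurent s) =
        (\<Sum>s\<in>G. if s = g then laurent (\<lambda>v. u v - g v) * laurent s else (0 :: ('v, 'k) mpoly fract))"
      by (rule sum.cong) auto
    hence "laurent u = (\<Sum>s\<in>G. (if s = g then laurent (\<lambda>v. u v - g v) else 0) * laurent s :: ('v, 'k) mpoly fract)"
      using G(1) g(1) by (simp add: laurent_mult)
    moreover have "(\<lambda>s. if s = g then laurent (\<lambda>v. u v - g v) else 0) \<in> G \<rightarrow> L"
      using L_laurent[OF g(2)] L_zero by auto
    ultimately show ?thesis by (rule VI)
  qed
  have tot: "(\<Sum>v\<in>UNIV. g v) = 0" if "g \<in> G" for g using G(2) that unfolding transversal_def by blast
  have Vhom: "Fract P (xpow (\<lambda>v. if v = x0 then n else 0)) \<in> V" if P: "homogeneous n P" for P n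
  proof -
    let ?d = "xpow (\<lambda>v. if v = x0 then n else 0) :: ('v, 'k) mpoly"
    have inv: "Fract R ?d = Fract R 1 * Fract 1 ?d" for R by simp
    have "Fract P ?d = Fract (\<Sum>e\<in>keys P. single e (lookup P e)) 1 * Fract 1 ?d"
      unfolding inv[of P] by (rule arg_cong[where f = "\<lambda>P. Fract P 1 * Fract 1 ?d", OF poly_mapping_sum_single])
    also have "\<dots> = (\<Sum>e\<in>keys P. Fract (single e (lookup P e)) 1 * Fract 1 ?d)"
      unfolding Fract_sum sum_distrib_right ..
    also have "\<dots> \<in> V"
    proof (rule Vsum)
      fix e assume e: "e \<in> keys P"
      have "single e (lookup P e) = mpoly_const (lookup P e) * xpow (lookup e)"
        by (simp add: mpoly_const_def xpow_def mult_single)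
      hence "Fract (single e (lookup P e)) 1 * Fract 1 ?d = Fract (mpoly_const (lookup P e)) 1 * Fract (xpow (lookup e)) ?d"
        by simp
      moreover have "Fract (xpow (lookup e)) ?d \<in> V"
        unfolding Fract_xpow
      proof (rule Vlaurent)
        have "(\<Sum>v\<in>UNIV. lookup e v) = n" using P e by (simp add: homogeneous_def)
        hence "(\<Sum>v\<in>UNIV. int (lookup e v)) = int n" by (simp flip: of_nat_sum)
        moreover have "(\<Sum>v\<in>UNIV. int (if v = x0 then n else 0)) = int n" by (simp flip: of_nat_sum)
        ultimately show "(\<Sum>v\<in>UNIV. int (lookup e v) - int (if v = x0 then n else 0)) = 0"
          by (simp add: sum_subtractf)
      qed
      ultimately show "Fract (single e (lookup P e)) 1 * Fract 1 ?d \<in> V" using Vscale L_const by metis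
    qed
    finally show ?thesis .
  qed
  \<comment> \<open>a multiple of a basis by a nonzero element of \<open>V\<close> is again a basis of \<open>V\<close>\<close>
  have Vdiv: "x / w \<in> V" if x: "x \<in> V" and w: "w \<in> V" "w \<noteq> 0" for x w
  proof -
    obtain us where us: "Q.independent L us" "length us = card G" "set us = (\<lambda>s. w * laurent s) ` G"
      "Q.Span L us = {\<Sum>s\<in>G. c s * (w * laurent s) | c. c \<in> G \<rightarrow> L}" using fam(2)[OF w(2)] by blast
    obtain c where c: "c \<in> G \<rightarrow> L" "w = (\<Sum>s\<in>G. c s * laurent s)" using w(1) unfolding V_def by blast
    have "w * laurent s \<in> V" if s: "s \<in> G" for s
    proof -
      have "w * laurent s = (\<Sum>t\<in>G. c t * laurent (\<lambda>v. t v + s v))"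
        by (simp add: c(2) sum_distrib_right mult.assoc laurent_mult)
      also have "\<dots> \<in> V"
        by (intro Vsum Vscale Vlaurent) (use c(1) tot s in \<open>auto simp: sum.distrib\<close>)
      finally show ?thesis .
    qed
    hence "set us \<subseteq> V" unfolding us(3) by blast
    hence "Q.Span L us = V"
      using Q.independent_length_eq_dimension[OF L_subfield dimV us(1)] us(2) by blast
    then obtain d where d: "d \<in> G \<rightarrow> L" "x = (\<Sum>s\<in>G. d s * (w * laurent s))" using x us(4) by auto
    have "x / w = (\<Sum>s\<in>G. d s * laurent s)"
      using w(2) by (simp add: d(2) sum_divide_distrib)
    thus ?thesis using d(1) by (rule VI)
  qed
  have "V = KP"
  proof (intro equalityI subsetI)
    fix x assume "x \<in> V"
    then obtain c where c: "c \<in> G \<rightarrow> L" "x = (\<Sum>s\<in>G. c s * laurent s)" unfolding V_def by blast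
    have "(\<Sum>s\<in>S. c s * laurent s) \<in> KP" if "S \<subseteq> G" for S
      using finite_subset[OF that G(1)] that
    proof (induction S)
      case empty
      show ?case using L_zero L_subset_KP by auto
    next
      case (insert s S)
      thus ?case using c(1) L_subset_KP laurent_KP[OF tot] by (auto intro!: KP_add KP_mult)
    qed
    thus "x \<in> KP" using c(2) by blast
  next
    fix x assume "x \<in> KP"
    then obtain P R n where x: "x = Fract P R" "homogeneous n P" "homogeneous n R" "R \<noteq> 0" by (rule KP_E)
    let ?d = "xpow (\<lambda>v. if v = x0 then n else 0) :: ('v, 'k) mpoly"
    have "x = Fract P ?d / Fract R ?d" using x(1,4) by (simp add: divide_fract eq_fract)
    moreover have "Fract R ?d \<noteq> 0" using x(4) by (simp add: Zero_fract_def eq_fract)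
    ultimately show "x \<in> V" using Vdiv[OF Vhom[OF x(2)] Vhom[OF x(3)]] by simp
  qed
  thus ?thesis using dimV by simp
qed

lemma map_degree_transversal:
  assumes "finite G" "transversal G"
  shows "map_degree m f = card G"
proof -
  interpret Q: field Q by (rule field_from_type_algebra)
  note d = KP_dimension[OF assms]
  have "Q.dim L KP = card G" using Q.dimI[OF L_subfield d] by (simp add: over_def)
  moreover have "Q.finite_dimension L KP" using d by (rule Q.finite_dimensionI)
  ultimately show ?thesis unfolding map_degree_def Let_def by simp
qed

lemma map_degree_if_not_full_rank:
  assumes "\<not> full_rank"
  shows "map_degree m f = 0"
proof -
  interpret Q: field Q by (rule field_from_type_algebra)
  have "\<not> Q.finite_dimension L KP"
  proof
    assume "Q.finite_dimension L KP"
    then obtain n where n: "Q.dimension n L KP" unfolding Q.finite_dimension_def by blast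
    from incongruent_family[OF assms, of "Suc n"]
    obtain U where U: "finite U" "card U = Suc n" "\<forall>u\<in>U. (\<Sum>w\<in>UNIV. u w) = (0 :: int)"
      "\<forall>u\<in>U. \<forall>u'\<in>U. (\<lambda>w. u w - u' w) \<in> lat \<longrightarrow> u = u'"
      by (elim exE conjE)
    have ind: "c s = \<zero>\<^bsub>Q\<^esub>" if "c \<in> U \<rightarrow> L" "(\<Oplus>\<^bsub>Q\<^esub>s\<in>U. c s \<otimes>\<^bsub>Q\<^esub> laurent s) = \<zero>\<^bsub>Q\<^esub>" "s \<in> U" for c s
    proof -
      have "c s = 0"
      proof (rule laurent_independent[where U = U and c = c])
        show "u = u'" if "u \<in> U" "u' \<in> U" "(\<lambda>v. u v - u' v) \<in> lat" for u u' using U(4) that by blast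
        show "c u \<in> L" if "u \<in> U" for u using \<open>c \<in> U \<rightarrow> L\<close> that by auto
        show "(\<Sum>s\<in>U. c s * laurent s) = 0" using that(2) U(1) by (simp add: finsum_Q)
      qed (use U(1) that(3) in auto)
      thus ?thesis by simp
    qed
    have "\<exists>us. Q.independent L us \<and> length us = card U \<and> set us = laurent ` U \<and>
        Q.Span L us = {\<Oplus>\<^bsub>Q\<^esub>s\<in>U. c s \<otimes>\<^bsub>Q\<^esub> laurent s | c. c \<in> U \<rightarrow> L}"
    proof (rule Q.dimension_family(2)[OF L_subfield U(1)])
      fix c s assume "c \<in> U \<rightarrow> L" "(\<Oplus>\<^bsub>Q\<^esub>s\<in>U. c s \<otimes>\<^bsub>Q\<^esub> laurent s) = \<zero>\<^bsub>Q\<^esub>" "s \<in> U"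
      thus "c s = \<zero>\<^bsub>Q\<^esub>" by (rule ind)
    qed simp
    then obtain us where us: "Q.independent L us" "length us = card U" "set us = laurent ` U" by blast
    have "set us \<subseteq> KP" using us(3) U(3) laurent_KP by auto
    from Q.independent_length_le_dimension[OF L_subfield n us(1) this] show False using us(2) U(2) by simp
  qed
  thus ?thesis unfolding map_degree_def Let_def by simp
qed

section \<open>Comparison of the leading form with the volume\<close>

text \<open>
  In the case of full rank, \<open>card G\<close> times the Hilbert function has both the map degree times the
  multidegrees and the mixed volumes as coefficients of its leading form. Otherwise the map degree
  and all volumes vanish.
\<close>

theorem degree_times_multidegree:
  assumes vol: "\<And>l. volume C (minkowski_comb C K l) = vol (\<lambda>i. real (l i))"
    and d: "sum d UNIV = card C"
  shows "real (map_degree m f) * real_of_rat (multidegree m (image_closure m f) d) = mixed_volume C K d"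
proof (cases full_rank)
  case False
  have "mixed_volume C K d = 0"
    by (rule mixed_volume_eqI[where M = "\<lambda>_. 0"]) (simp_all add: vol vol_zero_if_not_full_rank[OF False] d)
  thus ?thesis by (simp add: map_degree_if_not_full_rank[OF False])
next
  case True
  then obtain G where G: "finite G" "transversal G" using finite_transversal by blast
  define e where "e = multidegree m (image_closure m f)"
  from multidegree_expansion obtain N where N: "finite {d. e d \<noteq> 0}"
    "\<forall>t. (\<forall>i. N \<le> t i) \<longrightarrow> (of_nat (card (sumset t)) :: rat) = (\<Sum>d | e d \<noteq> 0. e d * binom_prod d (\<lambda>i. of_nat (t i)))"
    unfolding e_def[symmetric] by (elim exE conjE)
  obtain c where c: "\<And>i. N \<le> c i" "\<And>t. (\<lambda>n. real (card G * card (sumset (\<lambda>i. n * t i + c i))) / real n ^ card C)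
    \<longlonglongrightarrow> vol (\<lambda>i. real (t i))" using count_tendsto[OF True G, of N] by blast
  define M where "M d = real (card G) * real_of_rat (e d)" for d
  have Gpos: "card G \<noteq> 0"
  proof
    assume "card G = 0"
    hence "G = {}" using G(1) by simp
    have "\<forall>y. (\<Sum>v\<in>UNIV. y v) = 0 \<longrightarrow> (\<exists>g\<in>G. (\<lambda>v. y v - g v) \<in> lat)"
      using G(2) unfolding transversal_def by blast
    from this[rule_format, of "\<lambda>_. 0"] show False using \<open>G = {}\<close> by simp
  qed
  have supp: "{d. M d \<noteq> 0} = {d. e d \<noteq> 0}" using Gpos by (simp add: M_def)
  have "vol (\<lambda>i. real (t i)) = (\<Sum>d | sum d UNIV = card C. M d * (\<Prod>i\<in>UNIV. real (t i) ^ d i / fact (d i)))" for t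
  proof (rule leading_form[where h = "\<lambda>t. real (card G * card (sumset t))" and N = N and c = c])
    show "finite {d. M d \<noteq> 0}" unfolding supp by (rule N(1))
    fix t :: "'p \<Rightarrow> nat" assume t: "\<And>i. N \<le> t i"
    have bp: "real_of_rat (binom_prod d (\<lambda>i. of_nat (t i))) = binom_prod d (\<lambda>i. real (t i))" for d
      by (simp add: binom_prod_def of_rat_prod flip: of_nat_add binomial_gbinomial)
    have "real (card (sumset t)) = real_of_rat (of_nat (card (sumset t)))" by simp
    also have "\<dots> = (\<Sum>d | e d \<noteq> 0. real_of_rat (e d) * binom_prod d (\<lambda>i. real (t i)))"
      using N(2) t by (simp add: of_rat_sum of_rat_mult bp)
    finally show "real (card G * card (sumset t)) = (\<Sum>d | M d \<noteq> 0. M d * binom_prod d (\<lambda>i. real (t i)))"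
      unfolding supp by (simp add: M_def sum_distrib_left mult.assoc)
  qed (use c in auto)
  hence "mixed_volume C K d = M d" by (intro mixed_volume_eqI d) (simp add: vol)
  thus ?thesis by (simp add: map_degree_transversal[OF G] M_def e_def)
qed

end

theorem theorem6p4:
  fixes f :: "'p::finite \<Rightarrow> nat \<Rightarrow> ('v::{finite,linorder}, 'k::field) mpoly"
    and m \<delta> d :: "'p \<Rightarrow> nat"
    and r :: nat
    and x0 :: 'v
  assumes "CARD('v) = r + 1"
    and "\<And>i. \<delta> i \<ge> 1"
    and "\<And>i j. j \<le> m i \<Longrightarrow> homogeneous (\<delta> i) (f i j)"
    and "\<And>i j. j \<le> m i \<Longrightarrow> is_monomial (f i j)"
    and "(\<Sum>i\<in>UNIV. d i) = r"
  shows "real (map_degree m f) * real_of_rat (multidegree m (image_closure m f) d)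
    = mixed_volume (- {x0}) (\<lambda>i. drop_coord x0 ` newton_polytope (f i ` {..m i})) d"
proof -
  define a where "a i j = lookup (SOME e. f i j = single e 1)" for i j
  have f_eq: "f i j = single (exponent (a i j)) 1" if "j \<le> m i" for i j
  proof -
    have "\<exists>e. f i j = single e 1" using assms(4)[OF that] by (simp add: is_monomial_def)
    from someI_ex[OF this] show ?thesis by (simp add: a_def)
  qed
  have deg: "(\<Sum>v\<in>UNIV. a i j v) = \<delta> i" if "j \<le> m i" for i j
    using assms(3)[OF that] by (simp add: f_eq[OF that] homogeneous_def)
  interpret pointed_toric m a f \<delta> x0
    by unfold_locales (use f_eq deg in auto)
  have newton: "newton_polytope (f i ` {..m i}) = convex hull ((\<lambda>j. \<chi> v. real (a i j v)) ` {..m i})" for i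
  proof -
    have "single e 1 = f i j \<longleftrightarrow> e = exponent (a i j)" if "j \<le> m i" for e j
    proof
      assume "single e 1 = f i j"
      hence "keys (single e (1::'k)) = keys (single (exponent (a i j)) (1::'k))" using f_eq[OF that] by simp
      thus "e = exponent (a i j)" by simp
    qed (simp add: f_eq[OF that])
    hence E: "single e 1 \<in> f i ` {..m i} \<longleftrightarrow> (\<exists>j\<le>m i. e = exponent (a i j))" for e
      by (auto simp: image_iff)
    have "{(\<chi> v. real (lookup e v)) | e. single e 1 \<in> f i ` {..m i}} =
        {(\<chi> v. real (lookup (exponent (a i j)) v)) | j. j \<le> m i}"
      unfolding E by blast
    also have "\<dots> = (\<lambda>j. \<chi> v. real (a i j v)) ` {..m i}" by auto
    finally have "{(\<chi> v. real (lookup e v)) | e. single e 1 \<in> f i ` {..m i}} = (\<lambda>j. \<chi> v. real (a i j v)) ` {..m i}" .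
    thus ?thesis by (simp add: newton_polytope_def)
  qed
  have "card (- {x0}) = r" using assms(1) by (simp add: Compl_eq_Diff_UNIV card_Diff_singleton)
  thus ?thesis
    using assms(5) by (intro degree_times_multidegree) (simp_all add: vol_def minkowski_body newton)
qed

end
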